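(* Let $n\geqslant 2$ and let $G$ and $G_*$ be two groups of Möbius transformations of the unit ball $\mathbb{B}^n$ onto itself, acting discontinuously on $\mathbb{B}^n$ and not having fixed points in $\mathbb{B}^n$. Let $D$ and $D_*$ be domains in $\mathbb{B}^n/G$ and $\mathbb{B}^n/G_*$, respectively, having compact closures $\overline{D}$ and $\overline{D_*}$. Let $f:D\rightarrow D_*$ be an open discrete almost everywhere differentiable mapping, $f\in ACP$, having the $N$- and $N^{-1}$-Luzin properties. Suppose that $\Gamma$ is a family of paths in $D$, and let $f(\Gamma)=\{f\circ\gamma:\gamma\in\Gamma\}$. Then $$M(\Gamma)\leqslant\int_{f(D)}K_I(p_*,f^{-1})\cdot\rho_*^n(p_* )\,d\widetilde{h_*}(p_* )\qquad\text{for every }\rho_*\in\mathrm{adm}\,f(\Gamma),$$ where $K_I(p_*,f^{-1}):=\sum_{p\in D\cap f^{-1}(p_* )}K_O(p,f)$.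
   Context: Groups and quotient. $\mathbb{B}^n$ is the open unit ball of $\mathbb{R}^n$ with hyperbolic distance $h(x,y)=\log\frac{1+t}{1-t}$, $t=\frac{|x-y|}{\sqrt{|x-y|^2+(1-|x|^2)(1-|y|^2)}}$, which is invariant under Möbius transformations of $\mathbb{B}^n$ onto itself. A group $G$ of such transformations acts discontinuously on $\mathbb{B}^n$ if each $x\in\mathbb{B}^n$ has a neighborhood $U$ with $g(U)\cap U=\varnothing$ for all but finitely many $g\in G$; $G$ has no fixed points in $\mathbb{B}^n$ if $g(a)=a$ with $a\in\mathbb{B}^n$, $g\in G$, is possible only for $g=I$ (identity). $\mathbb{B}^n/G$ is the space of orbits, $\pi:\mathbb{B}^n\to\mathbb{B}^n/G$ the natural projection, and $\widetilde h(p_1,p_2)=\inf_{g_1,g_2\in G}h(g_1(z_1),g_2(z_2))$, where $p_i=\pi(z_i)$. If $G$ is a group of Möbius transformations of $\mathbb{B}^n$, $n\geqslant 2$, onto itself, acting discontinuously on $\mathbb{B}^n$ and not having fixed points in $\mathbb{B}^n$, then $\widetilde h$ is a metric on $\mathbb{B}^n/G$ inducing its topology, $\pi$ is a local homeomorphism, and the local inverses of $\pi$ are charts ("local coordinates") with conformal transition maps. The corresponding objects for $G_*$ are denoted $\pi_*$, $\widetilde{h_*}$. A domain is a nonempty open connected set. Mappings $f:D\to D_*$ are continuous. Measure. For a (measurable) set $A\subset\mathbb{B}^n/G$ its hyperbolic measure, also denoted $\widetilde h(A)$, is $V(P\cap\pi^{-1}(A))$, where $V(E)=\int_E\frac{2^n\,dm(x)}{(1-|x|^2)^n}$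 ($m$ is Lebesgue measure) and $P=\{p\in\mathbb{B}^n: h(p,p_0)<h(p,T(p_0))\ \text{for all } T\in G\setminus\{I\}\}$ is a normal fundamental polyhedron with center $p_0$. Integration with respect to this measure is denoted $d\widetilde h$ (and $d\widetilde{h_*}$ for $G_*$); "almost everywhere" refers to it. Paths and modulus. A path in $\mathbb{B}^n/G$ is a continuous map of a finite segment, interval or half-interval into $\mathbb{B}^n/G$. The length of $\gamma:[a,b]\to\mathbb{B}^n/G$ is the supremum of $\sum_k\widetilde h(\gamma(t_k),\gamma(t_{k+1}))$ over partitions of $[a,b]$; $\gamma$ is locally rectifiable if every closed subpath has finite length. For a rectifiable path $\gamma$ with arc-length (normal) representation $\gamma^0:[0,l(\gamma)]\to\mathbb{B}^n/G$, $\int_\gamma\rho\,ds_{\widetilde h}=\int_0^{l(\gamma)}\rho(\gamma^0(s))\,ds$; for locally rectifiable $\gamma$ one takes the supremum over closed subpaths. A Borel function $\rho:\mathbb{B}^n/G\to[0,\infty]$ is admissible for a family $\Gamma$ of paths, $\rho\in\mathrm{adm}\,\Gamma$, if $\int_\gamma\rho\,ds_{\widetilde h}\geqslant1$ for each locally rectifiable $\gamma\in\Gamma$; $M(\Gamma)=\inf_{\rho\in\mathrm{adm}\,\Gamma}\int_{\mathbb{B}^n/G}\rho^n\,d\widetilde h$. The same definitions apply with $G_*$, $\widetilde{h_*}$. A property holds for almost all paths if the family of paths for which it fails has modulus zero. Classes of mappings. $f:D\to D_*$ is discrete if $f^{-1}(y)$ consists of isolated points for each $y\in D_*$; open if images of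 open subsets of $D$ are open. $f$ has the $N$-Luzin property if $\widetilde{h_*}(f(E))=0$ whenever $E\subset D$, $\widetilde h(E)=0$; it has the $N^{-1}$-Luzin property if $\widetilde h(f^{-1}(E_* ))=0$ whenever $E_*\subset D_*$, $\widetilde{h_*}(E_* )=0$. Almost everywhere differentiability is understood in local coordinates. For a locally rectifiable path $\gamma$ on an interval $\Delta$ with base point $t_0$ ($t_0=a$ if $\gamma$ is defined on $[a,b]$ or $[a,b)$), $l_\gamma(t)$ is the length of $\gamma|_{[t_0,t]}$ for $t>t_0$, minus the length of $\gamma|_{[t,t_0]}$ for $t<t_0$, and $l_\gamma(t_0)=0$; $\Delta_\gamma=l_\gamma(\Delta)$. If $\widetilde\gamma=f\circ\gamma$ is also locally rectifiable, $L_{\gamma,f}:\Delta_\gamma\to\Delta_{\widetilde\gamma}$ is the unique non-decreasing function with $L_{\gamma,f}(l_\gamma(t))=l_{\widetilde\gamma}(t)$ for all $t\in\Delta$. $f\in ACP$ means: for almost all paths $\gamma$ in $D$, the path $\widetilde\gamma=f\circ\gamma$ is locally rectifiable and $L_{\gamma,f}$ is absolutely continuous on all closed segments lying in $\Delta_\gamma$. Outer dilatation. For $F$ between domains in $\mathbb{R}^n$, differentiable at $x$, put $\Vert F'(x)\Vert=\max_{|v|=1}|F'(x)v|$, $J(x,F)=\det F'(x)$, and $K_O(x,F)=\Vert F'(x)\Vert^n/|J(x,F)|$ if $J(x,F)\ne0$, $K_O(x,F)=1$ if $F'(x)=0$, $K_O(x,F)=\infty$ otherwise. For $f:D\to D_*$,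 $K_O(p,f)=K_O(\varphi(p),\psi\circ f\circ\varphi^{-1})$, where $\varphi$, $\psi$ are local coordinates (local inverses of $\pi$, $\pi_*$) at $p$ and $f(p)$; this does not depend on the choice. *)

theory Defs
  imports "HOL-Analysis.Analysis" "HOL-Algebra.Bij"
begin

section \<open>Moebius transformations of the unit ball\<close>

abbreviation unit_ball :: "(real^'n) set" where
  "unit_ball \<equiv> ball 0 1"

text \<open>Extended space: \<open>None\<close> is the point at infinity, as in the library's
  \<open>Alexandroff_compactification\<close>.\<close>

fun hyperplane_reflection :: "real^'n \<Rightarrow> real \<Rightarrow> (real^'n) option \<Rightarrow> (real^'n) option" where
  "hyperplane_reflection a t None = None"
| "hyperplane_reflection a t (Some x) = Some (x - (2 * (x \<bullet> a - t) / (a \<bullet> a)) *\<^sub>R a)"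

fun sphere_inversion :: "real^'n \<Rightarrow> real \<Rightarrow> (real^'n) option \<Rightarrow> (real^'n) option" where
  "sphere_inversion a r None = Some a"
| "sphere_inversion a r (Some x) =
     (if x = a then None else Some (a + (r\<^sup>2 / (norm (x - a))\<^sup>2) *\<^sub>R (x - a)))"

inductive_set moebius_maps :: "((real^'n) option \<Rightarrow> (real^'n) option) set" where
  moebius_id: "id \<in> moebius_maps"
| moebius_hyperplane: "F \<in> moebius_maps \<Longrightarrow> a \<noteq> 0 \<Longrightarrow> hyperplane_reflection a t \<circ> F \<in> moebius_maps"
| moebius_sphere: "F \<in> moebius_maps \<Longrightarrow> r > 0 \<Longrightarrow> sphere_inversion a r \<circ> F \<in> moebius_maps"

text \<open>Elements of \<^const>\<open>Bij\<close> are extensional, so a map of the ball is determined by its values there.\<close>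

definition moebius_ball_maps :: "(real^'n \<Rightarrow> real^'n) set" where
  "moebius_ball_maps =
     {g \<in> Bij unit_ball. \<exists>F\<in>moebius_maps. \<forall>x\<in>unit_ball. F (Some x) = Some (g x)}"

definition moebius_ball_group :: "(real^'n \<Rightarrow> real^'n) set \<Rightarrow> bool" where
  "moebius_ball_group G \<longleftrightarrow> G \<subseteq> moebius_ball_maps \<and> subgroup G (BijGroup unit_ball)"

definition acts_discontinuously :: "(real^'n \<Rightarrow> real^'n) set \<Rightarrow> bool" where
  "acts_discontinuously G \<longleftrightarrow>
     (\<forall>x\<in>unit_ball. \<exists>U. open U \<and> x \<in> U \<and> U \<subseteq> unit_ball \<and> finite {g\<in>G. g ` U \<inter> U \<noteq> {}})"

definition fixed_point_free :: "(real^'n \<Rightarrow> real^'n) set \<Rightarrow> bool" where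
  "fixed_point_free G \<longleftrightarrow> (\<forall>g\<in>G. \<forall>a\<in>unit_ball. g a = a \<longrightarrow> g = \<one>\<^bsub>BijGroup unit_ball\<^esub>)"

definition hyp_dist :: "real^'n \<Rightarrow> real^'n \<Rightarrow> real" where
  "hyp_dist x y =
     (let t = norm (x - y) / sqrt ((norm (x - y))\<^sup>2 + (1 - (norm x)\<^sup>2) * (1 - (norm y)\<^sup>2))
      in ln ((1 + t) / (1 - t)))"

section \<open>The orbit space\<close>

definition orbit_proj :: "(real^'n \<Rightarrow> real^'n) set \<Rightarrow> real^'n \<Rightarrow> (real^'n) set" where
  "orbit_proj G z = (\<lambda>g. g z) ` G"

definition orbit_space :: "(real^'n \<Rightarrow> real^'n) set \<Rightarrow> (real^'n) set set" where
  "orbit_space G = orbit_proj G ` unit_ball"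

definition orbit_vimage :: "(real^'n \<Rightarrow> real^'n) set \<Rightarrow> (real^'n) set set \<Rightarrow> (real^'n) set" where
  "orbit_vimage G A = {z \<in> unit_ball. orbit_proj G z \<in> A}"

definition orbit_topology :: "(real^'n \<Rightarrow> real^'n) set \<Rightarrow> (real^'n) set topology" where
  "orbit_topology G = topology (\<lambda>U. U \<subseteq> orbit_space G \<and> open (orbit_vimage G U))"

lemma openin_orbit_topology:
  "openin (orbit_topology G) U \<longleftrightarrow> U \<subseteq> orbit_space G \<and> open (orbit_vimage G U)"
proof -
  have "istopology (\<lambda>U. U \<subseteq> orbit_space G \<and> open (orbit_vimage G U))"
    unfolding istopology_def
  proof (intro conjI allI impI)
    fix S T
    assume S: "S \<subseteq> orbit_space G \<and> open (orbit_vimage G S)"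
      and T: "T \<subseteq> orbit_space G \<and> open (orbit_vimage G T)"
    show "S \<inter> T \<subseteq> orbit_space G" using S by blast
    have "orbit_vimage G (S \<inter> T) = orbit_vimage G S \<inter> orbit_vimage G T"
      by (auto simp: orbit_vimage_def)
    then show "open (orbit_vimage G (S \<inter> T))" using S T by auto
  next
    fix \<K>
    assume K: "\<forall>K\<in>\<K>. K \<subseteq> orbit_space G \<and> open (orbit_vimage G K)"
    show "\<Union>\<K> \<subseteq> orbit_space G" using K by blast
    have "orbit_vimage G (\<Union>\<K>) = (\<Union>K\<in>\<K>. orbit_vimage G K)"
      by (auto simp: orbit_vimage_def)
    then show "open (orbit_vimage G (\<Union>\<K>))" using K by auto
  qed
  then show ?thesis
    unfolding orbit_topology_def by (simp add: topology_inverse')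
qed

lemma topspace_orbit_topology [simp]: "topspace (orbit_topology G) = orbit_space G"
proof -
  have "orbit_vimage G (orbit_space G) = unit_ball"
    by (auto simp: orbit_vimage_def orbit_space_def)
  then have "openin (orbit_topology G) (orbit_space G)"
    by (simp add: openin_orbit_topology)
  then show ?thesis
    by (meson openin_orbit_topology openin_subset openin_topspace subset_antisym)
qed

text \<open>The points of an orbit are the images \<open>g z\<close> of any of its representatives, so this is the
  infimum of \<open>hyp_dist (g\<^sub>1 z\<^sub>1) (g\<^sub>2 z\<^sub>2)\<close> over the group.\<close>

definition orbit_dist :: "(real^'n) set \<Rightarrow> (real^'n) set \<Rightarrow> real" where
  "orbit_dist p q = Inf {hyp_dist x y |x y. x \<in> p \<and> y \<in> q}"

definition orbit_domain :: "(real^'n \<Rightarrow> real^'n) set \<Rightarrow> (real^'n) set set \<Rightarrow> bool" where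
  "orbit_domain G D \<longleftrightarrow>
     D \<noteq> {} \<and> openin (orbit_topology G) D \<and> connectedin (orbit_topology G) D"

section \<open>Hyperbolic measure\<close>

definition hyp_volume :: "(real^'n) measure" where
  "hyp_volume =
     density (restrict_space lebesgue unit_ball)
       (\<lambda>x. ennreal (2 ^ CARD('n) / (1 - (norm x)\<^sup>2) ^ CARD('n)))"

definition normal_polyhedron :: "(real^'n \<Rightarrow> real^'n) set \<Rightarrow> real^'n \<Rightarrow> (real^'n) set" where
  "normal_polyhedron G p0 =
     {p \<in> unit_ball. \<forall>T \<in> G - {\<one>\<^bsub>BijGroup unit_ball\<^esub>}. hyp_dist p p0 < hyp_dist p (T p0)}"

text \<open>The value does not depend on the center \<open>p0\<close>. Non-measurable sets have \<^const>\<open>emeasure\<close>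
  zero by convention, so measure zero is expressed by \<^const>\<open>null_sets\<close>.\<close>

definition orbit_measure ::
    "(real^'n \<Rightarrow> real^'n) set \<Rightarrow> real^'n \<Rightarrow> (real^'n) set measure" where
  "orbit_measure G p0 =
     measure_of (orbit_space G)
       {A. A \<subseteq> orbit_space G \<and> orbit_vimage G A \<in> sets hyp_volume}
       (\<lambda>A. emeasure hyp_volume (normal_polyhedron G p0 \<inter> orbit_vimage G A))"

definition orbit_borel :: "(real^'n \<Rightarrow> real^'n) set \<Rightarrow> (real^'n) set measure" where
  "orbit_borel G = sigma (orbit_space G) {U. openin (orbit_topology G) U}"

section \<open>Paths and modulus\<close>

text \<open>A path is a pair of its parameter interval and a map, whose values off the interval are
  irrelevant.\<close>

type_synonym 'n orbit_path = "real set \<times> (real \<Rightarrow> (real^'n) set)"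

definition parameter_interval :: "real set \<Rightarrow> bool" where
  "parameter_interval \<Delta> \<longleftrightarrow>
     (\<exists>a b. a < b \<and> (\<Delta> = {a..b} \<or> \<Delta> = {a<..<b} \<or> \<Delta> = {a..<b} \<or> \<Delta> = {a<..b}))"

definition paths_in ::
    "(real^'n \<Rightarrow> real^'n) set \<Rightarrow> (real^'n) set set \<Rightarrow> 'n orbit_path set" where
  "paths_in G D =
     {(\<Delta>, \<gamma>). parameter_interval \<Delta> \<and>
        continuous_map (top_of_set \<Delta>) (orbit_topology G) \<gamma> \<and> \<gamma> ` \<Delta> \<subseteq> D}"

definition image_path ::
    "((real^'n) set \<Rightarrow> (real^'n) set) \<Rightarrow> 'n orbit_path \<Rightarrow> 'n orbit_path" where
  "image_path f = (\<lambda>(\<Delta>, \<gamma>). (\<Delta>, f \<circ> \<gamma>))"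

text \<open>The length of the restriction of \<open>\<gamma>\<close> to \<open>[a, b]\<close>.\<close>

definition path_len :: "(real \<Rightarrow> (real^'n) set) \<Rightarrow> real \<Rightarrow> real \<Rightarrow> ennreal" where
  "path_len \<gamma> a b =
     (SUP (m, t) \<in> {(m::nat, t). t 0 = a \<and> t m = b \<and> (\<forall>k<m. t k \<le> t (Suc k))}.
        \<Sum>k<m. ennreal (orbit_dist (\<gamma> (t k)) (\<gamma> (t (Suc k)))))"

definition locally_rectifiable :: "'n::finite orbit_path \<Rightarrow> bool" where
  "locally_rectifiable = (\<lambda>(\<Delta>, \<gamma>). \<forall>a b. a \<le> b \<and> {a..b} \<subseteq> \<Delta> \<longrightarrow> path_len \<gamma> a b < \<infinity>)"

text \<open>The normal representation of \<open>\<gamma>\<close> on \<open>[a, b]\<close>: the choice of \<open>t\<close> does not matter, since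
  \<open>\<gamma>\<close> is constant on every interval on which its length function is.\<close>

definition normal_rep ::
    "(real \<Rightarrow> (real^'n) set) \<Rightarrow> real \<Rightarrow> real \<Rightarrow> real \<Rightarrow> (real^'n) set" where
  "normal_rep \<gamma> a b s = \<gamma> (SOME t. t \<in> {a..b} \<and> enn2real (path_len \<gamma> a t) = s)"

text \<open>Meaningful for locally rectifiable paths. The integral increases with the subpath, so on a
  closed interval the supremum is attained at the whole path.\<close>

definition path_integral :: "((real^'n) set \<Rightarrow> ennreal) \<Rightarrow> 'n orbit_path \<Rightarrow> ennreal" where
  "path_integral \<rho> = (\<lambda>(\<Delta>, \<gamma>).
     (SUP (a, b) \<in> {(a, b). a \<le> b \<and> {a..b} \<subseteq> \<Delta>}.
        \<integral>\<^sup>+s\<in>{0..enn2real (path_len \<gamma> a b)}. \<rho> (normal_rep \<gamma> a b s) \<partial>lborel))"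

definition adm ::
    "(real^'n \<Rightarrow> real^'n) set \<Rightarrow> 'n orbit_path set \<Rightarrow> ((real^'n) set \<Rightarrow> ennreal) set" where
  "adm G \<Gamma> =
     {\<rho> \<in> borel_measurable (orbit_borel G).
        \<forall>\<gamma>\<in>\<Gamma>. locally_rectifiable \<gamma> \<longrightarrow> 1 \<le> path_integral \<rho> \<gamma>}"

definition modulus ::
    "(real^'n \<Rightarrow> real^'n) set \<Rightarrow> real^'n \<Rightarrow> 'n orbit_path set \<Rightarrow> ennreal" where
  "modulus G p0 \<Gamma> =
     (INF \<rho> \<in> adm G \<Gamma>. \<integral>\<^sup>+p. \<rho> p ^ CARD('n) \<partial>orbit_measure G p0)"

definition almost_all_paths ::
    "(real^'n \<Rightarrow> real^'n) set \<Rightarrow> real^'n \<Rightarrow> (real^'n) set set \<Rightarrow> ('n orbit_path \<Rightarrow> bool) \<Rightarrow> bool" where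
  "almost_all_paths G p0 D Q \<longleftrightarrow> modulus G p0 {\<gamma> \<in> paths_in G D. \<not> Q \<gamma>} = 0"

section \<open>Classes of mappings\<close>

definition discrete_mapping ::
    "(real^'n \<Rightarrow> real^'n) set \<Rightarrow> (real^'n) set set \<Rightarrow> (real^'n) set set \<Rightarrow>
     ((real^'n) set \<Rightarrow> (real^'n) set) \<Rightarrow> bool" where
  "discrete_mapping G D D' f \<longleftrightarrow>
     (\<forall>y\<in>D'. subtopology (orbit_topology G) {p\<in>D. f p = y} = discrete_topology {p\<in>D. f p = y})"

definition luzin_N ::
    "(real^'n) set measure \<Rightarrow> (real^'n) set measure \<Rightarrow> (real^'n) set set \<Rightarrow>
     ((real^'n) set \<Rightarrow> (real^'n) set) \<Rightarrow> bool" where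
  "luzin_N \<mu> \<mu>' D f \<longleftrightarrow> (\<forall>E\<subseteq>D. E \<in> null_sets \<mu> \<longrightarrow> f ` E \<in> null_sets \<mu>')"

definition luzin_N_inv ::
    "(real^'n) set measure \<Rightarrow> (real^'n) set measure \<Rightarrow> (real^'n) set set \<Rightarrow> (real^'n) set set \<Rightarrow>
     ((real^'n) set \<Rightarrow> (real^'n) set) \<Rightarrow> bool" where
  "luzin_N_inv \<mu> \<mu>' D D' f \<longleftrightarrow>
     (\<forall>E\<subseteq>D'. E \<in> null_sets \<mu>' \<longrightarrow> {p\<in>D. f p \<in> E} \<in> null_sets \<mu>)"

definition base_point :: "real set \<Rightarrow> real" where
  "base_point \<Delta> = (if Inf \<Delta> \<in> \<Delta> then Inf \<Delta> else SOME t. t \<in> \<Delta>)"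

definition signed_len :: "'n::finite orbit_path \<Rightarrow> real \<Rightarrow> real" where
  "signed_len = (\<lambda>(\<Delta>, \<gamma>) t.
     (let t0 = base_point \<Delta> in
      if t0 \<le> t then enn2real (path_len \<gamma> t0 t) else - enn2real (path_len \<gamma> t t0)))"

definition abs_continuous_on_segment :: "real \<Rightarrow> real \<Rightarrow> (real \<Rightarrow> real) \<Rightarrow> bool" where
  "abs_continuous_on_segment c d L \<longleftrightarrow>
     (\<forall>\<epsilon>>0. \<exists>\<delta>>0. \<forall>(m::nat) a b.
        (\<forall>k<m. c \<le> a k \<and> a k \<le> b k \<and> b k \<le> d) \<and>
        disjoint_family_on (\<lambda>k. {a k<..<b k}) {..<m} \<and> (\<Sum>k<m. b k - a k) < \<delta> \<longrightarrow>
        (\<Sum>k<m. \<bar>L (b k) - L (a k)\<bar>) < \<epsilon>)"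

text \<open>\<open>L\<close> is the length transfer function \<open>L\<^bsub>\<gamma>,f\<^esub>\<close>, which these conditions determine uniquely
  on \<open>\<Delta>\<^bsub>\<gamma>\<^esub>\<close> if \<open>\<gamma>\<close> and \<open>f \<circ> \<gamma>\<close> are locally rectifiable.\<close>

definition length_transfer ::
    "((real^'n) set \<Rightarrow> (real^'n) set) \<Rightarrow> 'n orbit_path \<Rightarrow> (real \<Rightarrow> real) \<Rightarrow> bool" where
  "length_transfer f \<gamma> L \<longleftrightarrow>
     mono_on (signed_len \<gamma> ` fst \<gamma>) L \<and>
     L ` (signed_len \<gamma> ` fst \<gamma>) \<subseteq> signed_len (image_path f \<gamma>) ` fst \<gamma> \<and>
     (\<forall>t \<in> fst \<gamma>. L (signed_len \<gamma> t) = signed_len (image_path f \<gamma>) t)"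

text \<open>Paths that are not locally rectifiable form a family of modulus zero, so requiring local
  rectifiability of \<open>\<gamma>\<close>, which the length transfer function presupposes, changes nothing.\<close>

definition ACP ::
    "(real^'n \<Rightarrow> real^'n) set \<Rightarrow> real^'n \<Rightarrow> (real^'n) set set \<Rightarrow>
     ((real^'n) set \<Rightarrow> (real^'n) set) \<Rightarrow> bool" where
  "ACP G p0 D f \<longleftrightarrow> almost_all_paths G p0 D (\<lambda>\<gamma>.
     locally_rectifiable \<gamma> \<and> locally_rectifiable (image_path f \<gamma>) \<and>
     (\<exists>L. length_transfer f \<gamma> L \<and>
        (\<forall>c d. c \<le> d \<and> {c..d} \<subseteq> signed_len \<gamma> ` fst \<gamma> \<longrightarrow> abs_continuous_on_segment c d L)))"

section \<open>Local coordinates and dilatations\<close>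

definition local_coordinate ::
    "(real^'n \<Rightarrow> real^'n) set \<Rightarrow> (real^'n) set set \<Rightarrow> ((real^'n) set \<Rightarrow> real^'n) \<Rightarrow> bool" where
  "local_coordinate G U \<phi> \<longleftrightarrow>
     openin (orbit_topology G) U \<and> open (\<phi> ` U) \<and> \<phi> ` U \<subseteq> unit_ball \<and>
     (\<forall>q\<in>U. orbit_proj G (\<phi> q) = q) \<and>
     homeomorphic_map (subtopology (orbit_topology G) U) (top_of_set (\<phi> ` U)) \<phi>"

text \<open>A chosen local coordinate at \<open>p\<close> with its domain. Transition maps are restrictions of group
  elements, so differentiability and the dilatation below do not depend on the choice.\<close>

definition coordinate_at ::
    "(real^'n \<Rightarrow> real^'n) set \<Rightarrow> (real^'n) set \<Rightarrow> (real^'n) set set \<times> ((real^'n) set \<Rightarrow> real^'n)" where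
  "coordinate_at G p = (SOME (U, \<phi>). local_coordinate G U \<phi> \<and> p \<in> U)"

definition coordinate_point ::
    "(real^'n \<Rightarrow> real^'n) set \<Rightarrow> (real^'n) set \<Rightarrow> real^'n" where
  "coordinate_point G p = snd (coordinate_at G p) p"

definition coordinate_rep ::
    "(real^'n \<Rightarrow> real^'n) set \<Rightarrow> (real^'n \<Rightarrow> real^'n) set \<Rightarrow>
     ((real^'n) set \<Rightarrow> (real^'n) set) \<Rightarrow> (real^'n) set \<Rightarrow> real^'n \<Rightarrow> real^'n" where
  "coordinate_rep G G' f p =
     (let (U, \<phi>) = coordinate_at G p; (V, \<psi>) = coordinate_at G' (f p)
      in \<psi> \<circ> f \<circ> inv_into U \<phi>)"

definition differentiable_at_orbit ::
    "(real^'n \<Rightarrow> real^'n) set \<Rightarrow> (real^'n \<Rightarrow> real^'n) set \<Rightarrow>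
     ((real^'n) set \<Rightarrow> (real^'n) set) \<Rightarrow> (real^'n) set \<Rightarrow> bool" where
  "differentiable_at_orbit G G' f p \<longleftrightarrow>
     coordinate_rep G G' f p differentiable (at (coordinate_point G p))"

text \<open>The value at points of non-differentiability, set to infinity here, is immaterial below: they
  form a set of measure zero, whose image has measure zero by the Luzin property.\<close>

definition outer_dilatation :: "real^'n \<Rightarrow> (real^'n \<Rightarrow> real^'n) \<Rightarrow> ennreal" where
  "outer_dilatation x F =
     (if \<not> F differentiable (at x) then \<infinity>
      else if det (jacobian F (at x)) \<noteq> 0
        then ennreal (onorm (frechet_derivative F (at x)) ^ CARD('n) / \<bar>det (jacobian F (at x))\<bar>)
      else if frechet_derivative F (at x) = (\<lambda>v. 0) then 1
      else \<infinity>)"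

definition K_O ::
    "(real^'n \<Rightarrow> real^'n) set \<Rightarrow> (real^'n \<Rightarrow> real^'n) set \<Rightarrow>
     ((real^'n) set \<Rightarrow> (real^'n) set) \<Rightarrow> (real^'n) set \<Rightarrow> ennreal" where
  "K_O G G' f p = outer_dilatation (coordinate_point G p) (coordinate_rep G G' f p)"

definition K_I ::
    "(real^'n \<Rightarrow> real^'n) set \<Rightarrow> (real^'n \<Rightarrow> real^'n) set \<Rightarrow> (real^'n) set set \<Rightarrow>
     ((real^'n) set \<Rightarrow> (real^'n) set) \<Rightarrow> (real^'n) set \<Rightarrow> ennreal" where
  "K_I G G' D f q = (\<Sum>\<^sub>\<infinity>p \<in> D \<inter> f -` {q}. K_O G G' f p)"

end

theory Submission
  imports Defs
begin

text \<open>Let \<open>\<rho>'\<close> be admissible for \<open>f(\<Gamma>)\<close> and put \<open>\<rho> = (\<rho>' \<circ> f) \<sqdot> lip\<close> on \<open>D\<close>, where \<open>lip\<close> is the pointwise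
  Lipschitz constant of \<open>f\<close> for the two orbit metrics. If the length transfer function of a path is
  absolutely continuous, then the arc length measure of the image path has a density with respect to
  that of the path, and this density is at most \<open>lip\<close>: on a compact set where \<open>f\<close> is uniformly
  \<open>c\<close>-Lipschitz the image of the path is at most \<open>c\<close> times as long. So \<open>\<rho>\<close> is admissible for \<open>\<Gamma>\<close> up to a
  family of modulus zero. In local coordinates \<open>lip\<^sup>n\<close> is at most \<open>K\<^sub>O\<close> times the hyperbolic Jacobian at
  points of differentiability, and by Sard's theorem and the condition \<open>N\<^sup>-\<^sup>1\<close> the Jacobian vanishes
  almost nowhere. Up to a null set the fundamental polyhedron splits into countably many pieces on
  which \<open>f\<close> is injective and differentiable; changing variables on each of them and adding up turns
  the integral of \<open>\<rho>\<^sup>n\<close> into one of at most \<open>K\<^sub>I \<rho>'\<^sup>n\<close>. The Moebius transformations of the ball are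
  handled as Lorentz maps, which yields that they are hyperbolic isometries and preserve volume.\<close>

text \<open>The natural density would be the norm of the derivative of \<open>f\<close>. It exists
  only almost everywhere, so one would first have to show that almost every path spends zero length
  in the exceptional set. The constant \<open>lip\<close> is defined at every point, possibly
  infinite, so the comparison of the two path integrals holds on each single path with absolutely
  continuous length transfer; null sets enter only in the volume integral, where they can be
  discarded. Radon-Nikodym needs both arc lengths as measures on one space. Hence arc length is
  carried from the length interval back to the parameter interval, which a path shares with its
  image. In the volume integral, each orbit has at most one point in the polyhedron, so disjoint
  pieces of the polyhedron contribute different summands to the sum over a fibre that defines
  \<open>K_I\<close>.\<close>

section \<open>Change of variables\<close>

text \<open>The change of variables theorems of the library require a well-ordered index type, hence this
  well-ordered copy of \<open>'n\<close>.\<close>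

typedef ('n::finite) widx = "{..<CARD('n)}"
  by (rule exI[of _ 0]) (simp add: card_gt_0_iff)

instantiation widx :: (finite) linorder
begin
definition "less_eq_widx (x :: 'a widx) (y :: 'a widx) \<longleftrightarrow> Rep_widx x \<le> Rep_widx y"
definition "less_widx (x :: 'a widx) (y :: 'a widx) \<longleftrightarrow> Rep_widx x < Rep_widx y"
instance
  by standard (auto simp: less_eq_widx_def less_widx_def Rep_widx_inject)
end

instance widx :: (finite) wellorder
proof
  fix P :: "'a widx \<Rightarrow> bool" and a
  assume *: "\<And>x. (\<And>y. y < x \<Longrightarrow> P y) \<Longrightarrow> P x"
  have "\<forall>a. Rep_widx a = m \<longrightarrow> P a" for m
    by (induction m rule: less_induct) (metis * less_widx_def)
  then show "P a" by blast
qed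

lemma bij_betw_Rep_widx: "bij_betw Rep_widx (UNIV :: 'n widx set) {..<CARD('n::finite)}"
  by (metis type_definition.Rep_range type_definition_widx inj_onI Rep_widx_inject bij_betw_def)

instance widx :: (finite) finite
  by standard (use bij_betw_Rep_widx bij_betw_finite finite_lessThan in blast)

lemma CARD_widx [simp]: "CARD('n::finite widx) = CARD('n)"
  using bij_betw_same_card[OF bij_betw_Rep_widx] by simp

definition of_widx :: "'n::finite widx \<Rightarrow> 'n" where
  "of_widx = (SOME \<sigma>. bij \<sigma>)"

lemma bij_of_widx: "bij (of_widx :: 'n::finite widx \<Rightarrow> 'n)"
proof -
  have "\<exists>\<sigma> :: 'n widx \<Rightarrow> 'n. bij \<sigma>"
    by (rule finite_same_card_bij) auto
  then show ?thesis
    unfolding of_widx_def by (rule someI_ex)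
qed

definition to_widx :: "'n::finite \<Rightarrow> 'n widx" where
  "to_widx = inv_into UNIV of_widx"

lemma of_to_widx [simp]: "of_widx (to_widx j) = j"
  unfolding to_widx_def using bij_is_surj[OF bij_of_widx] by (metis f_inv_into_f UNIV_I)

lemma to_of_widx [simp]: "to_widx (of_widx i) = i"
  unfolding to_widx_def using bij_is_inj[OF bij_of_widx] by (rule inv_into_f_f) simp

lemma bij_to_widx: "bij to_widx"
  by (rule bijI') (metis of_to_widx, metis to_of_widx)

definition wvec :: "'a^'n \<Rightarrow> 'a^('n::finite widx)" where
  "wvec x = (\<chi> i. x $ of_widx i)"

definition unwvec :: "'a^('n::finite widx) \<Rightarrow> 'a^'n" where
  "unwvec y = (\<chi> i. y $ to_widx i)"

lemma unwvec_wvec [simp]: "unwvec (wvec x) = x"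
  by (simp add: unwvec_def wvec_def vec_eq_iff)

lemma wvec_unwvec [simp]: "wvec (unwvec x) = x"
  by (simp add: unwvec_def wvec_def vec_eq_iff)

lemma linear_wvec: "linear (wvec :: real^'n \<Rightarrow> _)"
  by (rule linearI) (simp_all add: wvec_def vec_eq_iff)

lemma linear_unwvec: "linear (unwvec :: real^('n::finite widx) \<Rightarrow> _)"
  by (rule linearI) (simp_all add: unwvec_def vec_eq_iff)

lemma bounded_linear_wvec: "bounded_linear (wvec :: real^'n \<Rightarrow> _)"
  using linear_wvec linear_conv_bounded_linear by blast

lemma bounded_linear_unwvec: "bounded_linear (unwvec :: real^('n::finite widx) \<Rightarrow> _)"
  using linear_unwvec linear_conv_bounded_linear by blast

lemma wvec_measurable [measurable]: "(wvec :: real^'n \<Rightarrow> _) \<in> borel_measurable borel"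
  by (intro borel_measurable_continuous_onI linear_continuous_on bounded_linear_wvec)

lemma inj_wvec: "inj wvec"
  by (metis injI unwvec_wvec)

lemma wvec_in_image [simp]: "wvec x \<in> wvec ` S \<longleftrightarrow> x \<in> S"
  by (rule inj_image_mem_iff[OF inj_wvec])

text \<open>A relabelling maps boxes to boxes with the same side lengths, and a Borel measure with
  the right values on boxes is \<open>lborel\<close>.\<close>

lemma lborel_distr_wvec: "distr lborel borel (wvec :: real^'n \<Rightarrow> _) = lborel"
proof (rule lborel_eqI[symmetric])
  fix l u :: "real^('n::finite widx)"
  assume le: "\<And>b. b \<in> Basis \<Longrightarrow> l \<bullet> b \<le> u \<bullet> b"
  have lei: "l $ i \<le> u $ i" for i
    using le[of "axis i 1"] by (simp add: inner_axis axis_in_Basis_iff)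
  have prod_Basis: "(\<Prod>b\<in>Basis. v \<bullet> b) = (\<Prod>i\<in>UNIV. v $ i)" for v :: "real^'k::finite"
  proof -
    have B: "(Basis :: (real^'k) set) = (\<lambda>i. axis i 1) ` UNIV"
      by (auto simp: Basis_vec_def)
    have "inj (\<lambda>i::'k. axis i (1::real))"
      by (auto simp: inj_on_def axis_eq_axis)
    then show ?thesis
      unfolding B by (subst prod.reindex) (auto simp: inner_axis)
  qed
  have vim: "wvec -` box l u \<inter> space lborel = box (unwvec l) (unwvec u)"
  proof -
    have "wvec x \<in> box l u \<longleftrightarrow> x \<in> box (unwvec l) (unwvec u)" for x :: "real^'n"
    proof -
      have "(\<forall>i. l $ i < x $ of_widx i \<and> x $ of_widx i < u $ i) \<longleftrightarrow>
            (\<forall>j. l $ to_widx j < x $ j \<and> x $ j < u $ to_widx j)"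
        by (metis of_to_widx to_of_widx)
      then show ?thesis
        by (simp add: mem_box_cart wvec_def unwvec_def)
    qed
    then show ?thesis by auto
  qed
  have "emeasure (distr lborel borel wvec) (box l u) = emeasure lborel (box (unwvec l) (unwvec u))"
    using vim by (subst emeasure_distr) auto
  also have "\<dots> = (\<Prod>b\<in>Basis. (unwvec u - unwvec l) \<bullet> b)"
  proof (rule emeasure_lborel_box)
    fix b :: "real^'n" assume "b \<in> Basis"
    then obtain i where "b = axis i 1" by (auto simp: Basis_vec_def)
    then show "unwvec l \<bullet> b \<le> unwvec u \<bullet> b"
      by (simp add: inner_axis unwvec_def lei)
  qed
  also have "(\<Prod>b\<in>Basis. (unwvec u - unwvec l) \<bullet> b) = (\<Prod>j\<in>UNIV. (u - l) $ to_widx j)"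
    by (simp add: prod_Basis unwvec_def)
  also have "\<dots> = (\<Prod>i\<in>UNIV. (u - l) $ i)"
    by (rule prod.reindex_bij_betw[OF bij_to_widx])
  also have "\<dots> = (\<Prod>b\<in>Basis. (u - l) \<bullet> b)"
    by (simp add: prod_Basis)
  finally show "emeasure (distr lborel borel wvec) (box l u) = (\<Prod>b\<in>Basis. (u - l) \<bullet> b)" .
qed simp

text \<open>Since the image of \<open>lborel\<close> is \<open>lborel\<close>, null sets pull back
  to null sets, and both claims pass to the completion.\<close>

lemma wvec_lebesgue_measurable: "(wvec :: real^'n \<Rightarrow> _) \<in> lebesgue \<rightarrow>\<^sub>M lebesgue"
  and lebesgue_distr_wvec: "distr lebesgue lebesgue (wvec :: real^'n \<Rightarrow> _) = lebesgue"
proof -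
  have m: "(wvec :: real^'n \<Rightarrow> _) \<in> lebesgue \<rightarrow>\<^sub>M lborel"
    by (intro measurable_completion) simp
  have "distr lebesgue lborel (wvec :: real^'n \<Rightarrow> _) = distr lborel borel wvec"
    by (subst distr_completion) (auto cong: distr_cong)
  then have d: "distr lebesgue lborel (wvec :: real^'n \<Rightarrow> _) = lborel"
    by (simp add: lborel_distr_wvec)
  show "(wvec :: real^'n \<Rightarrow> _) \<in> lebesgue \<rightarrow>\<^sub>M lebesgue"
    by (rule completion.measurable_completion2[OF m]) (simp add: d)
  show "distr lebesgue lebesgue (wvec :: real^'n \<Rightarrow> _) = lebesgue"
    using completion.completion_distr_eq[OF m] by (simp add: d)
qed

lemma emeasure_wvec_image:
  assumes "wvec ` S \<in> sets lebesgue"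
  shows "emeasure lebesgue (wvec ` S) = emeasure lebesgue (S :: (real^'n) set)"
proof -
  have "wvec -` wvec ` S = S" by (simp add: inj_vimage_image_eq inj_wvec)
  then show ?thesis
    using emeasure_distr[OF wvec_lebesgue_measurable assms] by (simp add: lebesgue_distr_wvec)
qed

lemma nn_integral_wvec:
  assumes "f \<in> borel_measurable lebesgue"
  shows "(\<integral>\<^sup>+x. f (wvec (x :: real^'n)) \<partial>lebesgue) = (\<integral>\<^sup>+y. f y \<partial>lebesgue)"
  using nn_integral_distr[OF wvec_lebesgue_measurable, of f] assms by (simp add: lebesgue_distr_wvec)

lemma wvec_image_sets:
  assumes "S \<in> sets lebesgue" shows "wvec ` (S :: (real^'n) set) \<in> sets lebesgue"
  by (rule differentiable_image_in_sets_lebesgue[OF assms])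
    (auto simp: linear_imp_differentiable_on linear_wvec)

text \<open>Conjugation by a relabelling renames rows and columns by the same bijection.
  Transporting permutations along it keeps their signs, so the two Leibniz sums agree term by
  term.\<close>

lemma det_wvec:
  fixes L :: "real^'n \<Rightarrow> real^'n"
  shows "det (matrix (wvec \<circ> L \<circ> unwvec)) = det (matrix L)"
proof -
  let ?s = "of_widx :: 'n widx \<Rightarrow> 'n"
  let ?m = "map_permutation UNIV ?s"
  have ax: "unwvec (axis j (1::real)) = axis (?s j) 1" for j
    by (auto simp: unwvec_def axis_def vec_eq_iff)
  have mat: "matrix (wvec \<circ> L \<circ> unwvec) $ i $ j = matrix L $ ?s i $ ?s j" for i j
    by (simp add: matrix_def wvec_def ax)
  have sUN: "?s ` UNIV = UNIV" using bij_is_surj[OF bij_of_widx] .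
  have m_apply: "?m p (?s i) = ?s (p i)" for p i
    by (simp add: map_permutation_def sUN restrict_id_def inv_into_f_f[OF bij_is_inj[OF bij_of_widx]])
  have bij: "bij_betw ?m {p. p permutes UNIV} {p. p permutes UNIV}"
  proof (rule bij_betwI')
    fix p q :: "'n widx \<Rightarrow> 'n widx"
    assume "p \<in> {p. p permutes UNIV}" "q \<in> {p. p permutes UNIV}"
    show "(?m p = ?m q) = (p = q)"
    proof
      assume "?m p = ?m q"
      then have "?s (p i) = ?s (q i)" for i by (metis m_apply)
      then show "p = q" using bij_is_inj[OF bij_of_widx] by (auto simp: inj_def fun_eq_iff)
    qed simp
  next
    fix p assume "p \<in> {p. p permutes (UNIV :: 'n widx set)}"
    then show "?m p \<in> {p. p permutes UNIV}"
      using map_permutation_permutes[of ?s UNIV UNIV p] bij_of_widx by simp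
  next
    fix q assume q: "q \<in> {q. q permutes (UNIV :: 'n set)}"
    define p where "p = to_widx \<circ> q \<circ> ?s"
    have "bij q" using q permutes_bij by auto
    then have "bij p"
      unfolding p_def by (intro bij_comp bij_of_widx bij_to_widx)
    then have "p permutes UNIV" using bij_imp_permutes by blast
    moreover have "q = ?m p"
    proof
      fix x
      obtain i where i: "x = ?s i" using sUN by blast
      show "q x = ?m p x"
        unfolding i m_apply p_def by simp
    qed
    ultimately show "\<exists>x\<in>{p. p permutes UNIV}. q = ?m x" by blast
  qed
  have "det (matrix L) = (\<Sum>p | p permutes UNIV. of_int (sign (?m p)) * (\<Prod>i\<in>UNIV. matrix L $ i $ (?m p i)))"
    unfolding det_def by (rule sum.reindex_bij_betw[OF bij, symmetric])
  also have "\<dots> = (\<Sum>p | p permutes UNIV. of_int (sign p) * (\<Prod>i\<in>UNIV. matrix L $ ?s i $ ?s (p i)))"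
  proof (rule sum.cong, simp)
    fix p assume "p \<in> {p. p permutes (UNIV :: 'n widx set)}"
    then have p: "p permutes UNIV" by simp
    have "sign (?m p) = sign p"
      by (rule sign_map_permutation) (use p bij_is_inj[OF bij_of_widx] in auto)
    moreover have "(\<Prod>i\<in>UNIV. matrix L $ i $ (?m p i)) = (\<Prod>i\<in>UNIV. matrix L $ ?s i $ (?m p (?s i)))"
      by (rule prod.reindex_bij_betw[OF bij_of_widx, symmetric])
    ultimately show "of_int (sign (?m p)) * (\<Prod>i\<in>UNIV. matrix L $ i $ (?m p i)) =
         of_int (sign p) * (\<Prod>i\<in>UNIV. matrix L $ ?s i $ ?s (p i))"
      by (simp add: m_apply)
  qed
  also have "\<dots> = det (matrix (wvec \<circ> L \<circ> unwvec))"
    unfolding det_def mat ..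
  finally show ?thesis by simp
qed

section \<open>The area formula and Sard's theorem for an arbitrary finite index type\<close>

lemma wvec_conj_derivative:
  fixes F :: "real^'n \<Rightarrow> real^'n"
  assumes "(F has_derivative F') (at x within S)"
  shows "((wvec \<circ> F \<circ> unwvec) has_derivative (wvec \<circ> F' \<circ> unwvec)) (at (wvec x) within wvec ` S)"
proof -
  have 1: "(unwvec has_derivative unwvec) (at (wvec x) within wvec ` S)"
    by (rule bounded_linear_imp_has_derivative[OF bounded_linear_unwvec])
  have 2: "unwvec ` wvec ` S = S" by (force simp: image_image)
  have "((F \<circ> unwvec) has_derivative (F' \<circ> unwvec)) (at (wvec x) within wvec ` S)"
    using diff_chain_within[OF 1, of F F'] assms by (simp add: 2)
  then have "((wvec \<circ> (F \<circ> unwvec)) has_derivative (wvec \<circ> (F' \<circ> unwvec))) (at (wvec x) within wvec ` S)"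
    by (rule diff_chain_within) (rule bounded_linear_imp_has_derivative[OF bounded_linear_wvec])
  then show ?thesis by (simp add: o_assoc)
qed

text \<open>Boundedness gives the image finite measure, which makes the Jacobian absolutely
  integrable; then the real-valued formula can be read in \<open>ennreal\<close>.\<close>

lemma emeasure_differentiable_image_wellorder:
  fixes F :: "real^('n::{finite,wellorder}) \<Rightarrow> real^('n::{finite,wellorder})"
  assumes S: "S \<in> sets lebesgue"
    and der: "\<And>x. x \<in> S \<Longrightarrow> (F has_derivative F' x) (at x within S)"
    and inj: "inj_on F S" and bd: "bounded (F ` S)"
  shows "emeasure lebesgue (F ` S) = (\<integral>\<^sup>+x. ennreal \<bar>det (matrix (F' x))\<bar> * indicator S x \<partial>lebesgue)"
proof -
  let ?d = "\<lambda>x. \<bar>det (matrix (F' x))\<bar>"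
  have "F ` S \<in> sets lebesgue"
    by (rule differentiable_image_in_sets_lebesgue[OF S])
      (use der in \<open>auto simp: differentiable_on_def differentiable_def\<close>)
  then have lm: "F ` S \<in> lmeasurable"
    using bd bounded_set_imp_lmeasurable by blast
  then have ai: "?d absolutely_integrable_on S"
    using measurable_differentiable_image_alt[OF S der inj] by blast
  then have int: "?d integrable_on S"
    by (rule set_lebesgue_integral_eq_integral(1))
  have "emeasure lebesgue (F ` S) = ennreal (measure lebesgue (F ` S))"
    by (rule emeasure_eq_measure2[OF lm])
  also have "measure lebesgue (F ` S) = integral S ?d"
    by (rule measure_differentiable_image_eq[OF S der inj int])
  also have "integral S ?d = (\<integral>x\<in>S. ?d x \<partial>lebesgue)"
    using set_lebesgue_integral_eq_integral(2)[OF ai] by simp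
  also have "ennreal \<dots> = (\<integral>\<^sup>+x. ennreal (indicator S x *\<^sub>R ?d x) \<partial>lebesgue)"
    using ai unfolding set_integrable_def set_lebesgue_integral_def
    by (intro nn_integral_eq_integral[symmetric]) simp_all
  also have "\<dots> = (\<integral>\<^sup>+x. ennreal (?d x) * indicator S x \<partial>lebesgue)"
    by (intro nn_integral_cong) (auto simp: indicator_def)
  finally show ?thesis .
qed

lemma det_Jacobian_measurable:
  fixes F :: "real^'n \<Rightarrow> real^'n"
  assumes S: "S \<in> sets lebesgue"
    and der: "\<And>x. x \<in> S \<Longrightarrow> (F has_derivative F' x) (at x within S)"
  shows "(\<lambda>x. det (matrix (F' x)) * indicator S x) \<in> borel_measurable lebesgue"
proof -
  let ?G = "wvec \<circ> F \<circ> unwvec" and ?T = "wvec ` S"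
  let ?G' = "\<lambda>y. wvec \<circ> F' (unwvec y) \<circ> unwvec"
  have T: "?T \<in> sets lebesgue" by (rule wvec_image_sets[OF S])
  have dG: "(?G has_derivative ?G' y) (at y within ?T)" if "y \<in> ?T" for y
    using that wvec_conj_derivative[OF der] by auto
  have "(\<lambda>y. det (matrix (?G' y))) \<in> borel_measurable (lebesgue_on ?T)"
    by (rule borel_measurable_det_Jacobian[OF T dG])
  then have "(\<lambda>y. det (matrix (?G' y)) * indicator ?T y) \<in> borel_measurable lebesgue"
    using T by (subst (asm) borel_measurable_restrict_space_iff) (auto simp: mult.commute)
  then have "(\<lambda>x. det (matrix (?G' (wvec x))) * indicator ?T (wvec x)) \<in> borel_measurable lebesgue"
    by (rule measurable_compose[OF wvec_lebesgue_measurable])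
  moreover have "indicator ?T (wvec x) = (indicator S x :: real)" for x
    by (simp add: indicator_def)
  ultimately show ?thesis by (simp add: det_wvec)
qed

lemma emeasure_differentiable_image:
  fixes F :: "real^'n \<Rightarrow> real^'n"
  assumes S: "S \<in> sets lebesgue"
    and der: "\<And>x. x \<in> S \<Longrightarrow> (F has_derivative F' x) (at x within S)"
    and inj: "inj_on F S" and bd: "bounded (F ` S)"
  shows "emeasure lebesgue (F ` S) = (\<integral>\<^sup>+x. ennreal \<bar>det (matrix (F' x))\<bar> * indicator S x \<partial>lebesgue)"
proof -
  let ?G = "wvec \<circ> F \<circ> unwvec" and ?T = "wvec ` S"
  let ?G' = "\<lambda>y. wvec \<circ> F' (unwvec y) \<circ> unwvec"
  have T: "?T \<in> sets lebesgue" by (rule wvec_image_sets[OF S])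
  have dG: "(?G has_derivative ?G' y) (at y within ?T)" if "y \<in> ?T" for y
    using that wvec_conj_derivative[OF der] by auto
  have im: "?G ` ?T = wvec ` F ` S" by (force simp: image_image)
  have FS: "F ` S \<in> sets lebesgue"
    by (rule differentiable_image_in_sets_lebesgue[OF S])
      (use der in \<open>auto simp: differentiable_on_def differentiable_def\<close>)
  have "emeasure lebesgue (F ` S) = emeasure lebesgue (?G ` ?T)"
    unfolding im by (rule emeasure_wvec_image[symmetric, OF wvec_image_sets[OF FS]])
  also have "\<dots> = (\<integral>\<^sup>+y. ennreal \<bar>det (matrix (?G' y))\<bar> * indicator ?T y \<partial>lebesgue)"
  proof (rule emeasure_differentiable_image_wellorder[OF T dG])
    show "inj_on ?G ?T"
      using inj by (auto simp: inj_on_def dest: injD[OF inj_wvec])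
    show "bounded (?G ` ?T)"
      unfolding im by (rule bounded_linear_image[OF bd bounded_linear_wvec])
  qed
  also have "\<dots> = (\<integral>\<^sup>+x. ennreal \<bar>det (matrix (?G' (wvec x)))\<bar> * indicator ?T (wvec x) \<partial>lebesgue)"
  proof (rule nn_integral_wvec[symmetric])
    have "(\<lambda>y. ennreal \<bar>det (matrix (?G' y)) * indicator ?T y\<bar>) \<in> borel_measurable lebesgue"
      using det_Jacobian_measurable[OF T dG] by measurable
    moreover have "ennreal \<bar>det (matrix (?G' y)) * indicator ?T y\<bar> = ennreal \<bar>det (matrix (?G' y))\<bar> * indicator ?T y" for y
      by (simp add: indicator_def)
    ultimately show "(\<lambda>y. ennreal \<bar>det (matrix (?G' y))\<bar> * indicator ?T y) \<in> borel_measurable lebesgue"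
      by simp
  qed
  also have "\<dots> = (\<integral>\<^sup>+x. ennreal \<bar>det (matrix (F' x))\<bar> * indicator S x \<partial>lebesgue)"
    by (simp add: indicator_def det_wvec)
  finally show ?thesis .
qed

text \<open>A vanishing determinant means a rank below the dimension, the situation of
  \<open>baby_Sard\<close>; the image is then carried back by the linear map \<open>unwvec\<close>,
  which preserves null sets.\<close>

lemma Sard_negligible:
  fixes F :: "real^'n \<Rightarrow> real^'n"
  assumes der: "\<And>x. x \<in> S \<Longrightarrow> (F has_derivative F' x) (at x within S)"
    and det0: "\<And>x. x \<in> S \<Longrightarrow> det (matrix (F' x)) = 0"
  shows "negligible (F ` S)"
proof -
  let ?G = "wvec \<circ> F \<circ> unwvec" and ?T = "wvec ` S"
  let ?G' = "\<lambda>y. wvec \<circ> F' (unwvec y) \<circ> unwvec"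
  have dG: "(?G has_derivative ?G' y) (at y within ?T)" if "y \<in> ?T" for y
    using that wvec_conj_derivative[OF der] by auto
  have "negligible (?G ` ?T)"
  proof (rule baby_Sard[OF order_refl dG])
    fix y assume "y \<in> ?T"
    then have "det (matrix (?G' y)) = 0" using det0 by (auto simp: det_wvec)
    then show "rank (matrix (?G' y)) < CARD('n widx)"
      by (simp only: det_eq_0_rank)
  qed
  then have "negligible (unwvec ` ?G ` ?T)"
    by (rule negligible_differentiable_image_negligible[rotated]) 
      (auto simp: linear_imp_differentiable_on linear_unwvec)
  moreover have "unwvec ` ?G ` ?T = F ` S" by (force simp: image_image)
  ultimately show ?thesis by simp
qed

section \<open>Hyperbolic distance\<close>

lemma unit_ball_pos: "x \<in> unit_ball \<Longrightarrow> 0 < 1 - (norm x)\<^sup>2"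
  by (simp add: abs_square_less_1)

text \<open>For \<open>q = (1 + t) / (1 - t)\<close> the value \<open>cosh (ln q)\<close> is the
  mean of \<open>q\<close> and \<open>1 / q\<close>, which is rational in \<open>t\<^sup>2\<close>.
  In this form root and logarithm are gone, and since cosh is injective on the nonnegative reals it
  serves as the working description of the distance.\<close>

lemma cosh_hyp_dist:
  fixes x y :: "real^'n"
  assumes x: "x \<in> unit_ball" and y: "y \<in> unit_ball"
  shows "cosh (hyp_dist x y) = 1 + 2 * ((norm (x - y))\<^sup>2 / ((1 - (norm x)\<^sup>2) * (1 - (norm y)\<^sup>2)))"
    and hyp_dist_nonneg: "0 \<le> hyp_dist x y"
proof -
  define P where "P = (1 - (norm x)\<^sup>2) * (1 - (norm y)\<^sup>2)"
  have P: "P > 0" unfolding P_def using unit_ball_pos[OF x] unit_ball_pos[OF y] by simp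
  define d where "d = norm (x - y)"
  define t where "t = d / sqrt (d\<^sup>2 + P)"
  have dP: "0 < d\<^sup>2 + P" using P by (simp add: add_nonneg_pos)
  have t2: "t\<^sup>2 = d\<^sup>2 / (d\<^sup>2 + P)" unfolding t_def using dP by (simp add: power_divide)
  have t0: "0 \<le> t" unfolding t_def d_def using dP by (intro divide_nonneg_nonneg real_sqrt_ge_zero) (auto simp: d_def)
  have "t\<^sup>2 < 1" unfolding t2 using P dP by simp
  then have t1: "t < 1" using t0 by (simp add: abs_square_less_1)
  have h: "hyp_dist x y = ln ((1 + t) / (1 - t))"
    by (simp add: hyp_dist_def t_def d_def P_def Let_def)
  have ge: "1 \<le> (1 + t) / (1 - t)" using t0 t1 by simp
  then show "0 \<le> hyp_dist x y" unfolding h by simp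
  have "cosh (hyp_dist x y) = ((1 + t) / (1 - t) + (1 - t) / (1 + t)) / 2"
    unfolding h using ge by (subst cosh_ln_real) auto
  also have "\<dots> = (1 + t\<^sup>2) / (1 - t\<^sup>2)"
  proof -
    have "(1 + t) / (1 - t) + (1 - t) / (1 + t) = ((1 + t) * (1 + t) + (1 - t) * (1 - t)) / ((1 - t) * (1 + t))"
      using t0 t1 by (intro add_frac_eq) auto
    also have "(1 + t) * (1 + t) + (1 - t) * (1 - t) = 2 * (1 + t\<^sup>2)"
      by (simp add: power2_eq_square algebra_simps)
    also have "(1 - t) * (1 + t) = 1 - t\<^sup>2"
      by (simp add: power2_eq_square algebra_simps)
    finally have "((1 + t) / (1 - t) + (1 - t) / (1 + t)) / 2 = 2 * (1 + t\<^sup>2) / (1 - t\<^sup>2) / 2"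
      by (rule arg_cong)
    then show ?thesis by (metis divide_divide_eq_left mult.commute mult_divide_mult_cancel_left zero_neq_numeral)
  qed
  also have "\<dots> = 1 + 2 * (d\<^sup>2 / P)"
  proof -
    have "1 + t\<^sup>2 = (2 * d\<^sup>2 + P) / (d\<^sup>2 + P)" "1 - t\<^sup>2 = P / (d\<^sup>2 + P)"
      unfolding t2 using dP by (simp_all add: field_simps)
    then have "(1 + t\<^sup>2) / (1 - t\<^sup>2) = (2 * d\<^sup>2 + P) / P" using dP by simp
    then show ?thesis using P by (simp add: add_divide_distrib)
  qed
  finally show "cosh (hyp_dist x y) = 1 + 2 * ((norm (x - y))\<^sup>2 / ((1 - (norm x)\<^sup>2) * (1 - (norm y)\<^sup>2)))"
    by (simp add: d_def P_def)
qed

lemma hyp_dist_commute: "hyp_dist x y = hyp_dist y x"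
  by (simp add: hyp_dist_def norm_minus_commute mult.commute)

lemma hyp_dist_self [simp]: "hyp_dist x x = 0"
  by (simp add: hyp_dist_def)

lemma sinh_ge_self: "0 \<le> z \<Longrightarrow> z \<le> sinh (z::real)"
proof -
  assume z: "0 \<le> z"
  have "(\<lambda>z. sinh z - z) 0 \<le> (\<lambda>z. sinh z - z) z"
  proof (rule DERIV_nonneg_imp_nondecreasing[OF z])
    fix y :: real assume "0 \<le> y"
    have "((\<lambda>z. sinh z - z) has_real_derivative (cosh y - 1)) (at y)"
      by (auto intro!: derivative_eq_intros)
    moreover have "0 \<le> cosh y - 1" using cosh_real_ge_1[of y] by simp
    ultimately show "\<exists>d. ((\<lambda>z. sinh z - z) has_real_derivative d) (at y) \<and> 0 \<le> d" by blast
  qed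
  then show ?thesis by simp
qed

lemma sinh_le_self_cosh: "0 \<le> z \<Longrightarrow> sinh (z::real) \<le> z * cosh z"
proof -
  assume z: "0 \<le> z"
  have "(\<lambda>z. z * cosh z - sinh z) 0 \<le> (\<lambda>z. z * cosh z - sinh z) z"
  proof (rule DERIV_nonneg_imp_nondecreasing[OF z])
    fix y :: real assume "0 \<le> y"
    have "((\<lambda>z. z * cosh z - sinh z) has_real_derivative (y * sinh y)) (at y)"
      by (auto intro!: derivative_eq_intros)
    moreover have "0 \<le> y * sinh y" using \<open>0 \<le> y\<close> by simp
    ultimately show "\<exists>d. ((\<lambda>z. z * cosh z - sinh z) has_real_derivative d) (at y) \<and> 0 \<le> d" by blast
  qed
  then show ?thesis by simp
qed

text \<open>Half the distance, \<open>z\<close>, has \<open>sinh z = d / sqrt P\<close> and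
  \<open>cosh z = sqrt ((d\<^sup>2 + P) / P)\<close>; the bounds are \<open>z \<le> sinh z\<close>
  and \<open>sinh z \<le> z * cosh z\<close>. As \<open>y\<close> tends to \<open>x\<close> both are
  asymptotic to \<open>norm (x - y)\<close> times the conformal factor
  \<open>2 / (1 - (norm x)\<^sup>2)\<close>, which is what the comparison with derivatives
  needs.\<close>

lemma
  fixes x y :: "real^'n"
  assumes x: "x \<in> unit_ball" and y: "y \<in> unit_ball"
  shows hyp_dist_le: "hyp_dist x y \<le> 2 * norm (x - y) / sqrt ((1 - (norm x)\<^sup>2) * (1 - (norm y)\<^sup>2))"
    and hyp_dist_ge: "2 * norm (x - y) / sqrt ((norm (x - y))\<^sup>2 + (1 - (norm x)\<^sup>2) * (1 - (norm y)\<^sup>2)) \<le> hyp_dist x y"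
proof -
  define P where "P = (1 - (norm x)\<^sup>2) * (1 - (norm y)\<^sup>2)"
  have P: "P > 0" unfolding P_def using unit_ball_pos[OF x] unit_ball_pos[OF y] by simp
  define d where "d = norm (x - y)"
  define z where "z = hyp_dist x y / 2"
  have z0: "0 \<le> z" using hyp_dist_nonneg[OF x y] by (simp add: z_def)
  have "cosh (2 * z) = 1 + 2 * (d\<^sup>2 / P)"
    using cosh_hyp_dist[OF x y] by (simp add: z_def d_def P_def)
  then have ch2: "(cosh z)\<^sup>2 = 1 + d\<^sup>2 / P" by (simp add: cosh_double_cosh)
  then have sh2: "(sinh z)\<^sup>2 = d\<^sup>2 / P" by (simp add: sinh_square_eq)
  have ch: "cosh z = sqrt ((d\<^sup>2 + P) / P)"
    using P ch2 by (intro real_sqrt_unique[symmetric]) (auto simp: field_simps)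
  have sh: "sinh z = d / sqrt P"
  proof -
    have "sinh z = sqrt (d\<^sup>2 / P)"
      using z0 sh2 by (intro real_sqrt_unique[symmetric]) auto
    then show ?thesis by (simp add: real_sqrt_divide d_def)
  qed
  show "hyp_dist x y \<le> 2 * norm (x - y) / sqrt ((1 - (norm x)\<^sup>2) * (1 - (norm y)\<^sup>2))"
    using sinh_ge_self[OF z0] unfolding sh by (simp add: z_def d_def P_def mult.commute)
  have "d / sqrt P \<le> z * (sqrt (d\<^sup>2 + P) / sqrt P)"
    using sinh_le_self_cosh[OF z0] unfolding sh ch real_sqrt_divide .
  then have "d \<le> z * sqrt (d\<^sup>2 + P)"
    using P by (simp add: field_simps)
  moreover have "0 < sqrt (d\<^sup>2 + P)" using P by (simp add: add_nonneg_pos)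
  ultimately have "d / sqrt (d\<^sup>2 + P) \<le> z" by (simp add: pos_divide_le_eq)
  then show "2 * norm (x - y) / sqrt ((norm (x - y))\<^sup>2 + (1 - (norm x)\<^sup>2) * (1 - (norm y)\<^sup>2)) \<le> hyp_dist x y"
    by (simp add: z_def d_def P_def mult.commute)
qed

lemma norm_le_hyp_dist:
  fixes x y :: "real^'n"
  assumes x: "x \<in> unit_ball" and y: "y \<in> unit_ball"
  shows "norm (x - y) \<le> 2 * hyp_dist x y"
proof -
  let ?P = "(1 - (norm x)\<^sup>2) * (1 - (norm y)\<^sup>2)" and ?d = "norm (x - y)"
  have P: "0 < ?P" using unit_ball_pos[OF x] unit_ball_pos[OF y] by simp
  have P1: "?P \<le> 1" using unit_ball_pos[OF x] unit_ball_pos[OF y]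
    by (intro mult_le_one) auto
  have "?d \<le> 2" using norm_triangle_ineq4[of x y] x y by simp
  then have "?d\<^sup>2 \<le> 2\<^sup>2" by (rule power_mono) simp
  \<comment> \<open>The radicand is at most 5; the larger bound 16 is taken because it is a
    square.\<close>
  then have "sqrt (?d\<^sup>2 + ?P) \<le> sqrt (4\<^sup>2)"
    using P1 by (intro real_sqrt_le_mono) simp
  then have s: "sqrt (?d\<^sup>2 + ?P) \<le> 4" by simp
  have "0 < sqrt (?d\<^sup>2 + ?P)" using P by (simp add: add_nonneg_pos)
  then have "2 * ?d / 4 \<le> 2 * ?d / sqrt (?d\<^sup>2 + ?P)"
    using s by (intro divide_left_mono) auto
  then show ?thesis using hyp_dist_ge[OF x y] by simp
qed

text \<open>The Lorentz form is positive semidefinite on the orthogonal complement of the timelike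
  unit vector \<open>(b0, b)\<close>, by the ordinary Cauchy-Schwarz inequality. A semidefinite form
  in turn satisfies its own Cauchy-Schwarz inequality, by the discriminant argument.\<close>

lemma lorentz_cauchy_schwarz:
  fixes b u w :: "'a::real_inner"
  assumes b: "b0\<^sup>2 - b \<bullet> b = 1" and u: "u0 * b0 = u \<bullet> b" and w: "w0 * b0 = w \<bullet> b"
  shows "(u \<bullet> w - u0 * w0)\<^sup>2 \<le> (u \<bullet> u - u0\<^sup>2) * (w \<bullet> w - w0\<^sup>2)"
proof -
  have nonneg: "0 \<le> z \<bullet> z - z0\<^sup>2" if z: "z0 * b0 = z \<bullet> b" for z z0
  proof -
    have "(z0 * b0)\<^sup>2 \<le> (z \<bullet> z) * (b \<bullet> b)"
      unfolding z by (rule Cauchy_Schwarz_ineq)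
    also have "\<dots> \<le> (z \<bullet> z) * b0\<^sup>2" using b by (intro mult_left_mono) auto
    finally have "z0\<^sup>2 * b0\<^sup>2 \<le> (z \<bullet> z) * b0\<^sup>2" by (simp add: power_mult_distrib)
    moreover have "b0\<^sup>2 > 0" using b inner_ge_zero[of b] by linarith
    ultimately show ?thesis by simp
  qed
  define U W K where "U = u \<bullet> u - u0\<^sup>2" and "W = w \<bullet> w - w0\<^sup>2" and "K = u \<bullet> w - u0 * w0"
  have W0: "0 \<le> W" unfolding W_def by (rule nonneg[OF w])
  have quad: "0 \<le> \<alpha>\<^sup>2 * U + 2 * \<alpha> * \<beta> * K + \<beta>\<^sup>2 * W" for \<alpha> \<beta>
  proof -
    have "(\<alpha> * u0 + \<beta> * w0) * b0 = (\<alpha> *\<^sub>R u + \<beta> *\<^sub>R w) \<bullet> b"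
      using u w by (simp add: inner_add_left distrib_right mult.assoc)
    from nonneg[OF this] show ?thesis
      by (simp add: U_def W_def K_def inner_add_left inner_add_right inner_commute algebra_simps power2_eq_square)
  qed
  have "K\<^sup>2 \<le> U * W"
  proof (cases "W = 0")
    case True
    have "K = 0"
    proof (rule ccontr)
      assume "K \<noteq> 0"
      \<comment> \<open>With \<open>W = 0\<close> this choice gives the quadratic form the value
        -1.\<close>
      then show False using quad[of 1 "- (U + 1) / (2 * K)"] True by (simp add: field_simps)
    qed
    then show ?thesis using True by simp
  next
    case False
    then have "0 < W" using W0 by simp
    moreover have "0 \<le> W * (U * W - K\<^sup>2)"
      using quad[of W "- K"] by (simp add: algebra_simps power2_eq_square)
    ultimately show ?thesis by (simp add: zero_le_mult_iff)
  qed
  then show ?thesis by (simp add: U_def W_def K_def)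
qed

text \<open>Law of cosines on the hyperboloid, \<open>p\<close> and \<open>q\<close> being cosh of
  the distances from \<open>b\<close>. Removing the components along \<open>b\<close> leaves vectors
  of squared length \<open>p\<^sup>2 - 1\<close> and \<open>q\<^sup>2 - 1\<close>, and
  Cauchy-Schwarz for them says that the cosine of the angle at \<open>b\<close> is at least
  -1.\<close>

lemma lorentz_triangle:
  fixes a b c :: "'a::real_inner"
  assumes a: "a0\<^sup>2 - a \<bullet> a = 1" and b: "b0\<^sup>2 - b \<bullet> b = 1" and c: "c0\<^sup>2 - c \<bullet> c = 1"
    and p: "p = a0 * b0 - a \<bullet> b" and q: "q = b0 * c0 - b \<bullet> c"
  shows "a0 * c0 - a \<bullet> c \<le> p * q + sqrt (p\<^sup>2 - 1) * sqrt (q\<^sup>2 - 1)"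
proof -
  define u u0 w w0 where "u = a - p *\<^sub>R b" and "u0 = a0 - p * b0" and "w = c - q *\<^sub>R b" and "w0 = c0 - q * b0"
  have bb: "b0 * b0 = 1 + b \<bullet> b" using b by (simp add: power2_eq_square)
  have ab: "a \<bullet> b = a0 * b0 - p" and bc: "c \<bullet> b = b0 * c0 - q"
    using p q by (simp_all add: inner_commute)
  have u: "u0 * b0 = u \<bullet> b"
  proof -
    have "u0 * b0 = a0 * b0 - p * (b0 * b0)" by (simp add: u0_def algebra_simps)
    then show ?thesis by (simp add: u_def inner_diff_left ab bb algebra_simps)
  qed
  have w: "w0 * b0 = w \<bullet> b"
  proof -
    have "w0 * b0 = b0 * c0 - q * (b0 * b0)" by (simp add: w0_def algebra_simps)
    then show ?thesis by (simp add: w_def inner_diff_left bc bb algebra_simps)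
  qed
  have bb': "b \<bullet> b = b0 * b0 - 1" using bb by simp
  have aa': "a \<bullet> a = a0 * a0 - 1" and cc': "c \<bullet> c = c0 * c0 - 1"
    using a c by (simp_all add: power2_eq_square)
  have U: "u \<bullet> u - u0\<^sup>2 = p\<^sup>2 - 1"
    unfolding u_def u0_def
    by (simp add: inner_diff_left inner_diff_right inner_commute[of b a] ab aa' bb' power2_eq_square algebra_simps)
  have W: "w \<bullet> w - w0\<^sup>2 = q\<^sup>2 - 1"
    unfolding w_def w0_def
    by (simp add: inner_diff_left inner_diff_right inner_commute[of b c] bc cc' bb' power2_eq_square algebra_simps)
  have K: "u \<bullet> w - u0 * w0 = a \<bullet> c - a0 * c0 + p * q"
    unfolding w_def w0_def u_def u0_def
    by (simp add: inner_diff_left inner_diff_right inner_commute[of b c] bc ab bb' power2_eq_square algebra_simps)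
  have "(u \<bullet> w - u0 * w0)\<^sup>2 \<le> (p\<^sup>2 - 1) * (q\<^sup>2 - 1)"
    using lorentz_cauchy_schwarz[OF b u w] by (simp add: U W)
  then have "\<bar>u \<bullet> w - u0 * w0\<bar> \<le> sqrt ((p\<^sup>2 - 1) * (q\<^sup>2 - 1))"
    using real_sqrt_le_mono by fastforce
  then show ?thesis unfolding K real_sqrt_mult by linarith
qed

text \<open>The bound of \<open>lorentz_triangle\<close> is
  \<open>cosh r * cosh s + sinh r * sinh s\<close>, that is, the cosh of the sum, and cosh is
  increasing on the nonnegative reals.\<close>

lemma hyp_dist_triangle:
  fixes x y z :: "real^'n"
  assumes x: "x \<in> unit_ball" and y: "y \<in> unit_ball" and z: "z \<in> unit_ball"
  shows "hyp_dist x z \<le> hyp_dist x y + hyp_dist y z"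
proof -
  define X0 where "X0 = (\<lambda>x::real^'n. (1 + (norm x)\<^sup>2) / (1 - (norm x)\<^sup>2))"
  define X where "X = (\<lambda>x::real^'n. (2 / (1 - (norm x)\<^sup>2)) *\<^sub>R x)"
  \<comment> \<open>\<open>(X0 x, X x)\<close> is the point \<open>x\<close> in the hyperboloid model.\<close>
  have X1: "(X0 x)\<^sup>2 - X x \<bullet> X x = 1" if "x \<in> unit_ball" for x
  proof -
    define t where "t = (norm x)\<^sup>2"
    have nz: "1 - t \<noteq> 0" using unit_ball_pos[OF that] by (simp add: t_def)
    have "X x \<bullet> X x = (2 / (1 - t)) * ((2 / (1 - t)) * (x \<bullet> x))"
      unfolding X_def t_def by (simp only: inner_scaleR_left inner_scaleR_right)
    then have "X x \<bullet> X x = (2 / (1 - t))\<^sup>2 * t"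
      unfolding t_def power2_norm_eq_inner power2_eq_square[of "2 / _"] by (simp only: mult.assoc)
    then have "(X0 x)\<^sup>2 - X x \<bullet> X x = ((1 + t)\<^sup>2 - 4 * t) / (1 - t)\<^sup>2"
      by (simp add: X0_def t_def power_divide diff_divide_distrib)
    also have "(1 + t)\<^sup>2 - 4 * t = (1 - t)\<^sup>2" by (simp add: power2_eq_square algebra_simps)
    finally show ?thesis using nz by simp
  qed
  have XY: "cosh (hyp_dist x y) = X0 x * X0 y - X x \<bullet> X y"
    if x: "x \<in> unit_ball" and y: "y \<in> unit_ball" for x y
  proof -
    have nz: "1 - (norm x)\<^sup>2 \<noteq> 0" "1 - (norm y)\<^sup>2 \<noteq> 0"
      using unit_ball_pos[OF x] unit_ball_pos[OF y] by simp_all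
    have "(norm (x - y))\<^sup>2 = (norm x)\<^sup>2 + (norm y)\<^sup>2 - 2 * (x \<bullet> y)"
      by (simp add: power2_norm_eq_inner inner_diff_left inner_diff_right inner_commute)
    then have num: "(1 - (norm x)\<^sup>2) * (1 - (norm y)\<^sup>2) + 2 * (norm (x - y))\<^sup>2 =
        (1 + (norm x)\<^sup>2) * (1 + (norm y)\<^sup>2) - 4 * (x \<bullet> y)"
      by (simp add: algebra_simps)
    have "cosh (hyp_dist x y) =
        ((1 - (norm x)\<^sup>2) * (1 - (norm y)\<^sup>2) + 2 * (norm (x - y))\<^sup>2) / ((1 - (norm x)\<^sup>2) * (1 - (norm y)\<^sup>2))"
      unfolding cosh_hyp_dist[OF x y] using nz by (simp add: add_divide_distrib)
    also have "\<dots> = X0 x * X0 y - X x \<bullet> X y"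
      unfolding num by (simp add: X0_def X_def diff_divide_distrib)
    finally show ?thesis .
  qed
  let ?p = "cosh (hyp_dist x y)" and ?q = "cosh (hyp_dist y z)"
  have sq: "sqrt ((cosh r)\<^sup>2 - 1) = sinh r" if "0 \<le> r" for r :: real
    using that by (simp add: cosh_square_eq)
  have "cosh (hyp_dist x z) \<le> ?p * ?q + sqrt (?p\<^sup>2 - 1) * sqrt (?q\<^sup>2 - 1)"
    unfolding XY[OF x z] by (rule lorentz_triangle[OF X1[OF x] X1[OF y] X1[OF z] XY[OF x y] XY[OF y z]])
  also have "\<dots> = cosh (hyp_dist x y + hyp_dist y z)"
    by (simp only: sq[OF hyp_dist_nonneg[OF x y]] sq[OF hyp_dist_nonneg[OF y z]] cosh_add)
  finally show ?thesis
    using hyp_dist_nonneg[OF x y] hyp_dist_nonneg[OF y z] hyp_dist_nonneg[OF x z]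
    by (simp add: cosh_real_nonneg_le_iff)
qed

lemma continuous_on_hyp_dist: 
  fixes a :: "real^'n"
  assumes a: "a \<in> unit_ball"
  shows "continuous_on unit_ball (\<lambda>x. hyp_dist x a)"
proof -
  have eq: "hyp_dist x a = arcosh (1 + 2 * ((norm (x - a))\<^sup>2 / ((1 - (norm x)\<^sup>2) * (1 - (norm a)\<^sup>2))))"
    if "x \<in> unit_ball" for x
    using cosh_hyp_dist[OF that a] hyp_dist_nonneg[OF that a] by (metis arcosh_cosh_real)
  have "continuous_on unit_ball
    (\<lambda>x. arcosh (1 + 2 * ((norm (x - a))\<^sup>2 / ((1 - (norm x)\<^sup>2) * (1 - (norm a)\<^sup>2)))))"
  proof (intro continuous_on_compose2[OF continuous_on_arcosh[OF subset_refl]] image_subsetI; (intro continuous_intros ballI)?)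
    fix x :: "real^'n" assume "x \<in> unit_ball"
    then show "(1 - (norm x)\<^sup>2) * (1 - (norm a)\<^sup>2) \<noteq> 0" 
      using unit_ball_pos[of x] unit_ball_pos[OF a] by simp
  next
    fix x :: "real^'n" assume "x \<in> unit_ball"
    then show "1 + 2 * ((norm (x - a))\<^sup>2 / ((1 - (norm x)\<^sup>2) * (1 - (norm a)\<^sup>2))) \<in> {1..}"
      using unit_ball_pos[of x] unit_ball_pos[OF a] by simp
  qed
  then show ?thesis by (subst continuous_on_cong[OF refl eq])
qed

lemma hyp_dist_isometric:
  fixes x y x' y' :: "real^'n"
  assumes x: "x \<in> unit_ball" and y: "y \<in> unit_ball" and x': "x' \<in> unit_ball" and y': "y' \<in> unit_ball"
    and eq: "(norm (x' - y'))\<^sup>2 * ((1 - (norm x)\<^sup>2) * (1 - (norm y)\<^sup>2)) =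
             (norm (x - y))\<^sup>2 * ((1 - (norm x')\<^sup>2) * (1 - (norm y')\<^sup>2))"
  shows "hyp_dist x' y' = hyp_dist x y"
proof -
  have "cosh (hyp_dist x' y') = cosh (hyp_dist x y)"
  proof -
    have frac: "a / b = c / d" if "a * d = c * b" "b > 0" "d > 0" for a b c d :: real
      using that by (simp add: frac_eq_eq)
    show ?thesis
      unfolding cosh_hyp_dist[OF x y] cosh_hyp_dist[OF x' y']
      using unit_ball_pos[OF x] unit_ball_pos[OF y] unit_ball_pos[OF x'] unit_ball_pos[OF y']
      by (subst frac[OF eq]) auto
  qed
  then show ?thesis
    using hyp_dist_nonneg[OF x y] hyp_dist_nonneg[OF x' y'] by (metis arcosh_cosh_real)
qed

section \<open>Moebius transformations as Lorentz maps\<close>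

text \<open>The polarization of \<open>v \<bullet> v - u * w\<close> for vectors
  \<open>(u, v, w)\<close>, of signature (n+1, 1). The light cone up to scaling is the space with
  the point at infinity added, and Lorentz maps act on it as Moebius transformations.\<close>

definition lorentz_form :: "real \<times> (real^'n) \<times> real \<Rightarrow> real \<times> (real^'n) \<times> real \<Rightarrow> real" where
  "lorentz_form X Y = fst (snd X) \<bullet> fst (snd Y) - (fst X * snd (snd Y) + snd (snd X) * fst Y) / 2"

fun cone_lift :: "(real^'n) option \<Rightarrow> real \<times> (real^'n) \<times> real" where
  "cone_lift None = (1, 0, 0)"
| "cone_lift (Some x) = (x \<bullet> x, x, 1)"

definition lorentz_reflection ::
    "real \<times> (real^'n) \<times> real \<Rightarrow> real \<times> (real^'n) \<times> real \<Rightarrow> real \<times> (real^'n) \<times> real" where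
  "lorentz_reflection N X = X - (2 * lorentz_form X N / lorentz_form N N) *\<^sub>R N"

lemma lorentz_form_linear:
  "lorentz_form (X + X') Y = lorentz_form X Y + lorentz_form X' Y"
  "lorentz_form (X - X') Y = lorentz_form X Y - lorentz_form X' Y"
  "lorentz_form (c *\<^sub>R X) Y = c * lorentz_form X Y"
  "lorentz_form Y (X + X') = lorentz_form Y X + lorentz_form Y X'"
  "lorentz_form Y (X - X') = lorentz_form Y X - lorentz_form Y X'"
  "lorentz_form Y (c *\<^sub>R X) = c * lorentz_form Y X"
  by (simp_all add: lorentz_form_def inner_add_left inner_add_right inner_diff_left inner_diff_right
      field_simps)

lemma lorentz_form_commute: "lorentz_form X Y = lorentz_form Y X"
  by (simp add: lorentz_form_def inner_commute)

lemma linear_lorentz_reflection: "linear (lorentz_reflection N)"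
proof (rule linearI)
  fix X Y c
  have "2 * lorentz_form (X + Y) N / lorentz_form N N =
      2 * lorentz_form X N / lorentz_form N N + 2 * lorentz_form Y N / lorentz_form N N"
    by (simp add: lorentz_form_linear add_divide_distrib)
  then show "lorentz_reflection N (X + Y) = lorentz_reflection N X + lorentz_reflection N Y"
    unfolding lorentz_reflection_def by (simp add: scaleR_add_left)
  show "lorentz_reflection N (c *\<^sub>R X) = c *\<^sub>R lorentz_reflection N X"
    by (simp add: lorentz_reflection_def lorentz_form_linear scaleR_diff_right)
qed

lemma lorentz_form_reflection:
  assumes nz: "lorentz_form N N \<noteq> 0"
  shows "lorentz_form (lorentz_reflection N X) (lorentz_reflection N Y) = lorentz_form X Y"
proof -
  define a b where "a = 2 * lorentz_form X N / lorentz_form N N" and "b = 2 * lorentz_form Y N / lorentz_form N N"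
  have "lorentz_form (X - a *\<^sub>R N) (Y - b *\<^sub>R N) =
      lorentz_form X Y - b * lorentz_form X N - a * lorentz_form Y N + a * (b * lorentz_form N N)"
    by (simp only: lorentz_form_linear lorentz_form_commute[of N Y]) (simp add: algebra_simps)
  also have "a * (b * lorentz_form N N) = a * (2 * lorentz_form Y N)" using nz by (simp add: b_def)
  also have "b * lorentz_form X N = a * lorentz_form Y N" by (simp add: a_def b_def)
  finally show ?thesis unfolding lorentz_reflection_def a_def[symmetric] b_def[symmetric] by simp
qed

lemma lorentz_form_lift: "lorentz_form (cone_lift (Some x)) (cone_lift (Some y)) = - (norm (x - y))\<^sup>2 / 2"
  by (simp add: lorentz_form_def power2_norm_eq_inner inner_diff_left inner_diff_right inner_commute field_simps)

text \<open>The vector \<open>(2 * t, a, 0)\<close> pairs with the lift of \<open>x\<close> to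
  \<open>x \<bullet> a - t\<close>, so its orthogonal complement cuts out the hyperplane. Here even
  the normalization of the lift is preserved.\<close>

lemma hyperplane_reflection_lift:
  assumes a: "a \<noteq> 0"
  shows "lorentz_reflection (2 * t, a, 0) (cone_lift p) = cone_lift (hyperplane_reflection a t p)"
proof (cases p)
  case None
  then show ?thesis by (simp add: lorentz_reflection_def lorentz_form_def zero_prod_def)
next
  case (Some x)
  define c where "c = 2 * (x \<bullet> a - t) / (a \<bullet> a)"
  have "(x - c *\<^sub>R a) \<bullet> (x - c *\<^sub>R a) = x \<bullet> x - c * (2 * (x \<bullet> a) - c * (a \<bullet> a))"
    by (simp add: inner_diff_left inner_diff_right inner_commute algebra_simps)
  also have "c * (a \<bullet> a) = 2 * (x \<bullet> a - t)" using a by (simp add: c_def)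
  finally have 1: "(x - c *\<^sub>R a) \<bullet> (x - c *\<^sub>R a) = x \<bullet> x - c * (2 * t)" by simp
  have 2: "2 * lorentz_form (cone_lift p) (2 * t, a, 0) / lorentz_form (2 * t, a, 0) (2 * t, a, 0) = c"
    by (simp add: Some lorentz_form_def c_def)
  show ?thesis
    unfolding lorentz_reflection_def 2
    by (simp only: Some cone_lift.simps hyperplane_reflection.simps c_def[symmetric] 1) simp
qed

text \<open>The vector \<open>(a \<bullet> a - r\<^sup>2, a, 1)\<close> pairs with the lift of
  \<open>x\<close> to half of \<open>r\<^sup>2 - (norm (x - a))\<^sup>2\<close>, hence represents
  the sphere. The factor \<open>s\<close> depends on \<open>p\<close>: reflection does not keep the
  last coordinate equal to 1.\<close>

lemma sphere_inversion_lift: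
  fixes a :: "real^'n"
  assumes r: "r > 0"
  shows "\<exists>s. s \<noteq> 0 \<and> lorentz_reflection (a \<bullet> a - r\<^sup>2, a, 1) (cone_lift p) = s *\<^sub>R cone_lift (sphere_inversion a r p)"
proof -
  let ?N = "(a \<bullet> a - r\<^sup>2, a, 1)"
  have NN: "lorentz_form ?N ?N = r\<^sup>2" by (simp add: lorentz_form_def field_simps)
  show ?thesis
  proof (cases p)
    case None
    have "lorentz_form (cone_lift p) ?N = - 1 / 2" by (simp add: None lorentz_form_def)
    then have "lorentz_reflection ?N (cone_lift p) = cone_lift p + (1 / r\<^sup>2) *\<^sub>R ?N"
      unfolding lorentz_reflection_def NN by simp
    also have "\<dots> = (1 / r\<^sup>2) *\<^sub>R cone_lift (sphere_inversion a r p)"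
      using r by (simp add: None field_simps)
    finally show ?thesis using r by (intro exI[of _ "1 / r\<^sup>2"]) simp
  next
    case (Some x)
    define d where "d = (norm (x - a))\<^sup>2"
    have dd: "d = x \<bullet> x - 2 * (x \<bullet> a) + a \<bullet> a"
      by (simp add: d_def power2_norm_eq_inner inner_diff_left inner_diff_right inner_commute)
    have "lorentz_form (cone_lift p) ?N = (r\<^sup>2 - d) / 2"
      by (simp add: Some lorentz_form_def dd field_simps)
    then have R: "lorentz_reflection ?N (cone_lift p) = cone_lift p - (1 - d / r\<^sup>2) *\<^sub>R ?N"
      unfolding lorentz_reflection_def NN using r by (simp add: diff_divide_distrib)
    show ?thesis
    proof (cases "x = a")
      case True
      then have "lorentz_reflection ?N (cone_lift p) = r\<^sup>2 *\<^sub>R cone_lift (sphere_inversion a r p)"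
        unfolding R by (simp add: Some d_def zero_prod_def)
      then show ?thesis using r by (intro exI[of _ "r\<^sup>2"]) simp
    next
      case False
      then have d0: "d \<noteq> 0" by (simp add: d_def)
      define y where "y = a + (r\<^sup>2 / d) *\<^sub>R (x - a)"
      have si: "sphere_inversion a r p = Some y" using False by (simp add: Some y_def d_def)
      have xa: "(x - a) \<bullet> (x - a) = d" by (simp add: d_def power2_norm_eq_inner)
      have "(a + k *\<^sub>R (x - a)) \<bullet> (a + k *\<^sub>R (x - a)) = a \<bullet> a + 2 * k * (a \<bullet> (x - a)) + k\<^sup>2 * d" for k
        by (simp only: inner_add_left inner_add_right inner_scaleR_left inner_scaleR_right xa inner_commute[of "x - a" a])
          (simp add: power2_eq_square distrib_left)
      then have "y \<bullet> y = a \<bullet> a + 2 * (r\<^sup>2 / d) * (a \<bullet> (x - a)) + (r\<^sup>2 / d)\<^sup>2 * d"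
        unfolding y_def .
      also have "(r\<^sup>2 / d)\<^sup>2 * d = r\<^sup>2 * r\<^sup>2 / d" using d0 by (simp add: field_simps power2_eq_square)
      also have "a \<bullet> (x - a) = (x \<bullet> x - a \<bullet> a - d) / 2"
        by (simp add: dd inner_diff_right inner_commute)
      finally have yy: "(d / r\<^sup>2) * (y \<bullet> y) = x \<bullet> x - (1 - d / r\<^sup>2) * (a \<bullet> a - r\<^sup>2)"
        using d0 r by (simp add: field_simps)
      have "(d / r\<^sup>2) *\<^sub>R y = (d / r\<^sup>2) *\<^sub>R a + (x - a)"
        unfolding y_def using d0 r by (simp add: scaleR_add_right)
      then have "(d / r\<^sup>2) *\<^sub>R y = x - (1 - d / r\<^sup>2) *\<^sub>R a"
        by (simp add: scaleR_diff_left)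
      then have "lorentz_reflection ?N (cone_lift p) = (d / r\<^sup>2) *\<^sub>R cone_lift (Some y)"
        unfolding R using yy by (simp add: Some)
      then show ?thesis unfolding si using d0 r by (intro exI[of _ "d / r\<^sup>2"]) simp
    qed
  qed
qed

text \<open>The factor varies with the point, so \<open>M\<close> describes \<open>F\<close> through
  lines on the light cone; under composition the factors multiply.\<close>

lemma moebius_lorentz:
  assumes "F \<in> moebius_maps"
  shows "\<exists>M. linear M \<and> (\<forall>X Y. lorentz_form (M X) (M Y) = lorentz_form X Y) \<and>
             (\<forall>p. \<exists>s. s \<noteq> 0 \<and> M (cone_lift p) = s *\<^sub>R cone_lift (F p))"
  using assms
proof induction
  case moebius_id
  show ?case
    by (rule exI[of _ "\<lambda>x. x"]) (auto intro!: exI[of _ 1] linear_ident)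
next
  case (moebius_hyperplane F a t)
  then obtain M where M: "linear M" "\<And>X Y. lorentz_form (M X) (M Y) = lorentz_form X Y"
      "\<And>p. \<exists>s. s \<noteq> 0 \<and> M (cone_lift p) = s *\<^sub>R cone_lift (F p)" by blast
  let ?R = "lorentz_reflection (2 * t, a, 0)"
  have nz: "lorentz_form (2 * t, a, 0) (2 * t, a, 0) \<noteq> 0"
    using \<open>a \<noteq> 0\<close> by (simp add: lorentz_form_def)
  show ?case
  proof (intro exI[of _ "?R \<circ> M"] conjI allI)
    show "linear (?R \<circ> M)" by (rule linear_compose[OF M(1) linear_lorentz_reflection])
    show "lorentz_form ((?R \<circ> M) X) ((?R \<circ> M) Y) = lorentz_form X Y" for X Y
      by (simp add: lorentz_form_reflection[OF nz] M(2))
    fix p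
    obtain s where s: "s \<noteq> 0" "M (cone_lift p) = s *\<^sub>R cone_lift (F p)" using M(3) by blast
    have "(?R \<circ> M) (cone_lift p) = s *\<^sub>R cone_lift ((hyperplane_reflection a t \<circ> F) p)"
      by (simp add: s linear_cmul[OF linear_lorentz_reflection] hyperplane_reflection_lift[OF \<open>a \<noteq> 0\<close>])
    then show "\<exists>s. s \<noteq> 0 \<and> (?R \<circ> M) (cone_lift p) = s *\<^sub>R cone_lift ((hyperplane_reflection a t \<circ> F) p)"
      using s(1) by blast
  qed
next
  case (moebius_sphere F r a)
  then obtain M where M: "linear M" "\<And>X Y. lorentz_form (M X) (M Y) = lorentz_form X Y"
      "\<And>p. \<exists>s. s \<noteq> 0 \<and> M (cone_lift p) = s *\<^sub>R cone_lift (F p)" by blast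
  let ?N = "(a \<bullet> a - r\<^sup>2, a, 1)"
  let ?R = "lorentz_reflection ?N"
  have nz: "lorentz_form ?N ?N \<noteq> 0"
    using \<open>r > 0\<close> by (simp add: lorentz_form_def field_simps)
  show ?case
  proof (intro exI[of _ "?R \<circ> M"] conjI allI)
    show "linear (?R \<circ> M)" by (rule linear_compose[OF M(1) linear_lorentz_reflection])
    show "lorentz_form ((?R \<circ> M) X) ((?R \<circ> M) Y) = lorentz_form X Y" for X Y
      by (simp add: lorentz_form_reflection[OF nz] M(2))
    fix p
    obtain s where s: "s \<noteq> 0" "M (cone_lift p) = s *\<^sub>R cone_lift (F p)" using M(3) by blast
    obtain s' where s': "s' \<noteq> 0" "?R (cone_lift (F p)) = s' *\<^sub>R cone_lift (sphere_inversion a r (F p))"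
      using sphere_inversion_lift[OF \<open>r > 0\<close>] by blast
    have "(?R \<circ> M) (cone_lift p) = (s * s') *\<^sub>R cone_lift ((sphere_inversion a r \<circ> F) p)"
      by (simp add: s s' linear_cmul[OF linear_lorentz_reflection])
    then show "\<exists>s. s \<noteq> 0 \<and> (?R \<circ> M) (cone_lift p) = s *\<^sub>R cone_lift ((sphere_inversion a r \<circ> F) p)"
      using s(1) s'(1) by (metis mult_eq_0_iff)
  qed
qed

text \<open>The last coordinate of the lift of a point is 1, so the factor at \<open>x\<close> can
  be read off as the last coordinate of \<open>M (x \<bullet> x, x, 1)\<close>; in this form it is
  visibly continuous in \<open>x\<close>.\<close>

lemma moebius_ball_lorentz:
  fixes g :: "real^'n \<Rightarrow> real^'n"
  assumes g: "g \<in> moebius_ball_maps"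
  obtains M s where "linear M" "\<And>X Y. lorentz_form (M X) (M Y) = lorentz_form X Y"
    "\<And>x. x \<in> unit_ball \<Longrightarrow> s x \<noteq> 0" "\<And>x. x \<in> unit_ball \<Longrightarrow> M (x \<bullet> x, x, 1) = s x *\<^sub>R (g x \<bullet> g x, g x, 1)"
    "\<And>x. s x = snd (snd (M (x \<bullet> x, x, 1)))"
proof -
  obtain F where F: "F \<in> moebius_maps" "\<And>x. x \<in> unit_ball \<Longrightarrow> F (Some x) = Some (g x)"
    using g unfolding moebius_ball_maps_def by blast
  obtain M where M: "linear M" "\<And>X Y. lorentz_form (M X) (M Y) = lorentz_form X Y"
      "\<And>p. \<exists>s. s \<noteq> 0 \<and> M (cone_lift p) = s *\<^sub>R cone_lift (F p)"
    using moebius_lorentz[OF F(1)] by blast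
  define s where "s = (\<lambda>x. snd (snd (M (x \<bullet> x, x, 1))))"
  have *: "s x \<noteq> 0 \<and> M (x \<bullet> x, x, 1) = s x *\<^sub>R (g x \<bullet> g x, g x, 1)" if x: "x \<in> unit_ball" for x
  proof -
    obtain c where c: "c \<noteq> 0" "M (cone_lift (Some x)) = c *\<^sub>R cone_lift (F (Some x))" using M(3) by blast
    then have "M (x \<bullet> x, x, 1) = c *\<^sub>R (g x \<bullet> g x, g x, 1)" using F(2)[OF x] by simp
    moreover from this have "s x = c" by (simp add: s_def)
    ultimately show ?thesis using c(1) by simp
  qed
  show ?thesis
    by (rule that[of M s]) (use M * in \<open>auto simp: s_def\<close>)
qed

text \<open>Dividing the middle coordinate of the image of the lift by the last one exhibits
  \<open>g\<close> as a quotient of maps that are polynomial of degree at most two.\<close>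

lemma moebius_ball_differentiable:
  fixes g :: "real^'n \<Rightarrow> real^'n"
  assumes g: "g \<in> moebius_ball_maps" and x: "x \<in> unit_ball"
  shows "g differentiable (at x)"
proof -
  obtain M s where M: "linear M" and pres: "\<And>X Y. lorentz_form (M X) (M Y) = lorentz_form X Y"
    and s0: "\<And>x. x \<in> unit_ball \<Longrightarrow> s x \<noteq> 0"
    and Ms: "\<And>x. x \<in> unit_ball \<Longrightarrow> M (x \<bullet> x, x, 1) = s x *\<^sub>R (g x \<bullet> g x, g x, 1)"
    and s: "\<And>x. s x = snd (snd (M (x \<bullet> x, x, 1)))"
    using moebius_ball_lorentz[OF g] by metis
  have bM: "bounded_linear M" using M linear_conv_bounded_linear by blast
  obtain L where L: "((\<lambda>x. M (x \<bullet> x, x, 1)) has_derivative L) (at x)"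
  proof -
    have 1: "((\<lambda>x. (x \<bullet> x, x, 1::real)) has_derivative (\<lambda>h. (x \<bullet> h + h \<bullet> x, h, 0))) (at x)"
      by (intro has_derivative_Pair has_derivative_inner has_derivative_ident has_derivative_const)
    show thesis by (rule that[OF bounded_linear.has_derivative[OF bM 1]])
  qed
  have 2: "((\<lambda>x. snd (snd (M (x \<bullet> x, x, 1)))) has_derivative (\<lambda>h. snd (snd (L h)))) (at x)"
    by (intro has_derivative_snd L)
  have 3: "((\<lambda>x. fst (snd (M (x \<bullet> x, x, 1)))) has_derivative (\<lambda>h. fst (snd (L h)))) (at x)"
    by (intro has_derivative_snd has_derivative_fst L)
  have "(\<lambda>x. inverse (snd (snd (M (x \<bullet> x, x, 1)))) *\<^sub>R fst (snd (M (x \<bullet> x, x, 1)))) differentiable (at x)"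
    by (intro differentiable_scaleR differentiable_inverse differentiableI[OF 2] differentiableI[OF 3])
      (use s0[OF x] in \<open>simp add: s\<close>)
  then obtain D where D: "((\<lambda>x. inverse (snd (snd (M (x \<bullet> x, x, 1)))) *\<^sub>R fst (snd (M (x \<bullet> x, x, 1)))) has_derivative D) (at x)"
    by (auto simp: differentiable_def)
  have eq: "inverse (snd (snd (M (y \<bullet> y, y, 1)))) *\<^sub>R fst (snd (M (y \<bullet> y, y, 1))) = g y" if "y \<in> unit_ball" for y
    using s0[OF that] by (simp add: Ms[OF that])
  have "(g has_derivative D) (at x)"
    by (rule has_derivative_transform_within_open[OF D open_ball x eq])
  then show ?thesis by (auto simp: differentiable_def)
qed

lemma moebius_ball_continuous_on: "g \<in> moebius_ball_maps \<Longrightarrow> continuous_on unit_ball g"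
  by (meson continuous_at_imp_continuous_on differentiable_imp_continuous_within moebius_ball_differentiable)

text \<open>The vector \<open>E\<close> represents the unit sphere, \<open>2 * lorentz_form (cone_lift (Some x)) E\<close> being
  \<open>1 - (norm x)\<^sup>2\<close>. As \<open>g\<close> is proper, the preimage of \<open>E\<close> vanishes on the sphere, which leaves
  only the multiples of \<open>E\<close>, and the Lorentz form excludes all but \<open>E\<close> and \<open>-E\<close>.\<close>

lemma moebius_ball_identity:
  fixes g h :: "real^'n \<Rightarrow> real^'n"
  assumes g: "g \<in> moebius_ball_maps" and h: "continuous_on unit_ball h" "h ` unit_ball \<subseteq> unit_ball"
    and hg: "\<And>x. x \<in> unit_ball \<Longrightarrow> h (g x) = x"
    and x: "x \<in> unit_ball" and y: "y \<in> unit_ball"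
  shows "(norm (g x - g y))\<^sup>2 * ((1 - (norm x)\<^sup>2) * (1 - (norm y)\<^sup>2)) =
         (norm (x - y))\<^sup>2 * ((1 - (norm (g x))\<^sup>2) * (1 - (norm (g y))\<^sup>2))"
proof -
  obtain M s where M: "linear M" and pres: "\<And>X Y. lorentz_form (M X) (M Y) = lorentz_form X Y"
    and s0: "\<And>x. x \<in> unit_ball \<Longrightarrow> s x \<noteq> 0"
    and Ms: "\<And>x. x \<in> unit_ball \<Longrightarrow> M (x \<bullet> x, x, 1) = s x *\<^sub>R (g x \<bullet> g x, g x, 1)"
    and s: "\<And>x. s x = snd (snd (M (x \<bullet> x, x, 1)))"
    using moebius_ball_lorentz[OF g] by metis
  have gB: "g x \<in> unit_ball" if "x \<in> unit_ball" for x
    using g that unfolding moebius_ball_maps_def Bij_def bij_betw_def by blast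
  define E where "E = (- 1 :: real, 0 :: real^'n, 1::real)"
  \<comment> \<open>A vector in the kernel is orthogonal to everything, and the form is
    nondegenerate.\<close>
  have "inj M"
  proof -
    have "X = 0" if "M X = 0" for X
    proof -
      have z: "lorentz_form X Y = 0" for Y
        using pres[of X Y] that by (simp add: lorentz_form_def)
      obtain u v w where X: "X = (u, v, w)" by (cases X) auto
      have "w = 0" "u = 0" "v = 0"
        using z[of "(1, 0, 0)"] z[of "(0, 0, 1)"] z[of "(0, v, 0)"] by (simp_all add: X lorentz_form_def)
      then show ?thesis by (simp add: X zero_prod_def)
    qed
    then show ?thesis using linear_injective_0[OF M] by blast
  qed
  then have "surj M" using linear_injective_imp_surjective[OF M] by blast
  then obtain E' where E': "M E' = E" by (metis surjD)
  obtain u v w where uvw: "E' = (u, v, w)" by (cases E') auto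
  define Q where "Q = (\<lambda>x. lorentz_form (x \<bullet> x, x, 1) E')"
  have Q: "Q x = x \<bullet> v - (x \<bullet> x * w + u) / 2" for x
    by (simp add: Q_def uvw lorentz_form_def)
  have Qs: "Q x = s x * (1 - (norm (g x))\<^sup>2) / 2" if "x \<in> unit_ball" for x
  proof -
    have "Q x = lorentz_form (M (x \<bullet> x, x, 1)) E"
      unfolding Q_def E'[symmetric] pres ..
    also have "\<dots> = s x * (1 - (norm (g x))\<^sup>2) / 2"
      by (simp only: Ms[OF that] lorentz_form_linear)
         (simp add: E_def lorentz_form_def power2_norm_eq_inner field_simps)
    finally show ?thesis .
  qed
  \<comment> \<open>By \<open>Qs\<close>, \<open>Q x\<close> is half of
    \<open>s x * (1 - (norm (g x))\<^sup>2)\<close>. If it stayed away from 0 near the end of a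
    radius, \<open>g\<close> would keep that end in a compact part of the ball, and the inverse
    \<open>h\<close> would put the end point \<open>\<xi>\<close> inside the ball.\<close>
  have Q_sphere: "Q \<xi> = 0" if \<xi>: "norm \<xi> = 1" for \<xi>
  proof (rule ccontr)
    assume nz: "Q \<xi> \<noteq> 0"
    have contQ: "continuous_on UNIV (\<lambda>x. Q x)" unfolding Q by (intro continuous_intros) auto
    have conts: "continuous_on UNIV (\<lambda>x. s x)"
    proof -
      have "continuous_on UNIV (\<lambda>x. M (x \<bullet> x, x, 1))"
        by (intro linear_continuous_on_compose[OF _ M] continuous_intros)
      then show ?thesis unfolding s by (intro continuous_intros)
    qed
    define a where "a = (\<lambda>k::nat. (1 - inverse (real (Suc k))) *\<^sub>R \<xi>)"
    have a_ball: "a k \<in> unit_ball" for k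
    proof -
      have "0 < inverse (real (Suc k))" "inverse (real (Suc k)) \<le> 1" by (simp_all add: inverse_le_1_iff)
      then have "\<bar>1 - inverse (real (Suc k))\<bar> < 1" by linarith
      then show ?thesis unfolding a_def by (simp only: mem_ball_0 norm_scaleR \<xi> mult_1_right)
    qed
    have "a \<longlonglongrightarrow> (1 - 0) *\<^sub>R \<xi>"
      unfolding a_def by (intro tendsto_scaleR tendsto_diff tendsto_const LIMSEQ_inverse_real_of_nat)
    then have a_lim: "a \<longlonglongrightarrow> \<xi>" by simp
    have Qa: "(\<lambda>k. Q (a k)) \<longlonglongrightarrow> Q \<xi>"
      by (rule continuous_on_tendsto_compose[OF contQ a_lim]) auto
    have sa: "(\<lambda>k. s (a k)) \<longlonglongrightarrow> s \<xi>"
      by (rule continuous_on_tendsto_compose[OF conts a_lim]) auto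
    obtain S where S: "\<And>k. norm (s (a k)) \<le> S" "S > 0"
      using convergent_imp_Bseq[OF convergentI[OF sa]] by (elim BseqE) blast
    define \<eta> where "\<eta> = \<bar>Q \<xi>\<bar> / 2"
    have \<eta>: "\<eta> > 0" using nz by (simp add: \<eta>_def)
    have "\<forall>\<^sub>F k in sequentially. \<eta> < \<bar>Q (a k)\<bar>"
      by (rule order_tendstoD(1)[OF tendsto_rabs[OF Qa]]) (use nz in \<open>simp add: \<eta>_def\<close>)
    then have ev: "\<forall>\<^sub>F k in sequentially. a k \<in> h ` cball 0 (sqrt (1 - min 1 (2 * \<eta> / S)))"
    proof eventually_elim
      case (elim k)
      have g1: "0 < 1 - (norm (g (a k)))\<^sup>2" using unit_ball_pos[OF gB[OF a_ball]] .
      have "2 * \<eta> \<le> \<bar>s (a k)\<bar> * (1 - (norm (g (a k)))\<^sup>2)"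
        using elim g1 unfolding Qs[OF a_ball] by (simp add: abs_mult)
      also have "\<dots> \<le> S * (1 - (norm (g (a k)))\<^sup>2)" using g1 S(1)[of k] by (intro mult_right_mono) auto
      finally have "2 * \<eta> / S \<le> 1 - (norm (g (a k)))\<^sup>2" using S by (simp add: pos_divide_le_eq mult.commute)
      then have "(norm (g (a k)))\<^sup>2 \<le> 1 - min 1 (2 * \<eta> / S)" by linarith
      then have "norm (g (a k)) \<le> sqrt (1 - min 1 (2 * \<eta> / S))" by (rule real_le_rsqrt)
      then show ?case using hg[OF a_ball] by (intro image_eqI[of _ _ "g (a k)"]) auto
    qed
    have sub: "cball 0 (sqrt (1 - min 1 (2 * \<eta> / S))) \<subseteq> (unit_ball :: (real^'n) set)"
    proof -
      have "0 < min 1 (2 * \<eta> / S)" using \<eta> S by simp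
      then have "sqrt (1 - min 1 (2 * \<eta> / S)) < 1" by (subst real_sqrt_lt_1_iff) linarith
      moreover have "cball 0 \<rho> \<subseteq> (unit_ball :: (real^'n) set)" if "\<rho> < 1" for \<rho>
        using that by auto
      ultimately show ?thesis by blast
    qed
    have cl: "closed (h ` cball 0 (sqrt (1 - min 1 (2 * \<eta> / S))))"
      by (intro compact_imp_closed compact_continuous_image continuous_on_subset[OF h(1) sub]) auto
    have "\<xi> \<in> h ` cball 0 (sqrt (1 - min 1 (2 * \<eta> / S)))"
      using Lim_in_closed_set[OF cl ev _ a_lim] by simp
    then have "\<xi> \<in> unit_ball" using sub h(2) by blast
    then show False using \<xi> by simp
  qed
  have uw: "\<xi> \<bullet> v = (w + u) / 2" if "norm \<xi> = 1" for \<xi>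
    using Q_sphere[OF that] that by (simp add: Q norm_eq_1)
  obtain i :: 'n where True by simp
  \<comment> \<open>Opposite unit vectors give opposite values on the left of \<open>uw\<close>, so
    the common right side vanishes.\<close>
  have wu: "w + u = 0"
    using uw[of "axis i 1"] uw[of "- axis i 1"] by (simp add: norm_axis_1)
  have v0: "v = 0"
  proof (rule ccontr)
    assume "v \<noteq> 0"
    then show False using uw[of "v /\<^sub>R norm v"] wu by simp
  qed
  have "lorentz_form E' E' = lorentz_form E E" using pres[of E' E'] by (simp add: E')
  then have w2: "w\<^sup>2 = 1" using wu by (simp add: uvw E_def lorentz_form_def v0 power2_eq_square add_eq_0_iff2)
  have Qx: "Q x = w * (1 - (norm x)\<^sup>2) / 2" for x
    using wu by (simp add: Q v0 power2_norm_eq_inner field_simps add_eq_0_iff2)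
  have sx: "s x * (1 - (norm (g x))\<^sup>2) = w * (1 - (norm x)\<^sup>2)" if "x \<in> unit_ball" for x
    using Qs[OF that] Qx[of x] by simp
  have dist: "(norm (x - y))\<^sup>2 = s x * s y * (norm (g x - g y))\<^sup>2"
  proof -
    have "lorentz_form (M (x \<bullet> x, x, 1)) (M (y \<bullet> y, y, 1)) = - (norm (x - y))\<^sup>2 / 2"
      unfolding pres using lorentz_form_lift[of x y] by simp
    moreover have "lorentz_form (M (x \<bullet> x, x, 1)) (M (y \<bullet> y, y, 1)) = s x * (s y * (- (norm (g x - g y))\<^sup>2 / 2))"
      unfolding Ms[OF x] Ms[OF y] lorentz_form_linear using lorentz_form_lift[of "g x" "g y"] by simp
    ultimately show ?thesis by simp
  qed
  \<comment> \<open>Only \<open>w\<^sup>2\<close> enters, so the two signs of \<open>w\<close>,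
    belonging to \<open>E\<close> and \<open>-E\<close>, need not be told apart.\<close>
  have "w * (1 - (norm x)\<^sup>2) * (w * (1 - (norm y)\<^sup>2)) = (1 - (norm x)\<^sup>2) * (1 - (norm y)\<^sup>2)"
    using w2 by (simp add: power2_eq_square mult.left_commute mult.assoc)
  then have "(1 - (norm x)\<^sup>2) * (1 - (norm y)\<^sup>2) =
      s x * (1 - (norm (g x))\<^sup>2) * (s y * (1 - (norm (g y))\<^sup>2))"
    unfolding sx[OF x] sx[OF y] by simp
  then show ?thesis unfolding dist by (simp add: mult_ac)
qed

section \<open>Discontinuous groups and their orbit spaces\<close>

locale moebius_group =
  fixes G :: "(real^'n \<Rightarrow> real^'n) set"
  assumes group: "moebius_ball_group G"
    and discontinuous: "acts_discontinuously G"
    and fixed_point_free: "fixed_point_free G"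
begin

text \<open>Inverse, product and unit of \<open>BijGroup\<close> as plain functions that can be
  evaluated at points; the restriction to the ball matches the extensional elements of
  \<open>Bij\<close>.\<close>

definition ginv :: "(real^'n \<Rightarrow> real^'n) \<Rightarrow> real^'n \<Rightarrow> real^'n" where
  "ginv g = restrict (inv_into unit_ball g) unit_ball"

definition gmult :: "(real^'n \<Rightarrow> real^'n) \<Rightarrow> (real^'n \<Rightarrow> real^'n) \<Rightarrow> real^'n \<Rightarrow> real^'n" where
  "gmult g h = compose unit_ball g h"

definition gone :: "real^'n \<Rightarrow> real^'n" where
  "gone = (\<lambda>x\<in>unit_ball. x)"

section \<open>Pointwise calculus in the group and its action by isometries\<close>

lemma G_moebius: "g \<in> G \<Longrightarrow> g \<in> moebius_ball_maps"
  using group unfolding moebius_ball_group_def by blast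

lemma G_Bij: "g \<in> G \<Longrightarrow> g \<in> Bij unit_ball"
  using G_moebius unfolding moebius_ball_maps_def by blast

lemma G_bij_betw: "g \<in> G \<Longrightarrow> bij_betw g unit_ball unit_ball"
  using G_Bij unfolding Bij_def by blast

lemma G_in_ball [simp]: "g \<in> G \<Longrightarrow> x \<in> unit_ball \<Longrightarrow> g x \<in> unit_ball"
  using G_bij_betw bij_betwE by blast

lemma G_norm [simp]: "g \<in> G \<Longrightarrow> norm x < 1 \<Longrightarrow> norm (g x) < 1"
  using G_in_ball[of g x] by simp

lemma subgroup_G: "subgroup G (BijGroup unit_ball)"
  using group unfolding moebius_ball_group_def by blast

lemma gone_eq: "gone = \<one>\<^bsub>BijGroup unit_ball\<^esub>"
  by (simp add: gone_def BijGroup_def)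

lemma gone_closed [simp, intro]: "gone \<in> G"
  unfolding gone_eq by (rule subgroup.one_closed[OF subgroup_G])

lemma gone_apply [simp]: "x \<in> unit_ball \<Longrightarrow> gone x = x"
  by (simp add: gone_def)

lemma gmult_closed [simp, intro]: "g \<in> G \<Longrightarrow> h \<in> G \<Longrightarrow> gmult g h \<in> G"
  using subgroup.m_closed[OF subgroup_G, of g h] G_Bij[of g] G_Bij[of h]
  by (simp add: gmult_def BijGroup_def)

lemma gmult_apply [simp]: "x \<in> unit_ball \<Longrightarrow> gmult g h x = g (h x)"
  by (simp add: gmult_def compose_def)

lemma ginv_closed [simp, intro]: "g \<in> G \<Longrightarrow> ginv g \<in> G"
  using subgroup.m_inv_closed[OF subgroup_G, of g] inv_BijGroup[OF G_Bij, of g]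
  by (simp add: ginv_def restrict_def)

lemma ginv_left [simp]: "g \<in> G \<Longrightarrow> x \<in> unit_ball \<Longrightarrow> ginv g (g x) = x"
  using G_bij_betw[of g] G_in_ball[of g x] by (simp add: ginv_def bij_betw_inv_into_left)

lemma ginv_right [simp]: "g \<in> G \<Longrightarrow> x \<in> unit_ball \<Longrightarrow> g (ginv g x) = x"
  using G_bij_betw[of g] by (simp add: ginv_def bij_betw_inv_into_right)

lemma G_eqI:
  assumes "g \<in> G" "h \<in> G" "\<And>x. x \<in> unit_ball \<Longrightarrow> g x = h x"
  shows "g = h"
  using assms G_Bij[of g] G_Bij[of h] by (intro extensionalityI[of g unit_ball h]) (auto simp: Bij_def)

lemma G_free:
  assumes "g \<in> G" "x \<in> unit_ball" "g x = x"
  shows "g = gone"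
  using fixed_point_free assms unfolding fixed_point_free_def gone_eq by blast

text \<open>The element \<open>gmult (ginv h) g\<close> fixes \<open>x\<close>, so it is the
  identity by freeness.\<close>

lemma G_eq_at:
  assumes g: "g \<in> G" and h: "h \<in> G" and x: "x \<in> unit_ball" and eq: "g x = h x"
  shows "g = h"
proof -
  have "gmult (ginv h) g x = x" using assms by simp
  then have "gmult (ginv h) g = gone" using G_free g h x by blast
  then have *: "ginv h (g y) = y" if "y \<in> unit_ball" for y
    using that by (metis gmult_apply gone_apply)
  show ?thesis
  proof (rule G_eqI[OF g h])
    fix y :: "real^'n" assume y: "y \<in> unit_ball"
    then show "g y = h y" using ginv_right[OF h G_in_ball[OF g y]] *[OF y] by simp
  qed
qed

lemma G_continuous_on: "g \<in> G \<Longrightarrow> continuous_on unit_ball g"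
  by (rule moebius_ball_continuous_on[OF G_moebius])

lemma G_differentiable: "g \<in> G \<Longrightarrow> x \<in> unit_ball \<Longrightarrow> g differentiable (at x)"
  by (rule moebius_ball_differentiable[OF G_moebius])

lemma G_identity:
  assumes g: "g \<in> G" and x: "x \<in> unit_ball" and y: "y \<in> unit_ball"
  shows "(norm (g x - g y))\<^sup>2 * ((1 - (norm x)\<^sup>2) * (1 - (norm y)\<^sup>2)) =
         (norm (x - y))\<^sup>2 * ((1 - (norm (g x))\<^sup>2) * (1 - (norm (g y))\<^sup>2))"
  by (rule moebius_ball_identity[OF G_moebius[OF g] G_continuous_on[OF ginv_closed[OF g]] _ _ x y])
    (use g in auto)

lemma hyp_dist_G [simp]:
  "g \<in> G \<Longrightarrow> x \<in> unit_ball \<Longrightarrow> y \<in> unit_ball \<Longrightarrow> hyp_dist (g x) (g y) = hyp_dist x y"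
  by (rule hyp_dist_isometric) (use G_identity in auto)

lemma hyp_dist_ginv:
  assumes "g \<in> G" "x \<in> unit_ball" "y \<in> unit_ball"
  shows "hyp_dist (ginv g x) y = hyp_dist x (g y)"
  using hyp_dist_G[of g "ginv g x" y] assms by (simp del: hyp_dist_G)

text \<open>Dividing the isometry identity for \<open>x\<close> and \<open>x + t *\<^sub>R v\<close>
  by \<open>t\<^sup>2\<close> and letting \<open>t\<close> tend to 0 gives
  \<open>norm (L v) = \<tau> * norm v\<close>. So the derivative is conformal, and \<open>L\<close>
  scaled by \<open>1 / \<tau>\<close> is orthogonal.\<close>

lemma G_derivative_det:
  assumes g: "g \<in> G" and x: "x \<in> unit_ball" and L: "(g has_derivative L) (at x)"
  shows "\<bar>det (matrix L)\<bar> = ((1 - (norm (g x))\<^sup>2) / (1 - (norm x)\<^sup>2)) ^ CARD('n)"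
proof -
  define \<tau> where "\<tau> = (1 - (norm (g x))\<^sup>2) / (1 - (norm x)\<^sup>2)"
  have nx: "0 < 1 - (norm x)\<^sup>2" and ngx: "0 < 1 - (norm (g x))\<^sup>2"
    using unit_ball_pos[OF x] unit_ball_pos[OF G_in_ball[OF g x]] by simp_all
  have \<tau>: "\<tau> > 0" using nx ngx by (simp add: \<tau>_def)
  have linL: "linear L" using L has_derivative_linear by blast
  have normL: "norm (L v) = \<tau> * norm v" for v
  proof -
    have lim0: "((\<lambda>t. x + t *\<^sub>R v) \<longlongrightarrow> x) (at 0)"
      by (rule tendsto_eq_intros refl | simp)+
    have gx: "isCont g x" using L has_derivative_continuous by blast
    have limg: "((\<lambda>t. g (x + t *\<^sub>R v)) \<longlongrightarrow> g x) (at 0)"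
      by (rule isCont_tendsto_compose[OF gx lim0])
    have "((\<lambda>t. g (x + t *\<^sub>R v)) has_derivative (\<lambda>t. t *\<^sub>R L v)) (at 0)"
    proof -
      have 1: "((\<lambda>t. x + t *\<^sub>R v) has_derivative (\<lambda>t. t *\<^sub>R v)) (at 0)"
        by (auto intro!: derivative_eq_intros)
      have "((\<lambda>t. g (x + t *\<^sub>R v)) has_derivative (\<lambda>t. L (t *\<^sub>R v))) (at 0)"
        by (rule has_derivative_compose[OF 1]) (use L in simp)
      then show ?thesis
        by (simp add: linear_cmul[OF linL])
    qed
    then have "((\<lambda>t. norm (g (x + t *\<^sub>R v) - g x - t *\<^sub>R L v) / norm t) \<longlongrightarrow> 0) (at 0)"
      unfolding has_derivative_at by simp
    moreover have "norm (g (x + t *\<^sub>R v) - g x - t *\<^sub>R L v) / norm t = norm ((g (x + t *\<^sub>R v) - g x) /\<^sub>R t - L v)"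
      if "t \<noteq> 0" for t
    proof -
      have "(g (x + t *\<^sub>R v) - g x) /\<^sub>R t - L v = (g (x + t *\<^sub>R v) - g x - t *\<^sub>R L v) /\<^sub>R t"
        using that by (simp add: scaleR_diff_right)
      then show ?thesis by (simp add: divide_inverse mult.commute)
    qed
    ultimately have "((\<lambda>t. norm ((g (x + t *\<^sub>R v) - g x) /\<^sub>R t - L v)) \<longlongrightarrow> 0) (at 0)"
      by (subst (asm) LIM_equal) auto
    then have "((\<lambda>t. (g (x + t *\<^sub>R v) - g x) /\<^sub>R t) \<longlongrightarrow> L v) (at 0)"
      by (rule LIM_zero_cancel[OF tendsto_norm_zero_cancel])
    then have lim1: "((\<lambda>t. (norm ((g (x + t *\<^sub>R v) - g x) /\<^sub>R t))\<^sup>2) \<longlongrightarrow> (norm (L v))\<^sup>2) (at 0)"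
      by (intro tendsto_intros)
    have lim2: "((\<lambda>t. (norm v)\<^sup>2 * ((1 - (norm (g x))\<^sup>2) * (1 - (norm (g (x + t *\<^sub>R v)))\<^sup>2)) /
        ((1 - (norm x)\<^sup>2) * (1 - (norm (x + t *\<^sub>R v))\<^sup>2))) \<longlongrightarrow>
        (norm v)\<^sup>2 * ((1 - (norm (g x))\<^sup>2) * (1 - (norm (g x))\<^sup>2)) / ((1 - (norm x)\<^sup>2) * (1 - (norm x)\<^sup>2))) (at 0)"
      using nx by (intro tendsto_intros lim0 limg) auto
    have ev: "\<forall>\<^sub>F t in at 0. (norm ((g (x + t *\<^sub>R v) - g x) /\<^sub>R t))\<^sup>2 =
        (norm v)\<^sup>2 * ((1 - (norm (g x))\<^sup>2) * (1 - (norm (g (x + t *\<^sub>R v)))\<^sup>2)) /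
        ((1 - (norm x)\<^sup>2) * (1 - (norm (x + t *\<^sub>R v))\<^sup>2))"
    proof -
      have "\<forall>\<^sub>F t in at 0. x + t *\<^sub>R v \<in> unit_ball"
        by (rule topological_tendstoD[OF lim0]) (use x in auto)
      moreover have "\<forall>\<^sub>F t in at (0::real). t \<noteq> 0" by (simp add: eventually_at_filter)
      ultimately show ?thesis
      proof eventually_elim
        case (elim t)
        let ?y = "x + t *\<^sub>R v"
        have ny: "0 < 1 - (norm ?y)\<^sup>2" using unit_ball_pos[OF elim(1)] .
        have "(norm (g ?y - g x))\<^sup>2 * ((1 - (norm x)\<^sup>2) * (1 - (norm ?y)\<^sup>2)) =
            (norm (t *\<^sub>R v))\<^sup>2 * ((1 - (norm (g x))\<^sup>2) * (1 - (norm (g ?y))\<^sup>2))"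
          using G_identity[OF g elim(1) x] by (simp add: mult.commute)
        then have "(norm (g ?y - g x))\<^sup>2 = t\<^sup>2 * ((norm v)\<^sup>2 * ((1 - (norm (g x))\<^sup>2) * (1 - (norm (g ?y))\<^sup>2)) /
            ((1 - (norm x)\<^sup>2) * (1 - (norm ?y)\<^sup>2)))"
          using nx ny by (simp add: power_mult_distrib nonzero_eq_divide_eq mult.assoc)
        then show ?case using elim(2)
          by (simp add: power_mult_distrib power_inverse)
      qed
    qed
    have "(norm (L v))\<^sup>2 =
        (norm v)\<^sup>2 * ((1 - (norm (g x))\<^sup>2) * (1 - (norm (g x))\<^sup>2)) / ((1 - (norm x)\<^sup>2) * (1 - (norm x)\<^sup>2))"
      by (rule tendsto_unique[OF _ lim1]) (use lim2 tendsto_cong[OF ev] in auto)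
    also have "\<dots> = (\<tau> * norm v)\<^sup>2"
      by (simp add: \<tau>_def power2_eq_square)
    finally show ?thesis using \<tau> by (simp add: power2_eq_iff_nonneg)
  qed
  define K where "K = (\<lambda>v. (1 / \<tau>) *\<^sub>R L v)"
  have linK: "linear K" unfolding K_def by (intro linear_compose_scale_right linL)
  have "orthogonal_transformation K"
    unfolding orthogonal_transformation using linK normL \<tau> by (simp add: K_def)
  then have dK: "\<bar>det (matrix K)\<bar> = 1"
    using orthogonal_transformation_matrix det_orthogonal_matrix by fastforce
  have "L = (*\<^sub>R) \<tau> \<circ> K" using \<tau> by (auto simp: K_def)
  then have "matrix L = matrix ((*\<^sub>R) \<tau>) ** matrix K"
    using matrix_compose[OF linK, of "(*\<^sub>R) \<tau>"] by (simp add: linear_scaleR)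
  then show ?thesis using dK \<tau> by (simp add: det_mul abs_mult \<tau>_def)
qed

subsection \<open>The orbit metric\<close>

abbreviation proj :: "real^'n \<Rightarrow> (real^'n) set" where
  "proj \<equiv> orbit_proj G"

lemma proj_in [simp, intro]: "x \<in> unit_ball \<Longrightarrow> proj x \<in> orbit_space G"
  by (simp add: orbit_space_def)

lemma orbit_space_cases:
  assumes "p \<in> orbit_space G" obtains x where "x \<in> unit_ball" "p = proj x"
  using assms by (auto simp: orbit_space_def)

lemma mem_proj: "y \<in> proj x \<longleftrightarrow> (\<exists>g\<in>G. y = g x)"
  by (auto simp: orbit_proj_def)

lemma self_mem_proj: "x \<in> unit_ball \<Longrightarrow> x \<in> proj x"
  unfolding mem_proj by (rule bexI[of _ gone]) auto

lemma proj_G [simp]: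
  assumes g: "g \<in> G" and x: "x \<in> unit_ball"
  shows "proj (g x) = proj x"
proof
  show "proj (g x) \<subseteq> proj x"
    using x g gmult_apply[OF x] by (metis gmult_closed mem_proj subsetI)
  show "proj x \<subseteq> proj (g x)"
  proof
    fix y assume "y \<in> proj x"
    then obtain h where h: "h \<in> G" "y = h x" by (auto simp: mem_proj)
    then have "y = gmult h (ginv g) (g x)" using g x by simp
    then show "y \<in> proj (g x)" using h g mem_proj by blast
  qed
qed

lemma proj_eqD:
  assumes "proj x = proj y" "x \<in> unit_ball" obtains g where "g \<in> G" "x = g y"
  using self_mem_proj[OF assms(2)] assms(1) by (auto simp: mem_proj)

lemma orbit_dist_set_nonneg:
  assumes "x \<in> unit_ball" "y \<in> unit_ball" "r \<in> {hyp_dist a b |a b. a \<in> proj x \<and> b \<in> proj y}"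
  shows "0 \<le> r"
  using assms by (auto simp: mem_proj intro!: hyp_dist_nonneg)

lemma orbit_dist_le:
  assumes x: "x \<in> unit_ball" and y: "y \<in> unit_ball"
  shows "orbit_dist (proj x) (proj y) \<le> hyp_dist x y"
  unfolding orbit_dist_def
proof (rule cInf_lower)
  show "hyp_dist x y \<in> {hyp_dist a b |a b. a \<in> proj x \<and> b \<in> proj y}"
    using self_mem_proj[OF x] self_mem_proj[OF y] by blast
  show "bdd_below {hyp_dist a b |a b. a \<in> proj x \<and> b \<in> proj y}"
    using orbit_dist_set_nonneg[OF x y] by (intro bdd_belowI) blast
qed

lemma orbit_dist_nonneg:
  assumes "p \<in> orbit_space G" "q \<in> orbit_space G"
  shows "0 \<le> orbit_dist p q"
proof -
  obtain x where x: "x \<in> unit_ball" "p = proj x" by (rule orbit_space_cases[OF assms(1)])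
  obtain y where y: "y \<in> unit_ball" "q = proj y" by (rule orbit_space_cases[OF assms(2)])
  note xy = x y
  show ?thesis
    unfolding orbit_dist_def xy(2,4)
  proof (rule cInf_greatest)
    show "{hyp_dist a b |a b. a \<in> proj x \<and> b \<in> proj y} \<noteq> {}"
      using self_mem_proj[OF xy(1)] self_mem_proj[OF xy(3)] by blast
  qed (use orbit_dist_set_nonneg[OF xy(1,3)] in blast)
qed

text \<open>Of two nearly optimal representatives the first can be moved to \<open>x\<close> by a
  group element, which carries the second along without changing the distance.\<close>

lemma orbit_dist_lessD:
  assumes x: "x \<in> unit_ball" and q: "q \<in> orbit_space G" and less: "orbit_dist (proj x) q < e"
  obtains y where "y \<in> unit_ball" "q = proj y" "hyp_dist x y < e"
proof -
  obtain y where y: "y \<in> unit_ball" "q = proj y" by (rule orbit_space_cases[OF q])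
  have "{hyp_dist a b |a b. a \<in> proj x \<and> b \<in> proj y} \<noteq> {}"
    using self_mem_proj[OF x] self_mem_proj[OF y(1)] by blast
  from cInf_lessD[OF this less[unfolded orbit_dist_def y(2)]]
  obtain g h where gh: "g \<in> G" "h \<in> G" "hyp_dist (g x) (h y) < e" by (auto simp: mem_proj)
  then have "hyp_dist x (ginv g (h y)) < e"
    using hyp_dist_ginv[of g "h y" x] x y by (simp add: hyp_dist_commute)
  then show ?thesis using gh x y by (intro that[of "ginv g (h y)"]) auto
qed

lemma orbit_dist_commute: "orbit_dist p q = orbit_dist q p"
  unfolding orbit_dist_def by (rule arg_cong[where f = Inf]) (use hyp_dist_commute in blast)

lemma orbit_dist_self:
  assumes "p \<in> orbit_space G"
  shows "orbit_dist p p = 0"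
proof -
  obtain x where x: "x \<in> unit_ball" "p = proj x" by (rule orbit_space_cases[OF assms])
  show ?thesis
    using orbit_dist_nonneg[OF assms assms] orbit_dist_le[OF x(1) x(1)] by (simp add: x(2))
qed

text \<open>Representatives are chosen in succession, \<open>y\<close> close to \<open>x\<close> and
  then \<open>z\<close> close to this same \<open>y\<close>, so that the triangle inequality of the
  ball applies.\<close>

lemma orbit_dist_triangle:
  assumes "p \<in> orbit_space G" "q \<in> orbit_space G" "r \<in> orbit_space G"
  shows "orbit_dist p r \<le> orbit_dist p q + orbit_dist q r"
proof (rule field_le_epsilon)
  fix e :: real assume e: "0 < e"
  obtain x where x: "x \<in> unit_ball" "p = proj x" by (rule orbit_space_cases[OF assms(1)])
  obtain y where y: "y \<in> unit_ball" "q = proj y" "hyp_dist x y < orbit_dist p q + e / 2"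
    using orbit_dist_lessD[OF x(1) assms(2), of "orbit_dist p q + e / 2"] x(2) e by auto
  obtain z where z: "z \<in> unit_ball" "r = proj z" "hyp_dist y z < orbit_dist q r + e / 2"
    using orbit_dist_lessD[OF y(1) assms(3), of "orbit_dist q r + e / 2"] y(2) e by auto
  have "orbit_dist p r \<le> hyp_dist x z" using orbit_dist_le x z by auto
  also have "\<dots> \<le> hyp_dist x y + hyp_dist y z" using hyp_dist_triangle x y z by blast
  finally show "orbit_dist p r \<le> orbit_dist p q + orbit_dist q r + e" using y z by simp
qed

text \<open>All but finitely many elements move \<open>x\<close> out of \<open>U\<close>; the
  remaining ones other than the identity move it by a positive distance because the action is
  free.\<close>

lemma injectivity_radius:
  assumes x: "x \<in> unit_ball"
  obtains r where "r > 0" "\<And>g. g \<in> G \<Longrightarrow> g \<noteq> gone \<Longrightarrow> r \<le> hyp_dist x (g x)"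
proof -
  obtain U where U: "open U" "x \<in> U" "U \<subseteq> unit_ball" "finite {g\<in>G. g ` U \<inter> U \<noteq> {}}"
    using discontinuous x unfolding acts_discontinuously_def by blast
  obtain e where e: "e > 0" "ball x e \<subseteq> U" using U openE by blast
  define S where "S = {g\<in>G. g ` U \<inter> U \<noteq> {}} - {gone}"
  \<comment> \<open>The term \<open>e / 2\<close> serves the elements that move \<open>x\<close> out
    of \<open>ball x e\<close>, by \<open>norm_le_hyp_dist\<close>; it also keeps the minimum
    meaningful when \<open>S\<close> is empty.\<close>
  define r where "r = Min (insert (e / 2) ((\<lambda>g. hyp_dist x (g x)) ` S))"
  have fin: "finite S" using U(4) by (simp add: S_def)
  have pos: "0 < hyp_dist x (g x)" if "g \<in> G" "g \<noteq> gone" for g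
  proof -
    have "g x \<noteq> x" using G_free that x by blast
    then have "0 < norm (x - g x)" by simp
    then show ?thesis using norm_le_hyp_dist[OF x G_in_ball[OF that(1) x]] by linarith
  qed
  show ?thesis
  proof (rule that[of r])
    show "0 < r" unfolding r_def using fin e pos by (auto simp: S_def)
    fix g assume g: "g \<in> G" "g \<noteq> gone"
    show "r \<le> hyp_dist x (g x)"
    proof (cases "g \<in> S")
      case True
      then show ?thesis unfolding r_def using fin by (intro Min_le) auto
    next
      case False
      then have "g x \<notin> U" using g U(2) by (auto simp: S_def)
      then have "e \<le> norm (x - g x)" using e by (force simp: dist_norm subset_iff)
      then have "e / 2 \<le> hyp_dist x (g x)"
        using norm_le_hyp_dist[OF x G_in_ball[OF g(1) x]] by linarith
      moreover have "r \<le> e / 2" unfolding r_def using fin by (intro Min_le) auto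
      ultimately show ?thesis by simp
    qed
  qed
qed

text \<open>Within a quarter of the displacement bound \<open>r\<close> from \<open>x\<close>, two
  points are less than \<open>r / 2\<close> apart, whereas every other representative of the second
  is more than \<open>r / 2\<close> away from the first. Hence the infimum is attained at the given
  pair.\<close>

lemma local_isometry:
  assumes x: "x \<in> unit_ball"
  obtains r where "r > 0"
    "\<And>y z. y \<in> unit_ball \<Longrightarrow> z \<in> unit_ball \<Longrightarrow> hyp_dist x y < r \<Longrightarrow> hyp_dist x z < r \<Longrightarrow>
      orbit_dist (proj y) (proj z) = hyp_dist y z"
    "inj_on proj {y \<in> unit_ball. hyp_dist x y < r}"
proof -
  obtain r where r: "r > 0" "\<And>g. g \<in> G \<Longrightarrow> g \<noteq> gone \<Longrightarrow> r \<le> hyp_dist x (g x)"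
    by (rule injectivity_radius[OF x]) (rule that, assumption+)
  have far: "hyp_dist y z < hyp_dist y (g z)"
    if yz: "y \<in> unit_ball" "z \<in> unit_ball" "hyp_dist x y < r / 4" "hyp_dist x z < r / 4"
      and g: "g \<in> G" "g \<noteq> gone" for y z g
  proof -
    have gz: "g z \<in> unit_ball" and gx: "g x \<in> unit_ball" using g x yz by auto
    have "r \<le> hyp_dist x (g x)" by (rule r(2)[OF g])
    also have "\<dots> \<le> hyp_dist x y + hyp_dist y (g x)" by (rule hyp_dist_triangle[OF x yz(1) gx])
    also have "hyp_dist y (g x) \<le> hyp_dist y (g z) + hyp_dist (g z) (g x)"
      by (rule hyp_dist_triangle[OF yz(1) gz gx])
    finally have "r / 2 < hyp_dist y (g z)"
      using yz g x by (simp add: hyp_dist_commute)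
    moreover have "hyp_dist y z \<le> hyp_dist y x + hyp_dist x z"
      by (rule hyp_dist_triangle[OF yz(1) x yz(2)])
    ultimately show ?thesis using yz by (simp add: hyp_dist_commute[of y x])
  qed
  show ?thesis
  proof (rule that[of "r / 4"])
    show "0 < r / 4" using r by simp
    fix y z assume yz: "y \<in> unit_ball" "z \<in> unit_ball" "hyp_dist x y < r / 4" "hyp_dist x z < r / 4"
    have "hyp_dist y z \<le> orbit_dist (proj y) (proj z)"
    proof (rule ccontr)
      assume "\<not> ?thesis"
      then obtain z' where z': "z' \<in> unit_ball" "proj z = proj z'" "hyp_dist y z' < hyp_dist y z"
        using orbit_dist_lessD[OF yz(1) proj_in[OF yz(2)], of "hyp_dist y z"] by (metis not_le)
      obtain g where g: "g \<in> G" "z' = g z" by (rule proj_eqD[OF z'(2)[symmetric] z'(1)])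
      show False
      proof (cases "g = gone")
        case True then show ?thesis using g z' yz by simp
      next
        case False then show ?thesis using far[OF yz g(1)] z' g by simp
      qed
    qed
    then show "orbit_dist (proj y) (proj z) = hyp_dist y z" using orbit_dist_le yz by (simp add: order_antisym)
  next
    show "inj_on proj {y \<in> unit_ball. hyp_dist x y < r / 4}"
    proof (rule inj_onI)
      fix y z assume y: "y \<in> {y \<in> unit_ball. hyp_dist x y < r / 4}" and z: "z \<in> {y \<in> unit_ball. hyp_dist x y < r / 4}"
        and eq: "proj y = proj z"
      then have yz: "norm y < 1" "norm z < 1" "hyp_dist x y < r / 4" "hyp_dist x z < r / 4" by auto
      obtain g where g: "g \<in> G" "y = g z" using proj_eqD[OF eq] yz by auto
      show "y = z"
      proof (cases "g = gone")
        case True then show ?thesis using g yz by simp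
      next
        case False
        have "hyp_dist y z < hyp_dist y (g z)" using far[of y z g] yz g False by simp
        then show ?thesis using g hyp_dist_nonneg[of y z] yz by simp
      qed
    qed
  qed
qed

section \<open>Topology of the orbit space, countability of the group, charts\<close>

lemma open_hyp_ball:
  fixes x :: "real^'n"
  assumes x: "x \<in> unit_ball"
  shows "open {y \<in> unit_ball. hyp_dist x y < r}"
proof -
  have "open ((\<lambda>y. hyp_dist y x) -` {..<r} \<inter> unit_ball)"
    using continuous_on_hyp_dist[OF x] open_lessThan unfolding continuous_on_open_vimage[OF open_ball]
    by blast
  moreover have "(\<lambda>y. hyp_dist y x) -` {..<r} \<inter> unit_ball = {y \<in> unit_ball. hyp_dist x y < r}"
    unfolding hyp_dist_commute[of x] by blast
  ultimately show ?thesis by simp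
qed

lemma injective_neighbourhood:
  assumes x: "x \<in> unit_ball"
  obtains B where "open B" "x \<in> B" "B \<subseteq> unit_ball" "inj_on proj B"
proof -
  obtain r where "r > 0" "inj_on proj {y \<in> unit_ball. hyp_dist x y < r}"
    by (rule local_isometry[OF x]) (rule that, assumption+)
  then show ?thesis
    using open_hyp_ball[OF x, of r] x by (intro that[of "{y \<in> unit_ball. hyp_dist x y < r}"]) auto
qed

lemma G_image_eq:
  assumes g: "g \<in> G" and W: "W \<subseteq> unit_ball"
  shows "g ` W = {x \<in> unit_ball. ginv g x \<in> W}"
proof (rule equalityI; rule subsetI)
  fix x assume "x \<in> g ` W"
  then obtain w where w: "w \<in> W" "x = g w" by blast
  then have "w \<in> unit_ball" using W by blast
  then show "x \<in> {x \<in> unit_ball. ginv g x \<in> W}" using w g by simp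
next
  fix x assume x: "x \<in> {x \<in> unit_ball. ginv g x \<in> W}"
  then have "x = g (ginv g x)" using g by simp
  then show "x \<in> g ` W" using x by (metis (lifting) image_eqI mem_Collect_eq)
qed

lemma open_G_image:
  assumes g: "g \<in> G" and W: "open W" "W \<subseteq> unit_ball"
  shows "open (g ` W)"
proof -
  have "open (ginv g -` W \<inter> unit_ball)"
    using G_continuous_on[OF ginv_closed[OF g]] W(1) unfolding continuous_on_open_vimage[OF open_ball]
    by blast
  moreover have "ginv g -` W \<inter> unit_ball = g ` W"
    unfolding G_image_eq[OF g W(2)] by blast
  ultimately show ?thesis by simp
qed

lemma orbit_vimage_image:
  assumes "W \<subseteq> unit_ball"
  shows "orbit_vimage G (proj ` W) = (\<Union>g\<in>G. g ` W)"
proof (rule equalityI; rule subsetI)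
  fix z assume "z \<in> orbit_vimage G (proj ` W)"
  then obtain w where w: "z \<in> unit_ball" "w \<in> W" "proj z = proj w" by (auto simp: orbit_vimage_def)
  obtain g where "g \<in> G" "z = g w" by (rule proj_eqD[OF w(3,1)])
  then show "z \<in> (\<Union>g\<in>G. g ` W)" using w(2) by blast
next
  fix z assume "z \<in> (\<Union>g\<in>G. g ` W)"
  then obtain g w where z: "g \<in> G" "w \<in> W" "z = g w" by blast
  then have w: "w \<in> unit_ball" using assms by blast
  have "proj z = proj w" unfolding z(3) by (rule proj_G[OF z(1) w])
  moreover have "z \<in> unit_ball" unfolding z(3) by (rule G_in_ball[OF z(1) w])
  ultimately show "z \<in> orbit_vimage G (proj ` W)" using z(2) by (simp add: orbit_vimage_def)
qed

text \<open>The full preimage of the image is the union of the translates of \<open>W\<close>, which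
  are open because inverses are continuous.\<close>

lemma openin_proj_image:
  assumes "open W" "W \<subseteq> unit_ball"
  shows "openin (orbit_topology G) (proj ` W)"
  unfolding openin_orbit_topology orbit_vimage_image[OF assms(2)]
  using open_G_image assms by (auto simp: orbit_space_def)

text \<open>By \<open>orbit_dist_lessD\<close> the ball is the projection of a hyperbolic ball about
  a representative of \<open>p\<close>. This ties the metric to the quotient topology.\<close>

lemma openin_orbit_ball:
  assumes "p \<in> orbit_space G"
  shows "openin (orbit_topology G) {q \<in> orbit_space G. orbit_dist p q < e}"
proof -
  obtain x where x: "x \<in> unit_ball" "p = proj x" by (rule orbit_space_cases[OF assms])
  have "{q \<in> orbit_space G. orbit_dist p q < e} = proj ` {y \<in> unit_ball. hyp_dist x y < e}"
  proof (rule equalityI; rule subsetI)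
    fix q assume "q \<in> {q \<in> orbit_space G. orbit_dist p q < e}"
    then obtain y where "y \<in> unit_ball" "q = proj y" "hyp_dist x y < e"
      using orbit_dist_lessD[OF x(1), of q e] x(2) by auto
    then show "q \<in> proj ` {y \<in> unit_ball. hyp_dist x y < e}" by blast
  next
    fix q assume "q \<in> proj ` {y \<in> unit_ball. hyp_dist x y < e}"
    then show "q \<in> {q \<in> orbit_space G. orbit_dist p q < e}"
      using orbit_dist_le[OF x(1)] x by (force intro: le_less_trans)
  qed
  moreover have "{y \<in> unit_ball. hyp_dist x y < e} \<subseteq> unit_ball" by blast
  ultimately show ?thesis by (simp only: openin_proj_image[OF open_hyp_ball[OF x(1)]])
qed

text \<open>The translates of an injectivity neighbourhood are nonempty, open and pairwise disjoint,
  and a disjoint family of open sets is countable.\<close>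

lemma countable_G: "countable G"
proof -
  obtain B where B: "open B" "0 \<in> B" "B \<subseteq> unit_ball" "inj_on proj B"
    using injective_neighbourhood[of 0] by auto
  have disj: "g = h" if gh: "g \<in> G" "h \<in> G" "g ` B \<inter> h ` B \<noteq> {}" for g h
  proof -
    obtain b c where bc: "b \<in> B" "c \<in> B" "g b = h c" using gh by blast
    then have bc': "b \<in> unit_ball" "c \<in> unit_ball" using B(3) by blast+
    have "proj b = proj (g b)" by (rule proj_G[OF gh(1) bc'(1), symmetric])
    also have "\<dots> = proj c" unfolding bc(3) by (rule proj_G[OF gh(2) bc'(2)])
    finally have "proj b = proj c" .
    then have "b = c" using B(4) bc by (auto dest: inj_onD)
    then show ?thesis using G_eq_at[OF gh(1,2) bc'(1)] bc(3) by simp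
  qed
  have "countable ((\<lambda>g. g ` B) ` G)"
  proof (rule countable_disjoint_open_subsets)
    show "pairwise disjnt ((\<lambda>g. g ` B) ` G)"
    proof (rule pairwiseI)
      fix X Y assume "X \<in> (\<lambda>g. g ` B) ` G" "Y \<in> (\<lambda>g. g ` B) ` G" and ne: "X \<noteq> Y"
      then obtain g h where "g \<in> G" "h \<in> G" "X = g ` B" "Y = h ` B" by blast
      then show "disjnt X Y" using disj[of g h] ne unfolding disjnt_def by metis
    qed
    show "\<And>S. S \<in> (\<lambda>g. g ` B) ` G \<Longrightarrow> open S"
      using open_G_image[OF _ B(1,3)] by blast
  qed
  moreover have "inj_on (\<lambda>g. g ` B) G"
  proof (rule inj_onI)
    fix g h assume "g \<in> G" "h \<in> G" "g ` B = h ` B"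
    then show "g = h" using disj[of g h] B(2) by auto
  qed
  ultimately show ?thesis by (rule countable_image_inj_on)
qed

text \<open>The chart is the inverse of the projection on an injectivity neighbourhood: continuous
  because the projection is open, open because the projection is continuous.\<close>

lemma local_coordinate_exists:
  assumes "p \<in> orbit_space G"
  shows "\<exists>U \<phi>. local_coordinate G U \<phi> \<and> p \<in> U"
proof -
  obtain x where x: "x \<in> unit_ball" "p = proj x" by (rule orbit_space_cases[OF assms])
  obtain B where B: "open B" "x \<in> B" "B \<subseteq> unit_ball" "inj_on proj B"
    by (rule injective_neighbourhood[OF x(1)])
  define \<phi> where "\<phi> = inv_into B proj"
  have im: "\<phi> ` proj ` B = B" unfolding \<phi>_def using B(4) by simp
  have \<phi>: "\<phi> (proj y) = y" if "y \<in> B" for y unfolding \<phi>_def using B(4) that by simp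
  have \<phi>': "proj (\<phi> q) = q" if "q \<in> proj ` B" for q using that \<phi> by auto
  have U: "openin (orbit_topology G) (proj ` B)" by (rule openin_proj_image[OF B(1,3)])
  have top: "topspace (subtopology (orbit_topology G) (proj ` B)) = proj ` B"
    using openin_subset[OF U] by auto
  have "homeomorphic_map (subtopology (orbit_topology G) (proj ` B)) (top_of_set B) \<phi>"
  proof (rule bijective_open_imp_homeomorphic_map)
    show "inj_on \<phi> (topspace (subtopology (orbit_topology G) (proj ` B)))"
      unfolding top using \<phi> by (auto simp: inj_on_def)
    show "\<phi> ` topspace (subtopology (orbit_topology G) (proj ` B)) = topspace (top_of_set B)"
      unfolding top im by simp
    show "continuous_map (subtopology (orbit_topology G) (proj ` B)) (top_of_set B) \<phi>"
      unfolding continuous_map_def top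
    proof (intro conjI allI impI)
      show "\<phi> \<in> proj ` B \<rightarrow> topspace (top_of_set B)" using \<phi> by auto
      fix W assume W: "openin (top_of_set B) W"
      then have oW: "open W" "W \<subseteq> B" unfolding openin_open_eq[OF B(1)] by auto
      have "{q \<in> proj ` B. \<phi> q \<in> W} = proj ` W \<inter> proj ` B"
      proof (rule equalityI; rule subsetI)
        fix q assume "q \<in> {q \<in> proj ` B. \<phi> q \<in> W}"
        then show "q \<in> proj ` W \<inter> proj ` B" using \<phi> by auto
      next
        fix q assume "q \<in> proj ` W \<inter> proj ` B"
        then obtain w where "w \<in> W" "q = proj w" by blast
        moreover from this have "w \<in> B" using oW(2) by blast
        ultimately show "q \<in> {q \<in> proj ` B. \<phi> q \<in> W}" using \<phi>[of w] by simp
      qed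
      moreover have "openin (orbit_topology G) (proj ` W)"
        by (rule openin_proj_image[OF oW(1) subset_trans[OF oW(2) B(3)]])
      ultimately show "openin (subtopology (orbit_topology G) (proj ` B)) {q \<in> proj ` B. \<phi> q \<in> W}"
        unfolding openin_subtopology by blast
    qed
    show "open_map (subtopology (orbit_topology G) (proj ` B)) (top_of_set B) \<phi>"
      unfolding open_map_def
    proof (intro allI impI)
      fix W assume "openin (subtopology (orbit_topology G) (proj ` B)) W"
      then obtain T where T: "openin (orbit_topology G) T" "W = T \<inter> proj ` B"
        by (auto simp: openin_subtopology)
      have "\<phi> ` W = orbit_vimage G T \<inter> B"
      proof (rule equalityI; rule subsetI)
        fix y assume "y \<in> \<phi> ` W"
        then obtain b where "b \<in> B" "proj b \<in> T" "y = b" using T(2) \<phi> by auto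
        then show "y \<in> orbit_vimage G T \<inter> B" unfolding orbit_vimage_def using B(3) by blast
      next
        fix y assume "y \<in> orbit_vimage G T \<inter> B"
        then have y: "y \<in> B" "proj y \<in> W" unfolding orbit_vimage_def T(2) by auto
        then show "y \<in> \<phi> ` W" using \<phi>[OF y(1)] by (metis image_eqI)
      qed
      then show "openin (top_of_set B) (\<phi> ` W)"
        using T(1) B(1) unfolding openin_orbit_topology openin_open_eq[OF B(1)] by (simp add: open_Int)
    qed
  qed
  then have "local_coordinate G (proj ` B) \<phi>"
    unfolding local_coordinate_def im using U B(1,3) \<phi>' by blast
  then show ?thesis using B(2) x(2) by blast
qed

lemma coordinate_at:
  assumes "p \<in> orbit_space G" and "coordinate_at G p = (U, \<phi>)"
  shows "open (\<phi> ` U)" "\<phi> ` U \<subseteq> unit_ball" "\<And>q. q \<in> U \<Longrightarrow> proj (\<phi> q) = q" "p \<in> U"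
    "openin (orbit_topology G) U"
proof -
  have "case coordinate_at G p of (U, \<phi>) \<Rightarrow> local_coordinate G U \<phi> \<and> p \<in> U"
    unfolding coordinate_at_def
    by (rule someI_ex) (use local_coordinate_exists[OF assms(1)] in \<open>simp only: split_paired_Ex prod.case\<close>)
  then have *: "local_coordinate G U \<phi>" "p \<in> U" unfolding assms(2) by simp_all
  then show "p \<in> U" by simp
  show "open (\<phi> ` U)" "\<phi> ` U \<subseteq> unit_ball" "openin (orbit_topology G) U"
    using *(1) by (simp_all only: local_coordinate_def)
  show "proj (\<phi> q) = q" if "q \<in> U" for q
    using *(1) that unfolding local_coordinate_def by simp
qed

end

section \<open>Hyperbolic volume and the orbit measure\<close>

text \<open>The hypothesis on measures of images says that the inverse of \<open>T\<close> carries
  \<open>N\<close>, restricted to the image of \<open>A\<close>, to the measure with density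
  \<open>J\<close>; the integral formula is then the transfer rule for image measures. It serves
  both the passage from Lebesgue measure to hyperbolic volume and the mapping between the orbit
  spaces.\<close>

lemma
  fixes J \<Psi> :: "'a \<Rightarrow> ennreal"
  assumes A: "A \<in> sets M" and inj: "inj_on T A" and J: "J \<in> borel_measurable M"
    and im: "\<And>E. E \<in> sets M \<Longrightarrow> E \<subseteq> A \<Longrightarrow> T ` E \<in> sets N"
    and em: "\<And>E. E \<in> sets M \<Longrightarrow> E \<subseteq> A \<Longrightarrow> emeasure N (T ` E) = (\<integral>\<^sup>+x. J x * indicator E x \<partial>M)"
    and \<Psi>: "\<Psi> \<in> borel_measurable M"
  shows measurable_injective_image: "(\<lambda>q. \<Psi> (inv_into A T q) * indicator (T ` A) q) \<in> borel_measurable N"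
    and nn_integral_injective_image:
      "(\<integral>\<^sup>+q. \<Psi> (inv_into A T q) * indicator (T ` A) q \<partial>N) = (\<integral>\<^sup>+x. J x * \<Psi> x * indicator A x \<partial>M)"
proof -
  let ?MA = "restrict_space M A" and ?NA = "restrict_space N (T ` A)" and ?S = "inv_into A T"
  have TA: "T ` A \<in> sets N" using im[OF A] by simp
  have TA': "T ` A \<inter> space N \<in> sets N" using TA by auto
  have AM: "A \<inter> space M \<in> sets M" using A by auto
  have spN: "space ?NA = T ` A" using sets.sets_into_space[OF TA] by (auto simp: space_restrict_space)
  have spM: "space ?MA = A" using sets.sets_into_space[OF A] by (auto simp: space_restrict_space)
  have setsMA: "E \<in> sets ?MA \<longleftrightarrow> E \<in> sets M \<and> E \<subseteq> A" for E
    by (subst sets_restrict_space_iff[OF AM]) auto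
  have setsNA: "E \<in> sets ?NA \<longleftrightarrow> E \<in> sets N \<and> E \<subseteq> T ` A" for E
    by (subst sets_restrict_space_iff[OF TA']) auto
  have pre: "?S -` E \<inter> T ` A = T ` E" if "E \<subseteq> A" for E
    using that inj by (auto simp: inv_into_f_f subset_iff image_iff)
  have S: "?S \<in> ?NA \<rightarrow>\<^sub>M ?MA"
  proof (rule measurableI)
    show "?S q \<in> space ?MA" if "q \<in> space ?NA" for q
      using that unfolding spN spM by (rule inv_into_into)
    fix E assume "E \<in> sets ?MA"
    then have E: "E \<in> sets M" "E \<subseteq> A" by (simp_all add: setsMA)
    show "?S -` E \<inter> space ?NA \<in> sets ?NA"
      unfolding spN pre[OF E(2)] setsNA using im[OF E] E(2) by auto
  qed
  have JA: "J \<in> borel_measurable ?MA" and \<Psi>A: "\<Psi> \<in> borel_measurable ?MA"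
    using J \<Psi> by (auto intro: measurable_restrict_space1)
  have distr: "distr ?NA ?MA ?S = density ?MA J"
  proof (rule measure_eqI)
    fix E assume "E \<in> sets (distr ?NA ?MA ?S)"
    then have EA: "E \<in> sets ?MA" by simp
    then have E: "E \<in> sets M" "E \<subseteq> A" by (simp_all add: setsMA)
    have "emeasure (distr ?NA ?MA ?S) E = emeasure ?NA (T ` E)"
      using emeasure_distr[OF S EA] by (simp add: spN pre[OF E(2)])
    also have "\<dots> = emeasure N (T ` E)"
      using E(2) by (intro emeasure_restrict_space[OF TA']) auto
    also have "\<dots> = (\<integral>\<^sup>+x. J x * indicator E x \<partial>M)" by (rule em[OF E])
    also have "\<dots> = (\<integral>\<^sup>+x. J x * indicator E x * indicator A x \<partial>M)"
      using E(2) by (intro nn_integral_cong) (auto simp: indicator_def)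
    also have "\<dots> = (\<integral>\<^sup>+x. J x * indicator E x \<partial>?MA)"
      by (rule nn_integral_restrict_space[OF AM, symmetric])
    also have "\<dots> = emeasure (density ?MA J) E"
      by (rule emeasure_density[OF JA EA, symmetric])
    finally show "emeasure (distr ?NA ?MA ?S) E = emeasure (density ?MA J) E" .
  qed simp
  have SN: "(\<lambda>q. \<Psi> (?S q)) \<in> borel_measurable ?NA"
    by (rule measurable_compose[OF S \<Psi>A])
  then show "(\<lambda>q. \<Psi> (?S q) * indicator (T ` A) q) \<in> borel_measurable N"
    by (subst (asm) borel_measurable_restrict_space_iff_ennreal[OF TA'])
  have "(\<integral>\<^sup>+q. \<Psi> (?S q) * indicator (T ` A) q \<partial>N) = (\<integral>\<^sup>+q. \<Psi> (?S q) \<partial>?NA)"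
    by (rule nn_integral_restrict_space[OF TA', symmetric])
  also have "\<dots> = (\<integral>\<^sup>+x. \<Psi> x \<partial>distr ?NA ?MA ?S)"
    by (rule nn_integral_distr[OF S, symmetric]) (use \<Psi>A in simp)
  also have "\<dots> = (\<integral>\<^sup>+x. J x * \<Psi> x \<partial>?MA)"
    unfolding distr by (rule nn_integral_density[OF JA \<Psi>A])
  also have "\<dots> = (\<integral>\<^sup>+x. J x * \<Psi> x * indicator A x \<partial>M)"
    by (rule nn_integral_restrict_space[OF AM])
  finally show "(\<integral>\<^sup>+q. \<Psi> (?S q) * indicator (T ` A) q \<partial>N) = (\<integral>\<^sup>+x. J x * \<Psi> x * indicator A x \<partial>M)" .
qed

section \<open>Hyperbolic volume compared with Lebesgue measure\<close>

definition hyp_weight :: "real^'n \<Rightarrow> real" where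
  "hyp_weight x = 2 ^ CARD('n) / (1 - (norm x)\<^sup>2) ^ CARD('n)"

lemma hyp_weight_measurable [measurable]: "(hyp_weight :: real^'n \<Rightarrow> real) \<in> borel_measurable borel"
  unfolding hyp_weight_def by measurable

lemma hyp_weight_pos: "x \<in> unit_ball \<Longrightarrow> 0 < hyp_weight x"
  using unit_ball_pos[of x] by (simp add: hyp_weight_def)

lemma hyp_volume_eq: "hyp_volume = density (restrict_space lebesgue unit_ball) (\<lambda>x. ennreal (hyp_weight x))"
  by (simp add: hyp_volume_def hyp_weight_def)

lemma unit_ball_sets: "unit_ball \<inter> space lebesgue \<in> sets lebesgue"
  by simp

lemma sets_hyp_volume: "A \<in> sets hyp_volume \<longleftrightarrow> A \<in> sets lebesgue \<and> A \<subseteq> unit_ball"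
  unfolding hyp_volume_eq by (auto simp: sets_restrict_space_iff)

lemma space_hyp_volume: "space hyp_volume = unit_ball"
  unfolding hyp_volume_eq by (simp add: space_restrict_space)

lemma hyp_weight_restrict: "(\<lambda>x. ennreal (hyp_weight x)) \<in> borel_measurable (restrict_space lebesgue unit_ball)"
  by (intro measurable_restrict_space1 measurable_completion) simp

lemma borel_measurable_hyp_volume_iff:
  fixes u :: "real^'n \<Rightarrow> ennreal"
  shows "u \<in> borel_measurable hyp_volume \<longleftrightarrow> (\<lambda>x. u x * indicator unit_ball x) \<in> borel_measurable lebesgue"
proof -
  have "u \<in> borel_measurable hyp_volume \<longleftrightarrow> u \<in> borel_measurable (restrict_space lebesgue unit_ball)"
    by (simp add: hyp_volume_eq)
  then show ?thesis
    using borel_measurable_restrict_space_iff_ennreal[OF unit_ball_sets, of u] by simp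
qed

lemma nn_integral_hyp_volume:
  assumes "u \<in> borel_measurable hyp_volume"
  shows "(\<integral>\<^sup>+x. u x \<partial>hyp_volume) = (\<integral>\<^sup>+x. ennreal (hyp_weight x) * u x * indicator unit_ball x \<partial>lebesgue)"
proof -
  have u: "u \<in> borel_measurable (restrict_space lebesgue unit_ball)"
    using assms by (simp add: hyp_volume_eq)
  show ?thesis
    unfolding hyp_volume_eq nn_integral_density[OF hyp_weight_restrict u]
    by (rule nn_integral_restrict_space[OF unit_ball_sets])
qed

lemma emeasure_hyp_volume:
  assumes A: "A \<in> sets hyp_volume"
  shows "emeasure hyp_volume A = (\<integral>\<^sup>+x. ennreal (hyp_weight x) * indicator A x \<partial>lebesgue)"
proof -
  have "emeasure hyp_volume A = (\<integral>\<^sup>+x. indicator A x \<partial>hyp_volume)"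
    using A by simp
  also have "\<dots> = (\<integral>\<^sup>+x. ennreal (hyp_weight x) * indicator A x * indicator unit_ball x \<partial>lebesgue)"
    using A by (intro nn_integral_hyp_volume) simp
  also have "\<dots> = (\<integral>\<^sup>+x. ennreal (hyp_weight x) * indicator A x \<partial>lebesgue)"
    using A by (intro nn_integral_cong) (auto simp: indicator_def sets_hyp_volume)
  finally show ?thesis .
qed

text \<open>The density is finite and positive in the ball, so volume and Lebesgue measure have the
  same null sets there.\<close>

lemma null_sets_hyp_volume: "A \<in> null_sets hyp_volume \<longleftrightarrow> negligible A \<and> A \<subseteq> unit_ball"
proof
  assume A: "A \<in> null_sets hyp_volume"
  then have s: "A \<in> sets hyp_volume" by auto
  then have lA: "A \<in> sets lebesgue" and sub: "A \<subseteq> unit_ball" by (simp_all add: sets_hyp_volume)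
  have "(\<integral>\<^sup>+x. ennreal (hyp_weight x) * indicator A x \<partial>lebesgue) = 0"
    using A emeasure_hyp_volume[OF s] by auto
  moreover have "(\<lambda>x. ennreal (hyp_weight x) * indicator A x) \<in> borel_measurable lebesgue"
    using lA by (intro borel_measurable_times_ennreal measurable_completion borel_measurable_indicator) simp
  ultimately have "AE x in lebesgue. ennreal (hyp_weight x) * indicator A x = 0"
    by (simp add: nn_integral_0_iff_AE)
  then have "AE x in lebesgue. x \<notin> A"
  proof eventually_elim
    case (elim x)
    show ?case
    proof
      assume x: "x \<in> A"
      then have "0 < hyp_weight x" using hyp_weight_pos sub by blast
      then show False using elim x by (simp add: ennreal_eq_0_iff)
    qed
  qed
  then have "A \<in> null_sets lebesgue" using lA AE_iff_null_sets by blast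
  then show "negligible A \<and> A \<subseteq> unit_ball" using sub by (simp add: negligible_iff_null_sets)
next
  assume A: "negligible A \<and> A \<subseteq> unit_ball"
  then have n: "A \<in> null_sets lebesgue" by (simp add: negligible_iff_null_sets)
  then have s: "A \<in> sets hyp_volume" using A by (auto simp: sets_hyp_volume)
  have "AE x in lebesgue. x \<notin> A" using n by (rule AE_not_in)
  then have "(\<integral>\<^sup>+x. ennreal (hyp_weight x) * indicator A x \<partial>lebesgue) = (\<integral>\<^sup>+x. 0 \<partial>(lebesgue :: (real^'a) measure))"
    by (intro nn_integral_cong_AE) (auto elim!: eventually_mono)
  then show "A \<in> null_sets hyp_volume"
    using s emeasure_hyp_volume[OF s] by (auto intro!: null_setsI)
qed

text \<open>The factor by which \<open>F\<close> changes hyperbolic volume: the Euclidean Jacobian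
  times the quotient of the densities at \<open>F x\<close> and at \<open>x\<close>, in which the
  powers of 2 cancel.\<close>

definition hyp_jacobian :: "(real^'n \<Rightarrow> real^'n) \<Rightarrow> (real^'n \<Rightarrow> real^'n \<Rightarrow> real^'n) \<Rightarrow> real^'n \<Rightarrow> real" where
  "hyp_jacobian F F' x = \<bar>det (matrix (F' x))\<bar> * ((1 - (norm x)\<^sup>2) / (1 - (norm (F x))\<^sup>2)) ^ CARD('n)"

text \<open>The weight composed with \<open>F\<close> is integrated by the Lebesgue area formula;
  the weight at \<open>x\<close> times the hyperbolic Jacobian is the Euclidean Jacobian times the
  weight at \<open>F x\<close>.\<close>

lemma
  fixes F :: "real^'n \<Rightarrow> real^'n"
  assumes S: "S \<in> sets hyp_volume"
    and der: "\<And>x. x \<in> S \<Longrightarrow> (F has_derivative F' x) (at x within S)"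
    and inj: "inj_on F S" and im: "F ` S \<subseteq> unit_ball"
  shows hyp_volume_image_sets: "F ` S \<in> sets hyp_volume"
    and hyp_jacobian_measurable: "(\<lambda>x. ennreal (hyp_jacobian F F' x) * indicator S x) \<in> borel_measurable hyp_volume"
    and hyp_volume_image:
      "emeasure hyp_volume (F ` S) = (\<integral>\<^sup>+x. ennreal (hyp_jacobian F F' x) * indicator S x \<partial>hyp_volume)"
proof -
  have lS: "S \<in> sets lebesgue" and SB: "S \<subseteq> unit_ball" using S by (simp_all add: sets_hyp_volume)
  have derE: "(F has_derivative F' x) (at x within E)" if "E \<subseteq> S" "x \<in> E" for E x
    using der that has_derivative_subset by blast
  have imE: "F ` E \<in> sets lebesgue" if "E \<in> sets lebesgue" "E \<subseteq> S" for E
    by (rule differentiable_image_in_sets_lebesgue[OF that(1)])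
      (use derE[OF that(2)] in \<open>auto simp: differentiable_on_def differentiable_def\<close>)
  show FS: "F ` S \<in> sets hyp_volume"
    using imE[OF lS] im by (simp add: sets_hyp_volume)
  define d where "d = (\<lambda>x. \<bar>det (matrix (F' x)) * indicator S x\<bar>)"
  have d: "d \<in> borel_measurable lebesgue"
    unfolding d_def using det_Jacobian_measurable[OF lS der] by (rule borel_measurable_abs)
  \<comment> \<open>Nothing is known about \<open>F\<close> off \<open>S\<close>; setting it to 0
    there makes it measurable on the whole space and leaves integrals over \<open>S\<close>
    unchanged.\<close>
  have Fm: "(\<lambda>x. indicator S x *\<^sub>R F x) \<in> borel_measurable lebesgue"
  proof -
    have "F \<in> borel_measurable (lebesgue_on S)"
    proof (rule continuous_imp_measurable_on_sets_lebesgue[OF _ lS])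
      show "continuous_on S F"
        unfolding continuous_on_eq_continuous_within using der has_derivative_continuous by blast
    qed
    then show ?thesis using lS by (subst (asm) borel_measurable_restrict_space_iff) simp_all
  qed
  define \<Psi> where "\<Psi> = (\<lambda>x. ennreal (hyp_weight (indicator S x *\<^sub>R F x)))"
  have \<Psi>: "\<Psi> \<in> borel_measurable lebesgue"
    unfolding \<Psi>_def
    by (intro measurable_compose[OF _ measurable_ennreal] measurable_compose[OF Fm hyp_weight_measurable])
  have em: "emeasure lebesgue (F ` E) = (\<integral>\<^sup>+x. ennreal (d x) * indicator E x \<partial>lebesgue)"
    if E: "E \<in> sets lebesgue" "E \<subseteq> S" for E
  proof -
    have "emeasure lebesgue (F ` E) = (\<integral>\<^sup>+x. ennreal \<bar>det (matrix (F' x))\<bar> * indicator E x \<partial>lebesgue)"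
    proof (rule emeasure_differentiable_image[OF E(1) derE[OF E(2)]])
      show "inj_on F E" using inj E(2) inj_on_subset by blast
      have "F ` E \<subseteq> unit_ball" using im E(2) by blast
      then show "bounded (F ` E)" using bounded_ball bounded_subset by blast
    qed
    also have "\<dots> = (\<integral>\<^sup>+x. ennreal (d x) * indicator E x \<partial>lebesgue)"
      using E(2) by (intro nn_integral_cong) (auto simp: d_def indicator_def)
    finally show ?thesis .
  qed
  have weight: "ennreal (hyp_weight x) * (ennreal (hyp_jacobian F F' x) * indicator S x) * indicator unit_ball x =
      ennreal (d x) * \<Psi> x * indicator S x" for x
  proof (cases "x \<in> S")
    case True
    then have x: "x \<in> unit_ball" and Fx: "F x \<in> unit_ball" using SB im by auto
    have nx: "1 - (norm x)\<^sup>2 \<noteq> 0" using unit_ball_pos[OF x] by simp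
    have h0: "0 \<le> hyp_weight x" "0 \<le> hyp_weight (F x)"
      using hyp_weight_pos[OF x] hyp_weight_pos[OF Fx] by simp_all
    have j0: "0 \<le> hyp_jacobian F F' x"
      using unit_ball_pos[OF x] unit_ball_pos[OF Fx] by (simp add: hyp_jacobian_def)
    have "hyp_weight x * hyp_jacobian F F' x = \<bar>det (matrix (F' x))\<bar> * hyp_weight (F x)"
      using nx by (simp add: hyp_weight_def hyp_jacobian_def power_divide)
    then have "ennreal (hyp_weight x) * ennreal (hyp_jacobian F F' x) =
        ennreal \<bar>det (matrix (F' x))\<bar> * ennreal (hyp_weight (F x))"
      using h0 j0 by (simp add: ennreal_mult[symmetric])
    then show ?thesis using True x by (simp add: d_def \<Psi>_def)
  qed simp
  show jm: "(\<lambda>x. ennreal (hyp_jacobian F F' x) * indicator S x) \<in> borel_measurable hyp_volume"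
  proof -
    define r where "r = (\<lambda>x. d x * ((1 - (norm x)\<^sup>2) / (1 - (norm (indicator S x *\<^sub>R F x))\<^sup>2)) ^ CARD('n))"
    have nm: "(\<lambda>x::real^'n. norm x) \<in> borel_measurable lebesgue"
      by (intro measurable_completion) simp
    have "r \<in> borel_measurable lebesgue"
      unfolding r_def
      by (intro borel_measurable_times borel_measurable_power borel_measurable_divide borel_measurable_diff
          borel_measurable_const d nm measurable_compose[OF Fm borel_measurable_norm])
    then have "(\<lambda>x. ennreal (r x)) \<in> borel_measurable lebesgue"
      by (rule measurable_compose[OF _ measurable_ennreal])
    moreover have "ennreal (r x) = ennreal (hyp_jacobian F F' x) * indicator S x * indicator unit_ball x" for x
    proof (cases "x \<in> S")
      case True
      then have "x \<in> unit_ball" using SB by blast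
      then show ?thesis using True by (simp add: r_def hyp_jacobian_def d_def)
    qed (simp add: r_def d_def)
    ultimately show ?thesis by (simp add: borel_measurable_hyp_volume_iff)
  qed
  have "emeasure hyp_volume (F ` S) = (\<integral>\<^sup>+y. ennreal (hyp_weight y) * indicator (F ` S) y \<partial>lebesgue)"
    by (rule emeasure_hyp_volume[OF FS])
  also have "\<dots> = (\<integral>\<^sup>+y. \<Psi> (inv_into S F y) * indicator (F ` S) y \<partial>lebesgue)"
    using inj by (intro nn_integral_cong) (auto simp: \<Psi>_def indicator_def)
  also have "\<dots> = (\<integral>\<^sup>+x. ennreal (d x) * \<Psi> x * indicator S x \<partial>lebesgue)"
    using d by (intro nn_integral_injective_image[OF lS inj _ imE em \<Psi>]) auto
  also have "\<dots> = (\<integral>\<^sup>+x. ennreal (hyp_jacobian F F' x) * indicator S x \<partial>hyp_volume)"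
    unfolding nn_integral_hyp_volume[OF jm] weight ..
  finally show "emeasure hyp_volume (F ` S) = (\<integral>\<^sup>+x. ennreal (hyp_jacobian F F' x) * indicator S x \<partial>hyp_volume)" .
qed

text \<open>Cleared of denominators, equality of the distances is an equation whose quadratic part
  is a multiple of \<open>x \<bullet> x\<close>: its solutions lie on a hyperplane or on a
  sphere.\<close>

lemma hyp_bisector_negligible:
  fixes a b :: "real^'n"
  assumes a: "a \<in> unit_ball" and b: "b \<in> unit_ball" and ne: "a \<noteq> b"
  shows "negligible {x \<in> unit_ball. hyp_dist x a = hyp_dist x b}"
proof -
  define A where "A = (norm a)\<^sup>2 - (norm b)\<^sup>2"
  define v where "v = (1 - (norm b)\<^sup>2) *\<^sub>R a - (1 - (norm a)\<^sup>2) *\<^sub>R b"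
  define C where "C = (norm a)\<^sup>2 * (1 - (norm b)\<^sup>2) - (norm b)\<^sup>2 * (1 - (norm a)\<^sup>2)"
  have sq: "(norm (x - c))\<^sup>2 = x \<bullet> x - 2 * (x \<bullet> c) + (norm c)\<^sup>2" for x c :: "real^'n"
    by (simp add: power2_norm_eq_inner inner_diff_left inner_diff_right inner_commute)
  have sub: "{x \<in> unit_ball. hyp_dist x a = hyp_dist x b} \<subseteq> {x. A * (x \<bullet> x) - 2 * (x \<bullet> v) + C = 0}"
  proof clarsimp
    fix x :: "real^'n" assume "norm x < 1" and eq: "hyp_dist x a = hyp_dist x b"
    then have x: "x \<in> unit_ball" by simp
    have pos: "0 < 1 - (norm x)\<^sup>2" "0 < 1 - (norm a)\<^sup>2" "0 < 1 - (norm b)\<^sup>2"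
      using unit_ball_pos[OF x] unit_ball_pos[OF a] unit_ball_pos[OF b] by simp_all
    have "(norm (x - a))\<^sup>2 / ((1 - (norm x)\<^sup>2) * (1 - (norm a)\<^sup>2)) = (norm (x - b))\<^sup>2 / ((1 - (norm x)\<^sup>2) * (1 - (norm b)\<^sup>2))"
      using cosh_hyp_dist[OF x a] cosh_hyp_dist[OF x b] eq by simp
    then have "(norm (x - a))\<^sup>2 * ((1 - (norm x)\<^sup>2) * (1 - (norm b)\<^sup>2)) = (norm (x - b))\<^sup>2 * ((1 - (norm x)\<^sup>2) * (1 - (norm a)\<^sup>2))"
      using pos by (subst (asm) frac_eq_eq) simp_all
    then have "(norm (x - a))\<^sup>2 * (1 - (norm b)\<^sup>2) = (norm (x - b))\<^sup>2 * (1 - (norm a)\<^sup>2)"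
      using pos(1) by (simp add: mult.left_commute)
    then show "A * (x \<bullet> x) - 2 * (x \<bullet> v) + C = 0"
      unfolding sq A_def v_def C_def by (simp add: inner_diff_right algebra_simps)
  qed
  have "negligible {x. A * (x \<bullet> x) - 2 * (x \<bullet> v) + C = 0}"
  proof (cases "A = 0")
    case True
    have "v = (1 - (norm a)\<^sup>2) *\<^sub>R (a - b)"
      using True by (simp add: A_def v_def scaleR_diff_right)
    then have "v \<noteq> 0" using ne unit_ball_pos[OF a] by simp
    then have "negligible {x. v \<bullet> x = C / 2}" by (intro negligible_hyperplane) simp
    moreover have "{x. A * (x \<bullet> x) - 2 * (x \<bullet> v) + C = 0} = {x. v \<bullet> x = C / 2}"
      using True by (auto simp: inner_commute)
    ultimately show ?thesis by simp
  next
    case False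
    have "{x. A * (x \<bullet> x) - 2 * (x \<bullet> v) + C = 0} \<subseteq> sphere (v /\<^sub>R A) (sqrt ((norm (v /\<^sub>R A))\<^sup>2 - C / A))"
    proof
      fix x assume "x \<in> {x. A * (x \<bullet> x) - 2 * (x \<bullet> v) + C = 0}"
      then have "x \<bullet> x - 2 * (x \<bullet> (v /\<^sub>R A)) + C / A = 0"
        using False by (simp add: field_simps)
      then have "(norm (x - v /\<^sub>R A))\<^sup>2 = (norm (v /\<^sub>R A))\<^sup>2 - C / A"
        unfolding sq by simp
      then have "norm (x - v /\<^sub>R A) = sqrt ((norm (v /\<^sub>R A))\<^sup>2 - C / A)"
        by (metis norm_ge_zero real_sqrt_unique)
      then show "x \<in> sphere (v /\<^sub>R A) (sqrt ((norm (v /\<^sub>R A))\<^sup>2 - C / A))"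
        by (simp add: dist_norm norm_minus_commute)
    qed
    then show ?thesis using negligible_sphere negligible_subset by blast
  qed
  then show ?thesis using sub negligible_subset by blast
qed

text \<open>A bound on the distance to \<open>x\<close> bounds the distance to 0, hence keeps
  \<open>norm y\<close> below a constant less than 1; on that Euclidean ball the distance is
  continuous.\<close>

lemma hyp_ball_compact:
  fixes x :: "real^'n"
  assumes x: "x \<in> unit_ball"
  shows "compact {y \<in> unit_ball. hyp_dist y x \<le> R}"
proof -
  define c where "c = cosh (R + hyp_dist x 0)"
  \<comment> \<open>Solution of \<open>(1 + \<rho>\<^sup>2) / (1 - \<rho>\<^sup>2) = c\<close>, the
    left side being cosh of the distance from 0 to a point of norm \<open>\<rho>\<close>.\<close>
  define \<rho> where "\<rho> = sqrt ((c - 1) / (c + 1))"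
  have z: "(0 :: real^'n) \<in> unit_ball" by simp
  have c1: "1 \<le> c" by (simp add: c_def cosh_real_ge_1)
  have "\<rho> < 1" unfolding \<rho>_def using c1 by (subst real_sqrt_lt_1_iff) (simp add: field_simps)
  then have sub: "cball 0 \<rho> \<subseteq> (unit_ball :: (real^'n) set)" by auto
  have bd: "norm y \<le> \<rho>" if y: "y \<in> unit_ball" "hyp_dist y x \<le> R" for y :: "real^'n"
  proof -
    have "hyp_dist y 0 \<le> R + hyp_dist x 0"
      using hyp_dist_triangle[OF y(1) x z] y(2) by simp
    then have "cosh (hyp_dist y 0) \<le> c"
      unfolding c_def using hyp_dist_nonneg[OF y(1) z] by (subst cosh_real_nonneg_le_iff) auto
    then have "1 + 2 * ((norm y)\<^sup>2 / (1 - (norm y)\<^sup>2)) \<le> c"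
      using cosh_hyp_dist[OF y(1) z] by simp
    then have "2 * (norm y)\<^sup>2 \<le> (c - 1) * (1 - (norm y)\<^sup>2)"
      using unit_ball_pos[OF y(1)] by (simp add: field_simps)
    then have "(norm y)\<^sup>2 * (c + 1) \<le> c - 1" by (simp add: algebra_simps)
    then have "(norm y)\<^sup>2 \<le> (c - 1) / (c + 1)" using c1 by (simp add: pos_le_divide_eq)
    then show ?thesis unfolding \<rho>_def by (rule real_le_rsqrt)
  qed
  have "{y \<in> unit_ball. hyp_dist y x \<le> R} = {y \<in> cball 0 \<rho>. hyp_dist y x \<le> R}"
    using bd sub by auto
  moreover have "closed {y \<in> cball 0 \<rho>. hyp_dist y x \<le> R}"
    using continuous_closed_preimage[OF continuous_on_subset[OF continuous_on_hyp_dist[OF x] sub] closed_cball closed_atMost[of R]]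
    by (simp add: vimage_def Int_def)
  moreover have "bounded {y \<in> cball 0 \<rho>. hyp_dist y x \<le> R}"
    using bounded_cball bounded_subset by (metis (no_types, lifting) mem_Collect_eq subsetI)
  ultimately show ?thesis by (simp add: compact_eq_bounded_closed)
qed

context moebius_group
begin

text \<open>By \<open>G_derivative_det\<close> the hyperbolic Jacobian of a group element is
  1.\<close>

lemma
  assumes g: "g \<in> G" and E: "E \<in> sets hyp_volume"
  shows G_image_sets: "g ` E \<in> sets hyp_volume"
    and hyp_volume_G: "emeasure hyp_volume (g ` E) = emeasure hyp_volume E"
proof -
  have EB: "E \<subseteq> unit_ball" using E by (simp add: sets_hyp_volume)
  define g' where "g' = (\<lambda>x. frechet_derivative g (at x))"
  have der: "(g has_derivative g' x) (at x)" if "x \<in> E" for x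
  proof -
    have "x \<in> unit_ball" using that EB by (rule rev_subsetD)
    then show ?thesis
      unfolding g'_def frechet_derivative_works[symmetric] by (rule G_differentiable[OF g])
  qed
  have derE: "(g has_derivative g' x) (at x within E)" if "x \<in> E" for x
    using der[OF that] by (rule has_derivative_at_withinI)
  have inj: "inj_on g E"
    using bij_betw_imp_inj_on[OF G_bij_betw[OF g]] EB by (rule inj_on_subset)
  have im: "g ` E \<subseteq> unit_ball" using EB G_in_ball[OF g] by (meson image_subsetI subsetD)
  show "g ` E \<in> sets hyp_volume" by (rule hyp_volume_image_sets[OF E derE inj im])
  have "emeasure hyp_volume (g ` E) = (\<integral>\<^sup>+x. ennreal (hyp_jacobian g g' x) * indicator E x \<partial>hyp_volume)"
    by (rule hyp_volume_image[OF E derE inj im])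
  also have "\<dots> = (\<integral>\<^sup>+x. indicator E x \<partial>hyp_volume)"
  proof (rule nn_integral_cong)
    fix x assume "x \<in> space (hyp_volume :: (real^'n) measure)"
    show "ennreal (hyp_jacobian g g' x) * indicator E x = indicator E x"
    proof (cases "x \<in> E")
      case True
      then have x: "x \<in> unit_ball" using EB by blast
      have "hyp_jacobian g g' x = 1"
        unfolding hyp_jacobian_def G_derivative_det[OF g x der[OF True]]
        using unit_ball_pos[OF x] unit_ball_pos[OF G_in_ball[OF g x]]
        by (simp add: power_mult_distrib[symmetric])
      then show ?thesis by simp
    qed simp
  qed
  also have "\<dots> = emeasure hyp_volume E" using E by simp
  finally show "emeasure hyp_volume (g ` E) = emeasure hyp_volume E" .
qed

text \<open>A closed hyperbolic ball is compact, hence covered by finitely many injectivity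
  neighbourhoods, and each of these contains at most one point \<open>g a\<close>, which determines
  \<open>g\<close>.\<close>

lemma orbit_locally_finite:
  assumes z: "z \<in> unit_ball" and a: "a \<in> unit_ball"
  shows "finite {g \<in> G. hyp_dist z (g a) \<le> R}"
proof -
  let ?K = "{y \<in> unit_ball. hyp_dist y z \<le> R}"
  have "\<exists>B. open B \<and> y \<in> B \<and> B \<subseteq> unit_ball \<and> inj_on proj B" if "y \<in> ?K" for y
  proof -
    have "y \<in> unit_ball" using that by simp
    then show ?thesis by (rule injective_neighbourhood) blast
  qed
  then have "\<exists>B. \<forall>y\<in>?K. open (B y) \<and> y \<in> B y \<and> B y \<subseteq> unit_ball \<and> inj_on proj (B y)"
    by (intro bchoice ballI)
  then obtain B where "\<forall>y\<in>?K. open (B y) \<and> y \<in> B y \<and> B y \<subseteq> unit_ball \<and> inj_on proj (B y)" ..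
  then have B: "\<And>y. y \<in> ?K \<Longrightarrow> open (B y) \<and> y \<in> B y \<and> B y \<subseteq> unit_ball \<and> inj_on proj (B y)"
    by (rule bspec)
  obtain T where T: "T \<subseteq> ?K" "finite T" "?K \<subseteq> (\<Union>y\<in>T. B y)"
  proof (rule compactE_image[OF hyp_ball_compact[OF z, of R], of ?K B])
    show "open (B y)" if "y \<in> ?K" for y using B[OF that] by simp
    show "?K \<subseteq> (\<Union>y\<in>?K. B y)" using B by blast
  qed
  have fin: "finite {g \<in> G. g a \<in> B y}" if y: "y \<in> ?K" for y
  proof -
    have one: "g = h" if gh: "g \<in> G" "h \<in> G" "g a \<in> B y" "h a \<in> B y" for g h
    proof -
      have "proj (g a) = proj (h a)" by (simp only: proj_G[OF gh(1) a] proj_G[OF gh(2) a])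
      then have "g a = h a" using B[OF y] gh by (auto dest: inj_onD)
      then show ?thesis using G_eq_at[OF gh(1,2) a] by blast
    qed
    show ?thesis
    proof (cases "{g \<in> G. g a \<in> B y} = {}")
      case False
      then obtain g where "g \<in> G" "g a \<in> B y" by blast
      then have "{g \<in> G. g a \<in> B y} \<subseteq> {g}" using one by blast
      then show ?thesis by (rule finite_subset) simp
    next
      case True
      then show ?thesis by (simp only: finite.emptyI)
    qed
  qed
  have "finite (\<Union>y\<in>T. {g \<in> G. g a \<in> B y})"
    by (rule finite_UN_I[OF T(2) fin[OF subsetD[OF T(1)]]])
  moreover have "{g \<in> G. hyp_dist z (g a) \<le> R} \<subseteq> (\<Union>y\<in>T. {g \<in> G. g a \<in> B y})"
  proof
    fix g assume g: "g \<in> {g \<in> G. hyp_dist z (g a) \<le> R}"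
    then have "g a \<in> ?K" using a by (simp add: hyp_dist_commute)
    then obtain y where "y \<in> T" "g a \<in> B y" using T(3) by blast
    then show "g \<in> (\<Union>y\<in>T. {g \<in> G. g a \<in> B y})" using g by blast
  qed
  ultimately show ?thesis by (rule finite_subset[rotated])
qed

section \<open>The normal polyhedron as a fundamental domain up to null sets\<close>

lemma normal_polyhedron_subset: "normal_polyhedron G p0 \<subseteq> unit_ball"
  by (auto simp: normal_polyhedron_def)

lemma normal_polyhedron_sets:
  assumes p0: "p0 \<in> unit_ball"
  shows "normal_polyhedron G p0 \<in> sets hyp_volume"
proof -
  define W where "W = (\<lambda>T. {p \<in> unit_ball. hyp_dist p p0 < hyp_dist p (T p0)})"
  have op: "open (W T)" if "T \<in> G" for T
  proof -
    have "continuous_on unit_ball (\<lambda>p. hyp_dist p (T p0) - hyp_dist p p0)"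
      by (intro continuous_on_diff continuous_on_hyp_dist p0 G_in_ball[OF that p0])
    then have "open ((\<lambda>p. hyp_dist p (T p0) - hyp_dist p p0) -` {0<..} \<inter> unit_ball)"
      using continuous_on_open_vimage[OF open_ball] open_greaterThan by blast
    also have "(\<lambda>p. hyp_dist p (T p0) - hyp_dist p p0) -` {0<..} \<inter> unit_ball = W T"
      by (auto simp: W_def)
    finally show ?thesis .
  qed
  have "normal_polyhedron G p0 = unit_ball - (\<Union>T\<in>G - {gone}. unit_ball - W T)"
    unfolding normal_polyhedron_def gone_eq[symmetric] W_def
    by (rule equalityI; rule subsetI) (simp_all del: mem_ball_0)
  also have "\<dots> \<in> sets lebesgue"
  proof (rule sets.Diff[OF _ sets.countable_UN''])
    show "countable (G - {gone})" by (rule countable_Diff[OF countable_G])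
    show "unit_ball - W T \<in> sets lebesgue" if "T \<in> G - {gone}" for T
    proof (rule sets.Diff)
      have "open (W T)" using op that by blast
      then show "W T \<in> sets lebesgue" by simp
    qed simp
  qed simp
  finally show ?thesis using normal_polyhedron_subset by (simp add: sets_hyp_volume)
qed

text \<open>Suppose \<open>k\<close>, which takes \<open>g x\<close> to \<open>h x\<close>, is not
  the identity. Then \<open>g x\<close> is closer to \<open>p0\<close> than to
  \<open>ginv k p0\<close>; applying \<open>k\<close>, \<open>h x\<close> is closer to
  \<open>k p0\<close> than to \<open>p0\<close>, although it lies in the polyhedron.\<close>

lemma normal_polyhedron_unique:
  assumes p0: "p0 \<in> unit_ball" and x: "x \<in> unit_ball" and g: "g \<in> G" and h: "h \<in> G"
    and gx: "g x \<in> normal_polyhedron G p0" and hx: "h x \<in> normal_polyhedron G p0"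
  shows "g = h"
proof -
  define k where "k = gmult h (ginv g)"
  have k: "k \<in> G" using g h by (simp add: k_def)
  have kgx: "k (g x) = h x" using g h x by (simp add: k_def)
  have "k = gone"
  proof (rule ccontr)
    assume ne: "k \<noteq> gone"
    have ne': "ginv k \<noteq> gone"
    proof
      assume "ginv k = gone"
      then have "k x = x" using ginv_right[OF k x] x by simp
      then show False using G_free[OF k x] ne by simp
    qed
    have "hyp_dist (g x) p0 < hyp_dist (g x) (ginv k p0)"
      using gx ne' ginv_closed[OF k] unfolding normal_polyhedron_def gone_eq[symmetric] by blast
    also have "\<dots> = hyp_dist (h x) p0"
      using hyp_dist_ginv[OF k p0 G_in_ball[OF g x]] kgx by (simp add: hyp_dist_commute)
    also have "\<dots> < hyp_dist (h x) (k p0)"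
      using hx ne k unfolding normal_polyhedron_def gone_eq[symmetric] by blast
    also have "\<dots> = hyp_dist (g x) p0"
      unfolding kgx[symmetric] by (rule hyp_dist_G[OF k G_in_ball[OF g x] p0])
    finally show False by simp
  qed
  then have "h x = g x" using kgx g x by simp
  then show ?thesis using G_eq_at[OF g h x] by simp
qed

lemma normal_polyhedron_inj:
  assumes p0: "p0 \<in> unit_ball"
  shows "inj_on proj (normal_polyhedron G p0)"
proof (rule inj_onI)
  fix x y assume xy: "x \<in> normal_polyhedron G p0" "y \<in> normal_polyhedron G p0" "proj x = proj y"
  then have b: "x \<in> unit_ball" "y \<in> unit_ball" using normal_polyhedron_subset by blast+
  obtain g where g: "g \<in> G" "x = g y" by (rule proj_eqD[OF xy(3) b(1)])
  have "g = gone"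
    using normal_polyhedron_unique[OF p0 b(2) g(1) gone_closed] xy g b by simp
  then show "x = y" using g b by simp
qed

text \<open>By local finiteness some orbit point \<open>g p0\<close> is nearest to \<open>x\<close>.
  If \<open>ginv g x\<close> is not in the polyhedron, another orbit point is equally near, so
  \<open>x\<close> lies on one of countably many bisectors.\<close>

lemma normal_polyhedron_cover:
  assumes p0: "p0 \<in> unit_ball"
  shows "negligible {x \<in> unit_ball. \<forall>g\<in>G. g x \<notin> normal_polyhedron G p0}"
proof -
  let ?Bis = "\<lambda>(g, h). {x \<in> unit_ball. hyp_dist x (g p0) = hyp_dist x (h p0)}"
  let ?I = "{(g, h). g \<in> G \<and> h \<in> G \<and> g \<noteq> h}"
  have "countable (G \<times> G)" using countable_G by blast
  then have "countable ?I" by (rule countable_subset[rotated]) auto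
  moreover have "negligible (?Bis i)" if "i \<in> ?I" for i
  proof -
    obtain g h where gh: "i = (g, h)" by (cases i)
    then have i: "i = (g, h)" "g \<in> G" "h \<in> G" "g \<noteq> h" using that by simp_all
    then have "g p0 \<noteq> h p0" using G_eq_at[OF i(2,3) p0] by blast
    then show ?thesis using hyp_bisector_negligible[of "g p0" "h p0"] i p0 by simp
  qed
  ultimately have neg: "negligible (\<Union>i\<in>?I. ?Bis i)"
    unfolding negligible_iff_null_sets by (intro null_sets_UN') auto
  have "{x \<in> unit_ball. \<forall>g\<in>G. g x \<notin> normal_polyhedron G p0} \<subseteq> (\<Union>i\<in>?I. ?Bis i)"
  proof
    fix x assume "x \<in> {x \<in> unit_ball. \<forall>g\<in>G. g x \<notin> normal_polyhedron G p0}"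
    then have x: "x \<in> unit_ball" and out: "\<And>g. g \<in> G \<Longrightarrow> g x \<notin> normal_polyhedron G p0" by auto
    define F where "F = {g \<in> G. hyp_dist x (g p0) \<le> hyp_dist x (gone p0)}"
    have F: "finite F" "F \<noteq> {}"
      unfolding F_def using orbit_locally_finite[OF x p0] gone_closed by blast+
    define m where "m = Min ((\<lambda>g. hyp_dist x (g p0)) ` F)"
    have "m \<in> (\<lambda>g. hyp_dist x (g p0)) ` F" unfolding m_def using F by (intro Min_in) auto
    then obtain g where g: "g \<in> F" "m = hyp_dist x (g p0)" by blast
    have gG: "g \<in> G" using g by (simp add: F_def)
    have min: "hyp_dist x (g p0) \<le> hyp_dist x (h p0)" if "h \<in> G" for h
    proof (cases "h \<in> F")
      case True
      then have "m \<le> hyp_dist x (h p0)" unfolding m_def using F by (intro Min_le) auto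
      then show ?thesis using g by simp
    next
      case False
      then have "hyp_dist x (gone p0) < hyp_dist x (h p0)" using that by (simp add: F_def)
      then show ?thesis using g by (simp add: F_def)
    qed
    have gi: "hyp_dist (ginv g x) y = hyp_dist x (g y)" if "y \<in> unit_ball" for y
      by (rule hyp_dist_ginv[OF gG x that])
    have "ginv g x \<notin> normal_polyhedron G p0" using out gG by blast
    then obtain T where T: "T \<in> G" "T \<noteq> gone" "\<not> hyp_dist (ginv g x) p0 < hyp_dist (ginv g x) (T p0)"
      unfolding normal_polyhedron_def gone_eq[symmetric] using G_in_ball[OF ginv_closed[OF gG] x] by blast
    have "\<not> hyp_dist x (g p0) < hyp_dist x (gmult g T p0)"
      using T(3) gi[OF p0] gi[OF G_in_ball[OF T(1) p0]] p0 by simp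
    then have eq: "hyp_dist x (g p0) = hyp_dist x (gmult g T p0)"
      using min[OF gmult_closed[OF gG T(1)]] by simp
    have "g \<noteq> gmult g T"
    proof
      assume "g = gmult g T"
      then have "g p0 = g (T p0)" using gmult_apply[OF p0] by metis
      then have "p0 = T p0" by (metis T(1) G_in_ball gG ginv_left p0)
      then show False using G_free[OF T(1) p0] T(2) by simp
    qed
    then have "(g, gmult g T) \<in> ?I" using gG T(1) by simp
    moreover have "x \<in> ?Bis (g, gmult g T)" using x eq by simp
    ultimately show "x \<in> (\<Union>i\<in>?I. ?Bis i)" by blast
  qed
  then show ?thesis using neg negligible_subset by blast
qed

section \<open>The orbit measure as an image of hyperbolic volume\<close>

lemma orbit_vimage_eq: "orbit_vimage G A = proj -` A \<inter> unit_ball"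
  by (auto simp: orbit_vimage_def)

lemma orbit_vimage_subset: "orbit_vimage G A \<subseteq> unit_ball"
  by (auto simp: orbit_vimage_def)

text \<open>\<open>measure_of\<close> takes the intended values once the set system is known to be a
  sigma-algebra and the set function countably additive; both are inherited from
  \<open>hyp_volume\<close> because preimages commute with set operations.\<close>

lemma
  assumes p0: "p0 \<in> unit_ball"
  shows sets_orbit_measure:
      "A \<in> sets (orbit_measure G p0) \<longleftrightarrow> A \<subseteq> orbit_space G \<and> orbit_vimage G A \<in> sets hyp_volume"
    and space_orbit_measure: "space (orbit_measure G p0) = orbit_space G"
    and emeasure_orbit_measure: "A \<in> sets (orbit_measure G p0) \<Longrightarrow>
      emeasure (orbit_measure G p0) A = emeasure hyp_volume (normal_polyhedron G p0 \<inter> orbit_vimage G A)"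
proof -
  let ?A = "{A. A \<subseteq> orbit_space G \<and> orbit_vimage G A \<in> sets hyp_volume}"
  let ?P = "normal_polyhedron G p0"
  let ?\<mu> = "\<lambda>A. emeasure hyp_volume (?P \<inter> orbit_vimage G A)"
  have P: "?P \<in> sets hyp_volume" by (rule normal_polyhedron_sets[OF p0])
  have sa: "sigma_algebra (orbit_space G) ?A"
    unfolding sigma_algebra_iff2
  proof (intro conjI ballI allI impI)
    show "{} \<in> ?A" by (simp add: orbit_vimage_def)
    fix A assume A: "A \<in> ?A"
    have "orbit_vimage G (orbit_space G - A) = space hyp_volume - orbit_vimage G A"
      by (auto simp: orbit_vimage_def space_hyp_volume)
    then show "orbit_space G - A \<in> ?A" using A by auto
  next
    fix A :: "nat \<Rightarrow> _" assume A: "range A \<subseteq> ?A"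
    have "orbit_vimage G (\<Union>i. A i) = (\<Union>i. orbit_vimage G (A i))"
      by (auto simp: orbit_vimage_def)
    moreover have "(\<Union>i. orbit_vimage G (A i)) \<in> sets hyp_volume" using A by (intro sets.countable_UN) auto
    ultimately show "(\<Union>i. A i) \<in> ?A" using A by auto
  qed auto
  have ss: "sigma_sets (orbit_space G) ?A = ?A" by (rule sigma_algebra.sigma_sets_eq[OF sa])
  have pow: "?A \<subseteq> Pow (orbit_space G)" by auto
  show sets: "A \<in> sets (orbit_measure G p0) \<longleftrightarrow> A \<subseteq> orbit_space G \<and> orbit_vimage G A \<in> sets hyp_volume" for A
    unfolding orbit_measure_def sets_measure_of[OF pow] ss by blast
  show "space (orbit_measure G p0) = orbit_space G"
    unfolding orbit_measure_def by (rule space_measure_of[OF pow])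
  assume "A \<in> sets (orbit_measure G p0)"
  then have A: "A \<in> ?A" using sets by blast
  show "emeasure (orbit_measure G p0) A = ?\<mu> A"
    unfolding orbit_measure_def
  proof (rule emeasure_measure_of_sigma[OF sa _ _ A])
    show "positive ?A ?\<mu>" by (simp add: positive_def orbit_vimage_def)
    show "countably_additive ?A ?\<mu>"
    proof (rule countably_additiveI)
      fix B :: "nat \<Rightarrow> _" assume B: "range B \<subseteq> ?A" "disjoint_family B"
      have eq: "?P \<inter> orbit_vimage G (\<Union>i. B i) = (\<Union>i. ?P \<inter> orbit_vimage G (B i))"
        by (auto simp: orbit_vimage_def)
      have "(\<Sum>i. emeasure hyp_volume (?P \<inter> orbit_vimage G (B i))) =
          emeasure hyp_volume (\<Union>i. ?P \<inter> orbit_vimage G (B i))"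
      proof (rule suminf_emeasure)
        show "range (\<lambda>i. ?P \<inter> orbit_vimage G (B i)) \<subseteq> sets hyp_volume" using B(1) P by auto
        show "disjoint_family (\<lambda>i. ?P \<inter> orbit_vimage G (B i))"
          using B(2) by (auto simp: disjoint_family_on_def orbit_vimage_def)
      qed
      then show "(\<Sum>i. ?\<mu> (B i)) = ?\<mu> (\<Union>i. B i)" unfolding eq .
    qed
  qed
qed

lemma proj_measurable:
  assumes p0: "p0 \<in> unit_ball"
  shows "proj \<in> hyp_volume \<rightarrow>\<^sub>M orbit_measure G p0"
  by (rule measurableI)
    (auto simp: space_hyp_volume space_orbit_measure[OF p0] sets_orbit_measure[OF p0] orbit_vimage_eq)

text \<open>The orbit measure is the image under \<open>proj\<close> of the volume restricted to the
  polyhedron, the restriction being written as a density.\<close>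

lemma nn_integral_orbit_measure:
  assumes p0: "p0 \<in> unit_ball" and u: "u \<in> borel_measurable (orbit_measure G p0)"
  shows "(\<integral>\<^sup>+p. u p \<partial>orbit_measure G p0) = (\<integral>\<^sup>+x. u (proj x) * indicator (normal_polyhedron G p0) x \<partial>hyp_volume)"
proof -
  let ?P = "normal_polyhedron G p0"
  have P: "?P \<in> sets hyp_volume" by (rule normal_polyhedron_sets[OF p0])
  have ind: "(indicator ?P :: _ \<Rightarrow> ennreal) \<in> borel_measurable hyp_volume" using P by simp
  have pm: "proj \<in> density hyp_volume (indicator ?P) \<rightarrow>\<^sub>M orbit_measure G p0"
    using proj_measurable[OF p0] by simp
  have eq: "orbit_measure G p0 = distr (density hyp_volume (indicator ?P)) (orbit_measure G p0) proj"
  proof (rule measure_eqI)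
    fix A assume A: "A \<in> sets (orbit_measure G p0)"
    then have v: "orbit_vimage G A \<in> sets hyp_volume" by (simp add: sets_orbit_measure[OF p0])
    have "emeasure (distr (density hyp_volume (indicator ?P)) (orbit_measure G p0) proj) A =
        emeasure (density hyp_volume (indicator ?P)) (orbit_vimage G A)"
      using emeasure_distr[OF pm A] by (simp add: space_hyp_volume orbit_vimage_eq)
    also have "\<dots> = emeasure hyp_volume (?P \<inter> orbit_vimage G A)"
      using v P by (subst emeasure_density[OF ind]) (simp_all add: indicator_inter_arith[symmetric])
    finally show "emeasure (orbit_measure G p0) A =
        emeasure (distr (density hyp_volume (indicator ?P)) (orbit_measure G p0) proj) A"
      using emeasure_orbit_measure[OF p0 A] by simp
  qed simp
  have "(\<integral>\<^sup>+p. u p \<partial>orbit_measure G p0) = (\<integral>\<^sup>+p. u p \<partial>distr (density hyp_volume (indicator ?P)) (orbit_measure G p0) proj)"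
    using eq by simp
  also have "\<dots> = (\<integral>\<^sup>+x. u (proj x) \<partial>density hyp_volume (indicator ?P))"
    by (rule nn_integral_distr[OF pm]) (use u in simp)
  also have "\<dots> = (\<integral>\<^sup>+x. indicator ?P x * u (proj x) \<partial>hyp_volume)"
    by (rule nn_integral_density[OF ind measurable_compose[OF proj_measurable[OF p0] u]])
  finally show ?thesis by (simp add: mult.commute)
qed

text \<open>The part of \<open>E\<close> that \<open>g\<close> moves into the polyhedron arrives
  there with its volume unchanged. For different \<open>g\<close> these parts are disjoint in
  \<open>E\<close> by uniqueness in the polyhedron, their images are disjoint because
  \<open>proj\<close> is injective on \<open>E\<close>, and the rest of \<open>E\<close> is null.
  Thus the orbit measure can be computed in charts anywhere in the ball.\<close>

lemma
  assumes p0: "p0 \<in> unit_ball" and E: "E \<in> sets hyp_volume" and inj: "inj_on proj E"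
  shows proj_image_sets: "proj ` E \<in> sets (orbit_measure G p0)"
    and emeasure_proj_image: "emeasure (orbit_measure G p0) (proj ` E) = emeasure hyp_volume E"
proof -
  let ?P = "normal_polyhedron G p0"
  have P: "?P \<in> sets hyp_volume" by (rule normal_polyhedron_sets[OF p0])
  have EB: "E \<subseteq> unit_ball" using E by (simp add: sets_hyp_volume)
  have vim: "orbit_vimage G (proj ` E) = (\<Union>g\<in>G. g ` E)" by (rule orbit_vimage_image[OF EB])
  have gE: "g ` E \<in> sets hyp_volume" if "g \<in> G" for g by (rule G_image_sets[OF that E])
  show s: "proj ` E \<in> sets (orbit_measure G p0)"
    unfolding sets_orbit_measure[OF p0] vim
  proof
    show "proj ` E \<subseteq> orbit_space G" using EB by auto
    show "(\<Union>g\<in>G. g ` E) \<in> sets hyp_volume"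
      using gE countable_G by (intro sets.countable_UN') auto
  qed
  define X where "X = (\<lambda>g. {x \<in> E. g x \<in> ?P})"
  have X: "X g = E \<inter> ginv g ` ?P" if g: "g \<in> G" for g
  proof (rule equalityI; rule subsetI)
    fix x assume "x \<in> X g"
    then have "x \<in> E" "g x \<in> ?P" "x = ginv g (g x)" using EB g by (auto simp: X_def)
    then show "x \<in> E \<inter> ginv g ` ?P" by blast
  next
    fix x assume "x \<in> E \<inter> ginv g ` ?P"
    then show "x \<in> X g" using g normal_polyhedron_subset by (auto simp: X_def subset_iff)
  qed
  have Xs: "X g \<in> sets hyp_volume" if "g \<in> G" for g
    unfolding X[OF that] using E G_image_sets[OF ginv_closed[OF that] P] by blast
  have gX: "?P \<inter> g ` E = g ` X g" for g by (auto simp: X_def)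
  have disjX: "disjoint_family_on X G"
    unfolding disjoint_family_on_def
  proof (intro ballI impI)
    fix g h assume gh: "g \<in> G" "h \<in> G" "g \<noteq> h"
    show "X g \<inter> X h = {}"
    proof (rule ccontr)
      assume "X g \<inter> X h \<noteq> {}"
      then obtain x where x: "x \<in> E" "g x \<in> ?P" "h x \<in> ?P" by (auto simp: X_def)
      then have "x \<in> unit_ball" using EB by blast
      from normal_polyhedron_unique[OF p0 this gh(1,2) x(2,3)] gh(3) show False by simp
    qed
  qed
  have disjg: "disjoint_family_on (\<lambda>g. ?P \<inter> g ` E) G"
    unfolding disjoint_family_on_def
  proof (intro ballI impI)
    fix g h assume gh: "g \<in> G" "h \<in> G" "g \<noteq> h"
    have "g ` E \<inter> h ` E = {}"
    proof (rule ccontr)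
      assume "g ` E \<inter> h ` E \<noteq> {}"
      then obtain x y where xy: "x \<in> E" "y \<in> E" "g x = h y" by blast
      then have b: "x \<in> unit_ball" "y \<in> unit_ball" using EB by auto
      have "proj x = proj (g x)" by (rule proj_G[OF gh(1) b(1), symmetric])
      also have "\<dots> = proj y" unfolding xy(3) by (rule proj_G[OF gh(2) b(2)])
      finally have "x = y" using inj xy by (auto dest: inj_onD)
      then show False using G_eq_at[OF gh(1,2) b(1)] xy gh by simp
    qed
    then show "(?P \<inter> g ` E) \<inter> (?P \<inter> h ` E) = {}" by blast
  qed
  define N where "N = E \<inter> {x \<in> unit_ball. \<forall>g\<in>G. g x \<notin> ?P}"
  have N: "N \<in> null_sets hyp_volume"
    unfolding null_sets_hyp_volume N_def
    using negligible_subset[OF normal_polyhedron_cover[OF p0] Int_lower2] EB by (simp add: le_infI1)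
  have EX: "E = (\<Union>g\<in>G. X g) \<union> N"
  proof (rule equalityI; rule subsetI)
    fix x assume x: "x \<in> E"
    then have "x \<in> unit_ball" using EB by blast
    then show "x \<in> (\<Union>g\<in>G. X g) \<union> N" unfolding X_def N_def using x by blast
  next
    fix x assume "x \<in> (\<Union>g\<in>G. X g) \<union> N"
    then show "x \<in> E" by (auto simp: X_def N_def)
  qed
  have "emeasure (orbit_measure G p0) (proj ` E) = emeasure hyp_volume (\<Union>g\<in>G. ?P \<inter> g ` E)"
    unfolding emeasure_orbit_measure[OF p0 s] vim by (rule arg_cong[where f = "emeasure hyp_volume"]) blast
  also have "\<dots> = (\<integral>\<^sup>+g. emeasure hyp_volume (?P \<inter> g ` E) \<partial>count_space G)"
    using P gE by (intro emeasure_UN_countable countable_G disjg) auto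
  also have "\<dots> = (\<integral>\<^sup>+g. emeasure hyp_volume (X g) \<partial>count_space G)"
    by (intro nn_integral_cong) (simp add: gX hyp_volume_G Xs)
  also have "\<dots> = emeasure hyp_volume (\<Union>g\<in>G. X g)"
    using Xs by (intro emeasure_UN_countable[symmetric] countable_G disjX) auto
  also have "\<dots> = emeasure hyp_volume E"
  proof -
    have "(\<Union>g\<in>G. X g) \<in> sets hyp_volume" using Xs countable_G by (intro sets.countable_UN') auto
    then show ?thesis using emeasure_Un_null_set[OF _ N] EX by metis
  qed
  finally show "emeasure (orbit_measure G p0) (proj ` E) = emeasure hyp_volume E" .
qed

lemma sets_orbit_borel_subset:
  assumes p0: "p0 \<in> unit_ball"
  shows "sets (orbit_borel G) \<subseteq> sets (orbit_measure G p0)"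
proof -
  have "openin (orbit_topology G) U \<Longrightarrow> U \<in> sets (orbit_measure G p0)" for U
    unfolding openin_orbit_topology sets_orbit_measure[OF p0] sets_hyp_volume
    using orbit_vimage_subset by auto
  moreover have "{U. openin (orbit_topology G) U} \<subseteq> Pow (orbit_space G)"
    unfolding openin_orbit_topology by auto
  ultimately show ?thesis
    unfolding orbit_borel_def using sets.sigma_sets_subset[of "{U. openin (orbit_topology G) U}" "orbit_measure G p0"]
    by (simp add: space_orbit_measure[OF p0] subset_iff)
qed

lemma space_orbit_borel: "space (orbit_borel G) = orbit_space G"
  unfolding orbit_borel_def by (rule space_measure_of) (auto simp: openin_orbit_topology)

lemma openin_sets_orbit_borel: "openin (orbit_topology G) U \<Longrightarrow> U \<in> sets (orbit_borel G)"
  unfolding orbit_borel_def by (subst sets_measure_of) (auto simp: openin_orbit_topology)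

lemma orbit_borel_measurable:
  assumes p0: "p0 \<in> unit_ball" and u: "u \<in> borel_measurable (orbit_borel G)"
  shows "u \<in> borel_measurable (orbit_measure G p0)"
  using sets_orbit_borel_subset[OF p0] u
  unfolding measurable_def by (auto simp: space_orbit_borel space_orbit_measure[OF p0])

end

section \<open>Length of paths\<close>

lemma path_len_upper:
  assumes "t 0 = a" "t m = b" "\<And>k. k < m \<Longrightarrow> t k \<le> t (Suc k)"
  shows "(\<Sum>k<m. ennreal (orbit_dist (\<gamma> (t k)) (\<gamma> (t (Suc k))))) \<le> path_len \<gamma> a b"
  unfolding path_len_def by (rule SUP_upper2[of "(m, t)"]) (use assms in auto)

lemma path_len_least:
  assumes "\<And>m t. t 0 = a \<Longrightarrow> t m = b \<Longrightarrow> (\<And>k. k < m \<Longrightarrow> t k \<le> t (Suc k)) \<Longrightarrow>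
    (\<Sum>k<m. ennreal (orbit_dist (\<gamma> (t k)) (\<gamma> (t (Suc k))))) \<le> x"
  shows "path_len \<gamma> a b \<le> x"
  unfolding path_len_def by (rule SUP_least) (use assms in auto)

lemma partition_mono:
  fixes t :: "nat \<Rightarrow> real"
  assumes "\<And>k. k < m \<Longrightarrow> t k \<le> t (Suc k)" "i \<le> j" "j \<le> m"
  shows "t i \<le> t j"
  using assms(2,3)
proof (induction j)
  case (Suc j)
  then show ?case
    using assms(1)[of j] by (cases "i = Suc j") auto
qed simp

lemma partition_nonempty:
  fixes a b :: real
  assumes "a \<le> b"
  shows "{(m::nat, t). t 0 = a \<and> t m = b \<and> (\<forall>k<m. t k \<le> t (Suc k))} \<noteq> {}"
proof -
  have "(1::nat, \<lambda>k. if k = 0 then a else b) \<in> {(m::nat, t). t 0 = a \<and> t m = b \<and> (\<forall>k<m. t k \<le> t (Suc k))}"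
    using assms by simp
  then show ?thesis by blast
qed

lemma orbit_dist_sym: "orbit_dist p q = orbit_dist q p"
  unfolding orbit_dist_def by (rule arg_cong[where f = Inf]) (use hyp_dist_commute in blast)

text \<open>The metric facts from which the theory of arc length is developed. Stated without a
  group, they apply alike to a path and to its image under \<open>f\<close>, which live over
  different groups.\<close>

locale orbit_curve =
  fixes \<gamma> :: "real \<Rightarrow> (real^'n) set" and a b :: real
  assumes ab: "a \<le> b"
    and dist_self: "\<And>s. s \<in> {a..b} \<Longrightarrow> orbit_dist (\<gamma> s) (\<gamma> s) = 0"
    and dist_triangle: "\<And>s t u. s \<in> {a..b} \<Longrightarrow> t \<in> {a..b} \<Longrightarrow> u \<in> {a..b} \<Longrightarrow>
      orbit_dist (\<gamma> s) (\<gamma> u) \<le> orbit_dist (\<gamma> s) (\<gamma> t) + orbit_dist (\<gamma> t) (\<gamma> u)"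
    and dist_uniform: "\<And>\<epsilon>. 0 < \<epsilon> \<Longrightarrow>
      \<exists>\<delta>>0. \<forall>s\<in>{a..b}. \<forall>t\<in>{a..b}. \<bar>s - t\<bar> < \<delta> \<longrightarrow> orbit_dist (\<gamma> s) (\<gamma> t) < \<epsilon>"
begin

abbreviation edist :: "real \<Rightarrow> real \<Rightarrow> ennreal" where
  "edist s t \<equiv> ennreal (orbit_dist (\<gamma> s) (\<gamma> t))"

lemma dist_nonneg: "s \<in> {a..b} \<Longrightarrow> t \<in> {a..b} \<Longrightarrow> 0 \<le> orbit_dist (\<gamma> s) (\<gamma> t)"
  using dist_triangle[of s t s] dist_self[of s] by (simp add: orbit_dist_sym[of "\<gamma> t" "\<gamma> s"])

lemma edist_triangle:
  assumes "s \<in> {a..b}" "t \<in> {a..b}" "u \<in> {a..b}"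
  shows "edist s u \<le> edist s t + edist t u"
  using dist_triangle[OF assms] dist_nonneg assms by (simp add: ennreal_plus[symmetric] del: ennreal_plus)

text \<open>Cutting a partition at \<open>c\<close> with \<open>min\<close> and \<open>max\<close> avoids locating \<open>c\<close> among its points.\<close>

lemma edist_cut:
  assumes "s \<in> {a..b}" "t \<in> {a..b}" "c \<in> {a..b}" "s \<le> t"
  shows "edist s t \<le> edist (min s c) (min t c) + edist (max s c) (max t c)"
proof -
  consider "t \<le> c" | "c \<le> s" | "s \<le> c" "c \<le> t" by linarith
  then show ?thesis
  proof cases
    case 1
    then show ?thesis using assms by (simp add: min_absorb1)
  next
    case 2
    then show ?thesis using assms by (simp add: max_absorb1)
  next
    case 3
    then show ?thesis using edist_triangle[of s c t] assms by (simp add: min_absorb1 min_absorb2 max_absorb1 max_absorb2)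
  qed
qed

lemma path_len_self: "s \<in> {a..b} \<Longrightarrow> path_len \<gamma> s s = 0"
proof -
  assume s: "s \<in> {a..b}"
  have "path_len \<gamma> s s \<le> 0"
  proof (rule path_len_least)
    fix m and t :: "nat \<Rightarrow> real" assume t: "t 0 = s" "t m = s" "\<And>k. k < m \<Longrightarrow> t k \<le> t (Suc k)"
    have ts: "t k = s" if "k \<le> m" for k
      using partition_mono[of m t 0 k] partition_mono[of m t k m] t that by fastforce
    have "edist (t k) (t (Suc k)) = 0" if "k < m" for k
      using ts[of k] ts[of "Suc k"] that dist_self[OF s] by simp
    then show "(\<Sum>k<m. edist (t k) (t (Suc k))) \<le> 0" by simp
  qed
  then show ?thesis by simp
qed

lemma edist_le_path_len:
  assumes "s \<le> t"
  shows "edist s t \<le> path_len \<gamma> s t"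
  using path_len_upper[of "\<lambda>k. if k = 0 then s else t" s 1 t \<gamma>] assms by simp

lemma partition_cut:
  fixes t :: "nat \<Rightarrow> real"
  assumes t: "\<And>k. k < m \<Longrightarrow> t k \<le> t (Suc k)" "\<And>k. k \<le> m \<Longrightarrow> t k \<in> {a..b}" and c: "c \<in> {a..b}"
  shows "(\<Sum>k<m. edist (t k) (t (Suc k))) \<le>
    (\<Sum>k<m. edist (min (t k) c) (min (t (Suc k)) c)) + (\<Sum>k<m. edist (max (t k) c) (max (t (Suc k)) c))"
  unfolding sum.distrib[symmetric]
  by (rule sum_mono) (use t c in \<open>auto intro!: edist_cut simp del: atLeastAtMost_iff\<close>)

lemma sum_concat: "(\<Sum>k<m + n. f k) = (\<Sum>k<m. f k) + (\<Sum>k<n. f (m + k) :: 'c::comm_monoid_add)" for m n :: nat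
  by (induction n) (auto simp: add.assoc)

text \<open>Cutting a partition at \<open>s\<close> can only increase its sum, which gives one
  inequality; concatenating partitions of the two halves gives the other.\<close>

lemma path_len_add:
  assumes rst: "a \<le> r" "r \<le> s" "s \<le> t" "t \<le> b"
  shows "path_len \<gamma> r t = path_len \<gamma> r s + path_len \<gamma> s t"
proof (rule antisym)
  show "path_len \<gamma> r t \<le> path_len \<gamma> r s + path_len \<gamma> s t"
  proof (rule path_len_least)
    fix m and u :: "nat \<Rightarrow> real" assume u: "u 0 = r" "u m = t" "\<And>k. k < m \<Longrightarrow> u k \<le> u (Suc k)"
    have uin: "u k \<in> {a..b}" if "k \<le> m" for k
      using partition_mono[of m u 0 k] partition_mono[of m u k m] u that rst by force
    have "(\<Sum>k<m. edist (u k) (u (Suc k))) \<le>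
        (\<Sum>k<m. edist (min (u k) s) (min (u (Suc k)) s)) + (\<Sum>k<m. edist (max (u k) s) (max (u (Suc k)) s))"
      by (rule partition_cut) (use u uin rst in auto)
    also have "\<dots> \<le> path_len \<gamma> r s + path_len \<gamma> s t"
    proof (rule add_mono)
      show "(\<Sum>k<m. edist (min (u k) s) (min (u (Suc k)) s)) \<le> path_len \<gamma> r s"
        by (rule path_len_upper[of "\<lambda>k. min (u k) s"]) (use u rst in \<open>auto simp: min_le_iff_disj\<close>)
      show "(\<Sum>k<m. edist (max (u k) s) (max (u (Suc k)) s)) \<le> path_len \<gamma> s t"
        by (rule path_len_upper[of "\<lambda>k. max (u k) s"]) (use u rst in \<open>auto intro: max.mono[OF u(3) order_refl] simp del: max.bounded_iff\<close>)
    qed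
    finally show "(\<Sum>k<m. edist (u k) (u (Suc k))) \<le> path_len \<gamma> r s + path_len \<gamma> s t" .
  qed
  show "path_len \<gamma> r s + path_len \<gamma> s t \<le> path_len \<gamma> r t"
  proof -
    let ?S = "\<lambda>(m::nat, t). \<Sum>k<m. edist (t k) (t (Suc k))"
    let ?I = "\<lambda>r s. {(m::nat, t). t 0 = r \<and> t m = s \<and> (\<forall>k<m. t k \<le> t (Suc k))} :: (nat \<times> (nat \<Rightarrow> real)) set"
    have "?S p + ?S q \<le> path_len \<gamma> r t" if pq: "p \<in> ?I r s" "q \<in> ?I s t" for p q
    proof -
      obtain m u where p: "p = (m, u)" "u 0 = r" "u m = s" "\<forall>k<m. u k \<le> u (Suc k)" using pq(1) by blast
      obtain n v where q: "q = (n, v)" "v 0 = s" "v n = t" "\<forall>k<n. v k \<le> v (Suc k)" using pq(2) by blast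
      \<comment> \<open>The index \<open>m\<close> belongs to both partitions, consistently because
        \<open>u m = s = v 0\<close>.\<close>
      define w where "w = (\<lambda>k. if k \<le> m then u k else v (k - m))"
      have wm: "w (m + k) = v k" for k
        using p q by (cases k) (auto simp: w_def)
      have wu: "w k = u k" if "k \<le> m" for k using that by (simp add: w_def)
      have "(\<Sum>k<m + n. edist (w k) (w (Suc k))) \<le> path_len \<gamma> r t"
      proof (rule path_len_upper)
        show "w 0 = r" using p by (simp add: w_def)
        show "w (m + n) = t" using q by (simp add: wm)
        fix k assume "k < m + n"
        show "w k \<le> w (Suc k)"
        proof (cases "k < m")
          case True
          then show ?thesis using p by (simp add: wu)
        next
          case False
          then have k: "k = m + (k - m)" "k - m < n" using \<open>k < m + n\<close> by auto
          have "w (Suc k) = v (Suc (k - m))" using wm[of "Suc (k - m)"] k(1) by simp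
          moreover have "w k = v (k - m)" using wm[of "k - m"] k(1) by simp
          ultimately show ?thesis using q k(2) by simp
        qed
      qed
      moreover have "(\<Sum>k<m. edist (w k) (w (Suc k))) = (\<Sum>k<m. edist (u k) (u (Suc k)))"
        by (intro sum.cong) (auto simp: wu)
      moreover have "(\<Sum>k<n. edist (w (m + k)) (w (Suc (m + k)))) = (\<Sum>k<n. edist (v k) (v (Suc k)))"
        using wm by (intro sum.cong) (auto simp: add_Suc_right[symmetric] simp del: add_Suc_right)
      ultimately show ?thesis unfolding p(1) q(1) by (simp add: sum_concat)
    qed
    then have *: "(SUP p\<in>?I r s. ?S p + ?S q) \<le> path_len \<gamma> r t" if "q \<in> ?I s t" for q
      using that by (intro SUP_least) blast
    have "path_len \<gamma> r s + ?S q \<le> path_len \<gamma> r t" if "q \<in> ?I s t" for q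
      using *[OF that] unfolding ennreal_SUP_add_left[OF partition_nonempty[OF rst(2)]] path_len_def[of \<gamma> r s] .
    then have "(SUP q\<in>?I s t. path_len \<gamma> r s + ?S q) \<le> path_len \<gamma> r t"
      by (rule SUP_least)
    then have "path_len \<gamma> r s + (SUP q\<in>?I s t. ?S q) \<le> path_len \<gamma> r t"
      unfolding ennreal_SUP_add_right[OF partition_nonempty[OF rst(3)]] .
    then show ?thesis unfolding path_len_def[of \<gamma> s t] .
  qed
qed

lemma path_len_mono:
  assumes "a \<le> r'" "r' \<le> r" "r \<le> s" "s \<le> s'" "s' \<le> b"
  shows "path_len \<gamma> r s \<le> path_len \<gamma> r' s'"
proof -
  have "path_len \<gamma> r s \<le> path_len \<gamma> r' r + path_len \<gamma> r s" by simp
  also have "\<dots> = path_len \<gamma> r' s" using path_len_add[of r' r s] assms by simp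
  also have "\<dots> \<le> path_len \<gamma> r' s + path_len \<gamma> s s'" by simp
  also have "\<dots> = path_len \<gamma> r' s'" using path_len_add[of r' s s'] assms by simp
  finally show ?thesis .
qed

text \<open>Steps of length \<open>\<eta> / 2\<close> and the triangle inequality extend the local
  bound to all pairs of parameters, and the sums over partitions then telescope.\<close>

lemma path_len_le_local:
  fixes N :: "real \<Rightarrow> real"
  assumes \<eta>: "0 < \<eta>"
    and loc: "\<And>s t. a \<le> s \<Longrightarrow> s \<le> t \<Longrightarrow> t \<le> b \<Longrightarrow> t - s < \<eta> \<Longrightarrow> orbit_dist (\<gamma> s) (\<gamma> t) \<le> N t - N s"
  shows "path_len \<gamma> a b \<le> ennreal (N b - N a)"
proof -
  have *: "a \<le> s \<Longrightarrow> s \<le> t \<Longrightarrow> t \<le> b \<Longrightarrow> t - s < real m * (\<eta> / 2) \<Longrightarrow> orbit_dist (\<gamma> s) (\<gamma> t) \<le> N t - N s" for m s t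
  proof (induction m arbitrary: s)
    case (Suc m)
    define u where "u = min t (s + \<eta> / 2)"
    have u: "s \<le> u" "u \<le> t" "u - s < \<eta>" using Suc.prems \<eta> by (auto simp: u_def)
    have 1: "orbit_dist (\<gamma> s) (\<gamma> u) \<le> N u - N s" using loc[of s u] u Suc.prems by auto
    have 2: "orbit_dist (\<gamma> u) (\<gamma> t) \<le> N t - N u"
    proof (cases "u = t")
      case True
      then show ?thesis using loc[of t t] Suc.prems \<eta> by simp
    next
      case False
      then have "u = s + \<eta> / 2" by (auto simp: u_def min_def split: if_splits)
      then have "t - u < real m * (\<eta> / 2)" using Suc.prems(4) by (simp add: algebra_simps)
      then show ?thesis using Suc.IH[of u] u Suc.prems by auto
    qed
    have "orbit_dist (\<gamma> s) (\<gamma> t) \<le> orbit_dist (\<gamma> s) (\<gamma> u) + orbit_dist (\<gamma> u) (\<gamma> t)"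
      by (rule dist_triangle) (use u Suc.prems in auto)
    then show ?case using 1 2 by simp
  qed simp
  have glob: "orbit_dist (\<gamma> s) (\<gamma> t) \<le> N t - N s" if "a \<le> s" "s \<le> t" "t \<le> b" for s t
  proof -
    obtain m :: nat where "t - s < real m * (\<eta> / 2)"
      using ex_less_of_nat_mult[of "\<eta> / 2" "t - s"] \<eta> by auto
    then show ?thesis using * that by blast
  qed
  show ?thesis
  proof (rule path_len_least)
    fix m and t :: "nat \<Rightarrow> real" assume t: "t 0 = a" "t m = b" "\<And>k. k < m \<Longrightarrow> t k \<le> t (Suc k)"
    have tin: "t k \<in> {a..b}" if "k \<le> m" for k
      using partition_mono[of m t 0 k] partition_mono[of m t k m] t that by force
    have step: "orbit_dist (\<gamma> (t k)) (\<gamma> (t (Suc k))) \<le> N (t (Suc k)) - N (t k)" if "k < m" for k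
      using tin[of k] tin[of "Suc k"] t(3) that by (intro glob) auto
    have nn: "0 \<le> N (t (Suc k)) - N (t k)" if "k < m" for k
    proof -
      have "0 \<le> orbit_dist (\<gamma> (t k)) (\<gamma> (t (Suc k)))"
        by (rule dist_nonneg) (use tin[of k] tin[of "Suc k"] that in \<open>simp_all del: atLeastAtMost_iff\<close>)
      then show ?thesis using step[OF that] by linarith
    qed
    have "(\<Sum>k<m. edist (t k) (t (Suc k))) \<le> (\<Sum>k<m. ennreal (N (t (Suc k)) - N (t k)))"
      by (rule sum_mono) (use step in \<open>auto intro: ennreal_leI\<close>)
    also have "\<dots> = ennreal (\<Sum>k<m. N (t (Suc k)) - N (t k))"
      using nn by (intro sum_ennreal) auto
    also have "(\<Sum>k<m. N (t (Suc k)) - N (t k)) = N b - N a"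
      using sum_lessThan_telescope[of "\<lambda>k. N (t k)" m] t by simp
    finally show "(\<Sum>k<m. edist (t k) (t (Suc k))) \<le> ennreal (N b - N a)" .
  qed
qed

end

locale rect_curve = orbit_curve +
  assumes len_finite: "path_len \<gamma> a b < \<infinity>"
begin

lemma path_len_finite: "a \<le> s \<Longrightarrow> s \<le> t \<Longrightarrow> t \<le> b \<Longrightarrow> path_len \<gamma> s t < \<infinity>"
  using path_len_mono[of a s t b] len_finite by (meson le_less_trans order_refl)

text \<open>Of a partition with \<open>m\<close> steps that almost realizes the total length, at most \<open>m\<close> short steps fall
  into a short interval, so only little length is left for that interval.\<close>

lemma path_len_small:
  assumes \<epsilon>: "0 < \<epsilon>"
  shows "\<exists>\<delta>>0. \<forall>s u. a \<le> s \<longrightarrow> s \<le> u \<longrightarrow> u \<le> b \<longrightarrow> u - s < \<delta> \<longrightarrow> path_len \<gamma> s u < ennreal \<epsilon>"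
proof -
  let ?I = "{(m::nat, t). t 0 = a \<and> t m = b \<and> (\<forall>k<m. t k \<le> t (Suc k))} :: (nat \<times> (nat \<Rightarrow> real)) set"
  have "\<exists>p\<in>?I. path_len \<gamma> a b < (\<lambda>(m, t). \<Sum>k<m. edist (t k) (t (Suc k))) p + ennreal (\<epsilon> / 2)"
  proof (rule SUP_approx_ennreal)
    show "0 < \<epsilon> / 2" using \<epsilon> by simp
    show "?I \<noteq> {}" by (rule partition_nonempty[OF ab])
    show "path_len \<gamma> a b = (SUP p\<in>?I. (\<lambda>(m, t). \<Sum>k<m. edist (t k) (t (Suc k))) p)"
      unfolding path_len_def ..
    show "path_len \<gamma> a b \<noteq> \<infinity>" using len_finite by simp
  qed
  then obtain m t where t: "t 0 = a" "t m = b" "\<And>k. k < m \<Longrightarrow> t k \<le> t (Suc k)"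
    and near: "path_len \<gamma> a b < (\<Sum>k<m. edist (t k) (t (Suc k))) + ennreal (\<epsilon> / 2)"
    by auto
  have tin: "t k \<in> {a..b}" if "k \<le> m" for k
    using partition_mono[of m t 0 k] partition_mono[of m t k m] t that by force
  \<comment> \<open>Up to \<open>m\<close> steps of size \<open>\<omega>\<close> add up to at most
    \<open>\<epsilon> / 2\<close>; the added 1 covers \<open>m = 0\<close>.\<close>
  define \<omega> where "\<omega> = \<epsilon> / (2 * (real m + 1))"
  have \<omega>: "0 < \<omega>" using \<epsilon> by (simp add: \<omega>_def)
  obtain \<delta> where \<delta>: "\<delta> > 0" "\<And>x y. x \<in> {a..b} \<Longrightarrow> y \<in> {a..b} \<Longrightarrow> \<bar>x - y\<bar> < \<delta> \<Longrightarrow> orbit_dist (\<gamma> x) (\<gamma> y) < \<omega>"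
    using dist_uniform[OF \<omega>] by blast
  have "path_len \<gamma> s u < ennreal \<epsilon>" if su: "a \<le> s" "s \<le> u" "u \<le> b" "u - s < \<delta>" for s u
  proof -
    define v where "v = (\<lambda>k. min (t k) u)"
    have v: "v k \<le> v (Suc k)" if "k < m" for k using t(3)[OF that] by (auto simp: v_def min_le_iff_disj)
    have vin: "v k \<in> {a..b}" if "k \<le> m" for k using tin[OF that] su by (auto simp: v_def)
    let ?A = "\<Sum>k<m. edist (min (v k) s) (min (v (Suc k)) s)"
    let ?C = "\<Sum>k<m. edist (max (v k) s) (max (v (Suc k)) s)"
    let ?B = "\<Sum>k<m. edist (max (t k) u) (max (t (Suc k)) u)"
    have "(\<Sum>k<m. edist (t k) (t (Suc k))) \<le> (\<Sum>k<m. edist (v k) (v (Suc k))) + ?B"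
      unfolding v_def by (rule partition_cut) (use t tin su in auto)
    also have "(\<Sum>k<m. edist (v k) (v (Suc k))) \<le> ?A + ?C"
      by (rule partition_cut) (use v vin su in auto)
    finally have sum: "(\<Sum>k<m. edist (t k) (t (Suc k))) \<le> ?A + ?C + ?B" by (simp add: add_mono)
    have A: "?A \<le> path_len \<gamma> a s"
      by (rule path_len_upper[of "\<lambda>k. min (v k) s"]) (use t su v ab in \<open>auto simp: v_def min_le_iff_disj\<close>)
    have B: "?B \<le> path_len \<gamma> u b"
      by (rule path_len_upper[of "\<lambda>k. max (t k) u"]) (use t su ab in \<open>auto intro: max.mono[OF t(3) order_refl] simp del: max.bounded_iff\<close>)
    have C: "?C \<le> ennreal (\<epsilon> / 2)"
    proof -
      have in_su: "max (v k) s \<in> {s..u}" for k using su by (auto simp: v_def)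
      have "edist (max (v k) s) (max (v (Suc k)) s) \<le> ennreal \<omega>" for k
      proof -
        have "orbit_dist (\<gamma> (max (v k) s)) (\<gamma> (max (v (Suc k)) s)) < \<omega>"
          by (rule \<delta>(2)) (use in_su[of k] in_su[of "Suc k"] su in auto)
        then show ?thesis by (intro ennreal_leI) simp
      qed
      then have "?C \<le> (\<Sum>k<m. ennreal \<omega>)" by (intro sum_mono) auto
      also have "\<dots> = ennreal (real m * \<omega>)" using \<omega> by (simp add: ennreal_mult ennreal_of_nat_eq_real_of_nat)
      also have "real m * \<omega> \<le> \<epsilon> / 2" using \<epsilon> by (simp add: \<omega>_def field_simps)
      finally show ?thesis by (simp add: ennreal_leI)
    qed
    have "path_len \<gamma> a b = path_len \<gamma> a s + path_len \<gamma> s b" using path_len_add[of a s b] su by simp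
    also have "path_len \<gamma> s b = path_len \<gamma> s u + path_len \<gamma> u b" using path_len_add[of s u b] su by simp
    finally have split: "path_len \<gamma> a b = (path_len \<gamma> a s + path_len \<gamma> u b) + path_len \<gamma> s u"
      by (simp add: ac_simps)
    have "path_len \<gamma> a b < ?A + ?C + ?B + ennreal (\<epsilon> / 2)"
      using near sum by (meson add_right_mono less_le_trans)
    also have "\<dots> \<le> path_len \<gamma> a s + ennreal (\<epsilon> / 2) + path_len \<gamma> u b + ennreal (\<epsilon> / 2)"
      using A B C by (intro add_mono) auto
    also have "\<dots> = (path_len \<gamma> a s + path_len \<gamma> u b) + ennreal \<epsilon>"
    proof -
      have "ennreal (\<epsilon> / 2) + ennreal (\<epsilon> / 2) = ennreal \<epsilon>"
        using \<epsilon> by (simp add: ennreal_plus[symmetric] del: ennreal_plus)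
      then show ?thesis by (metis add.assoc add.commute)
    qed
    finally show ?thesis unfolding split by (metis ennreal_add_left_cancel_less)
  qed
  then show ?thesis using \<delta>(1) by blast
qed

section \<open>Arc length and its measure on the parameter interval\<close>

definition len :: "real \<Rightarrow> real" where
  "len t = enn2real (path_len \<gamma> a t)"

lemma path_len_len: "a \<le> s \<Longrightarrow> s \<le> t \<Longrightarrow> t \<le> b \<Longrightarrow> path_len \<gamma> s t = ennreal (len t - len s)"
proof -
  assume st: "a \<le> s" "s \<le> t" "t \<le> b"
  have f: "path_len \<gamma> a s < \<infinity>" "path_len \<gamma> s t < \<infinity>" "path_len \<gamma> a t < \<infinity>"
    using path_len_finite st by auto
  have "path_len \<gamma> a t = path_len \<gamma> a s + path_len \<gamma> s t" using path_len_add[of a s t] st by simp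
  then have "len t = len s + enn2real (path_len \<gamma> s t)"
    unfolding len_def using f by (simp add: enn2real_plus)
  then show ?thesis using f by simp
qed

lemma len_a: "len a = 0"
  using path_len_self[of a] ab by (simp add: len_def)

lemma len_mono: "a \<le> s \<Longrightarrow> s \<le> t \<Longrightarrow> t \<le> b \<Longrightarrow> len s \<le> len t"
  unfolding len_def using path_len_mono[of a a s t] path_len_finite[of a t]
  by (intro enn2real_mono) auto

lemma len_nonneg: "0 \<le> len t"
  by (simp add: len_def)

lemma len_continuous: "continuous_on {a..b} len"
  unfolding continuous_on_iff
proof (intro ballI allI impI)
  fix x \<epsilon> :: real assume x: "x \<in> {a..b}" and \<epsilon>: "0 < \<epsilon>"
  obtain \<delta> where \<delta>: "\<delta> > 0" "\<And>s u. a \<le> s \<Longrightarrow> s \<le> u \<Longrightarrow> u \<le> b \<Longrightarrow> u - s < \<delta> \<Longrightarrow> path_len \<gamma> s u < ennreal \<epsilon>"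
    using path_len_small[OF \<epsilon>] by blast
  have small: "len u - len s < \<epsilon>" if "a \<le> s" "s \<le> u" "u \<le> b" "u - s < \<delta>" for s u
    using \<delta>(2)[OF that] path_len_len[of s u] that \<epsilon> by (simp add: ennreal_less_iff len_mono)
  have "dist (len y) (len x) < \<epsilon>" if "y \<in> {a..b}" "dist y x < \<delta>" for y
  proof (cases "y \<le> x")
    case True
    then show ?thesis using small[of y x] len_mono[of y x] that x by (auto simp: dist_real_def)
  next
    case False
    then show ?thesis using small[of x y] len_mono[of x y] that x by (auto simp: dist_real_def)
  qed
  then show "\<exists>d>0. \<forall>y\<in>{a..b}. dist y x < d \<longrightarrow> dist (len y) (len x) < \<epsilon>"
    using \<delta>(1) by blast
qed

text \<open>The choice made in \<open>normal_rep\<close> as a function on its own: a right inverse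
  of \<open>len\<close> on \<open>{0..len b}\<close>.\<close>

definition len_inv :: "real \<Rightarrow> real" where
  "len_inv s = (SOME t. t \<in> {a..b} \<and> enn2real (path_len \<gamma> a t) = s)"

lemma normal_rep_eq: "normal_rep \<gamma> a b s = \<gamma> (len_inv s)"
  by (simp add: normal_rep_def len_inv_def)

lemma len_inv:
  assumes "s \<in> {0..len b}"
  shows "len_inv s \<in> {a..b}" "len (len_inv s) = s"
proof -
  have "\<exists>t\<ge>a. t \<le> b \<and> len t = s"
    by (rule IVT'[OF _ _ ab len_continuous]) (use assms len_a in auto)
  then have "\<exists>t. t \<in> {a..b} \<and> enn2real (path_len \<gamma> a t) = s" by (auto simp: len_def)
  from someI_ex[OF this] show "len_inv s \<in> {a..b}" "len (len_inv s) = s"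
    unfolding len_inv_def[symmetric] len_def by blast+
qed

text \<open>A right inverse of a monotone function is monotone whatever choices are made; this
  yields its Borel measurability.\<close>

lemma len_inv_mono: "mono_on {0..len b} len_inv"
proof (rule mono_onI)
  fix r s assume rs: "r \<in> {0..len b}" "s \<in> {0..len b}" "r \<le> s"
  show "len_inv r \<le> len_inv s"
  proof (rule ccontr)
    assume neg: "\<not> ?thesis"
    then have "len (len_inv s) \<le> len (len_inv r)"
      using len_mono[of "len_inv s" "len_inv r"] len_inv(1)[OF rs(1)] len_inv(1)[OF rs(2)] by simp
    then have "r = s" using len_inv(2)[OF rs(1)] len_inv(2)[OF rs(2)] rs(3) by simp
    then show False using neg by simp
  qed
qed

text \<open>The length spent in a set of parameters, that is, the Stieltjes measure of
  \<open>len\<close>. Pushing Lebesgue measure to the parameters puts a path and its image on the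
  same line.\<close>

definition len_measure :: "real measure" where
  "len_measure = distr (restrict_space lborel {0..len b}) borel len_inv"

lemma sets_len_measure [measurable_cong, simp]: "sets len_measure = sets borel"
  by (simp add: len_measure_def)

lemma space_len_measure [simp]: "space len_measure = UNIV"
  by (simp add: len_measure_def)

lemma len_inv_measurable: "len_inv \<in> restrict_space lborel {0..len b} \<rightarrow>\<^sub>M borel"
proof -
  have "len_inv \<in> borel_measurable (restrict_space borel {0..len b})"
    by (rule borel_measurable_mono_on_fnc[OF len_inv_mono])
  then show ?thesis
    by (simp cong: measurable_cong_sets add: sets_restrict_space_cong[OF sets_lborel])
qed

lemma emeasure_len_measure:
  assumes "B \<in> sets borel"
  shows "emeasure len_measure B = emeasure lborel (len_inv -` B \<inter> {0..len b})"
  and "len_inv -` B \<inter> {0..len b} \<in> sets borel"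
proof -
  have sp: "space (restrict_space lborel {0..len b}) = {0..len b}" by (simp add: space_restrict_space)
  have m: "len_inv -` B \<inter> {0..len b} \<in> sets (restrict_space lborel {0..len b})"
    using measurable_sets[OF len_inv_measurable assms] by (simp only: sp)
  then show "len_inv -` B \<inter> {0..len b} \<in> sets borel"
    by (subst (asm) sets_restrict_space_iff) auto
  have "emeasure len_measure B = emeasure (restrict_space lborel {0..len b}) (len_inv -` B \<inter> {0..len b})"
    unfolding len_measure_def using emeasure_distr[OF len_inv_measurable assms] by (simp only: sp)
  also have "\<dots> = emeasure lborel (len_inv -` B \<inter> {0..len b})"
    by (rule emeasure_restrict_space) auto
  finally show "emeasure len_measure B = emeasure lborel (len_inv -` B \<inter> {0..len b})" .
qed

lemma len_measure_outside: "emeasure len_measure (- {a..b}) = 0"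
proof -
  have "len_inv -` (- {a..b}) \<inter> {0..len b} = {}" using len_inv(1) by blast
  then show ?thesis by (simp add: emeasure_len_measure)
qed

text \<open>The preimage of \<open>{s..t}\<close> under \<open>len_inv\<close> lies between the open
  and the closed interval from \<open>len s\<close> to \<open>len t\<close>; at the end points the
  choice in \<open>len_inv\<close> is not controlled.\<close>

lemma len_measure_interval:
  assumes st: "a \<le> s" "s \<le> t" "t \<le> b"
  shows "emeasure len_measure {s..t} = path_len \<gamma> s t"
proof -
  let ?V = "len_inv -` {s..t} \<inter> {0..len b}"
  have ls: "0 \<le> len s" "len s \<le> len t" "len t \<le> len b"
    using len_mono[of a s] len_mono[of s t] len_mono[of t b] len_a st by auto
  have 1: "{len s<..<len t} \<subseteq> ?V"
  proof
    fix x assume x: "x \<in> {len s<..<len t}"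
    then have x': "x \<in> {0..len b}" using ls by auto
    have "s \<le> len_inv x"
    proof (rule ccontr)
      assume "\<not> ?thesis"
      then have "len (len_inv x) \<le> len s" using len_mono[of "len_inv x" s] len_inv(1)[OF x'] st by auto
      then show False using x len_inv(2)[OF x'] by simp
    qed
    moreover have "len_inv x \<le> t"
    proof (rule ccontr)
      assume "\<not> ?thesis"
      then have "len t \<le> len (len_inv x)" using len_mono[of t "len_inv x"] len_inv(1)[OF x'] st by auto
      then show False using x len_inv(2)[OF x'] by simp
    qed
    ultimately show "x \<in> ?V" using x' by simp
  qed
  have 2: "?V \<subseteq> {len s..len t}"
  proof
    fix x assume x: "x \<in> ?V"
    then have "len s \<le> len (len_inv x)" "len (len_inv x) \<le> len t"
      using len_mono[of s "len_inv x"] len_mono[of "len_inv x" t] st by auto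
    then show "x \<in> {len s..len t}" using len_inv(2)[of x] x by simp
  qed
  have "emeasure lborel ?V = ennreal (len t - len s)"
  proof (rule antisym)
    show "emeasure lborel ?V \<le> ennreal (len t - len s)"
      using emeasure_mono[OF 2, of lborel] ls by simp
    show "ennreal (len t - len s) \<le> emeasure lborel ?V"
      using emeasure_mono[OF 1, of lborel] emeasure_len_measure(2)[of "{s..t}"] ls by simp
  qed
  then show ?thesis using path_len_len[OF st] by (simp add: emeasure_len_measure)
qed

lemma finite_len_measure: "finite_measure len_measure"
proof
  have "emeasure len_measure (space len_measure) \<le> emeasure lborel {0..len b}"
    by (simp add: emeasure_len_measure)
  also have "\<dots> < \<infinity>" using len_nonneg[of b] by simp
  finally show "emeasure len_measure (space len_measure) \<noteq> \<infinity>" by simp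
qed

lemma len_measure_singleton: "s \<in> {a..b} \<Longrightarrow> emeasure len_measure {s} = 0"
  using len_measure_interval[of s s] path_len_self[of s] by simp

lemma len_measure_half_open:
  assumes st: "a \<le> s" "s \<le> t" "t \<le> b"
  shows "emeasure len_measure {s<..t} = path_len \<gamma> s t"
proof -
  have "{s} \<in> null_sets len_measure" using len_measure_singleton[of s] st by (auto intro: null_setsI)
  then have "emeasure len_measure ({s<..t} \<union> {s}) = emeasure len_measure {s<..t}"
    by (rule emeasure_Un_null_set[rotated]) simp
  moreover have "{s<..t} \<union> {s} = {s..t}" using st by auto
  ultimately show ?thesis using len_measure_interval[OF st] by simp
qed

text \<open>The normal representation is \<open>\<gamma>\<close> composed with
  \<open>len_inv\<close>, so this is the transfer rule for an image measure.\<close>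

lemma nn_integral_normal_rep:
  assumes "(\<lambda>t. \<rho> (\<gamma> t) * indicator {a..b} t) \<in> borel_measurable borel"
  shows "(\<integral>\<^sup>+s\<in>{0..enn2real (path_len \<gamma> a b)}. \<rho> (normal_rep \<gamma> a b s) \<partial>lborel) =
    (\<integral>\<^sup>+t. \<rho> (\<gamma> t) * indicator {a..b} t \<partial>len_measure)"
proof -
  have "(\<integral>\<^sup>+t. \<rho> (\<gamma> t) * indicator {a..b} t \<partial>len_measure) =
      (\<integral>\<^sup>+s. \<rho> (\<gamma> (len_inv s)) * indicator {a..b} (len_inv s) \<partial>restrict_space lborel {0..len b})"
    unfolding len_measure_def by (rule nn_integral_distr[OF len_inv_measurable]) (use assms in simp)
  also have "\<dots> = (\<integral>\<^sup>+s. \<rho> (\<gamma> (len_inv s)) * indicator {a..b} (len_inv s) * indicator {0..len b} s \<partial>lborel)"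
    by (rule nn_integral_restrict_space) simp
  also have "\<dots> = (\<integral>\<^sup>+s. \<rho> (normal_rep \<gamma> a b s) * indicator {0..len b} s \<partial>lborel)"
    by (intro nn_integral_cong) (use len_inv(1) in \<open>auto simp: indicator_def normal_rep_eq\<close>)
  finally show ?thesis by (simp add: len_def)
qed

lemma len_measure_inner:
  "B \<in> sets borel \<Longrightarrow> emeasure len_measure B = (SUP K \<in> {K. K \<subseteq> B \<and> compact K}. emeasure len_measure K)"
  using finite_measure.emeasure_finite[OF finite_len_measure] by (intro inner_regular) auto

lemma len_measure_outer:
  "B \<in> sets borel \<Longrightarrow> emeasure len_measure B = (INF U \<in> {U. B \<subseteq> U \<and> open U}. emeasure len_measure U)"
  using finite_measure.emeasure_finite[OF finite_len_measure] by (intro outer_regular) auto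

end

section \<open>Comparison of arc length measures\<close>

context rect_curve
begin

lemma len_measure_eq_ennreal: "emeasure len_measure B = ennreal (measure len_measure B)"
  by (rule finite_measure.emeasure_eq_measure[OF finite_len_measure])

lemma measure_half_open:
  "a \<le> s \<Longrightarrow> s \<le> t \<Longrightarrow> t \<le> b \<Longrightarrow> measure len_measure {s<..t} = len t - len s"
  using len_measure_half_open[of s t] path_len_len[of s t] len_mono[of s t] by (simp add: measure_def)

lemma measure_closed:
  "a \<le> s \<Longrightarrow> s \<le> t \<Longrightarrow> t \<le> b \<Longrightarrow> measure len_measure {s..t} = len t - len s"
  using len_measure_interval[of s t] path_len_len[of s t] len_mono[of s t] by (simp add: measure_def)

lemma dist_le_len: "a \<le> s \<Longrightarrow> s \<le> t \<Longrightarrow> t \<le> b \<Longrightarrow> orbit_dist (\<gamma> s) (\<gamma> t) \<le> len t - len s"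
  using edist_le_path_len[of s t] path_len_len[of s t] len_mono[of s t] by (simp add: ennreal_le_iff)

end

lemma compact_cover_radius:
  fixes K :: "real set"
  assumes "compact K" "open U" "K \<subseteq> U"
  obtains e where "e > 0" "\<And>x y. x \<in> K \<Longrightarrow> \<bar>y - x\<bar> < e \<Longrightarrow> y \<in> U"
proof -
  obtain e where e: "e > 0" "(\<Union>x\<in>K. ball x e) \<subseteq> U"
    using compact_subset_open_imp_ball_epsilon_subset[OF assms] by blast
  show ?thesis
  proof (rule that[OF e(1)])
    fix x y assume "x \<in> K" "\<bar>y - x\<bar> < e"
    then have "x \<in> K" "y \<in> ball x e" by (simp_all add: dist_real_def abs_minus_commute)
    then have "y \<in> (\<Union>x\<in>K. ball x e)" by blast
    then show "y \<in> U" using e(2) by blast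
  qed
qed

text \<open>On a short interval meeting \<open>K\<close> the length of the second curve is controlled by the first
  one, elsewhere by itself; so its length is at most the increment of \<open>N\<close> below.\<close>

lemma len_measure_compare_compact:
  assumes P: "rect_curve \<gamma> a b" and P': "rect_curve \<gamma>' a b"
    and K: "compact K" "K \<subseteq> {a..b}" and c: "0 \<le> c" and \<eta>: "0 < \<eta>"
    and near: "\<And>u s. u \<in> K \<Longrightarrow> s \<in> {a..b} \<Longrightarrow> \<bar>s - u\<bar> < \<eta> \<Longrightarrow>
      orbit_dist (\<gamma>' s) (\<gamma>' u) \<le> c * orbit_dist (\<gamma> s) (\<gamma> u)"
  shows "emeasure (rect_curve.len_measure \<gamma>' a b) K \<le> ennreal c * emeasure (rect_curve.len_measure \<gamma> a b) K"
proof -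
  interpret P: rect_curve \<gamma> a b by (rule P)
  interpret P': rect_curve \<gamma>' a b by (rule P')
  interpret M: finite_measure P.len_measure by (rule P.finite_len_measure)
  interpret M': finite_measure P'.len_measure by (rule P'.finite_len_measure)
  have Kb: "K \<in> sets borel" using K(1) by (simp add: borel_compact)
  have main: "measure P'.len_measure K \<le> c * measure P.len_measure U" if U: "open U" "K \<subseteq> U" for U
  proof -
    have Ub: "U \<in> sets borel" using U(1) by simp
    obtain e where e: "e > 0" "\<And>x y. x \<in> K \<Longrightarrow> \<bar>y - x\<bar> < e \<Longrightarrow> y \<in> U"
      using compact_cover_radius[OF K(1) U] by metis
    define N where "N = (\<lambda>t. c * measure P.len_measure (U \<inter> {a..t}) + measure P'.len_measure ({a..t} - K))"
    have incr: "N t - N s = c * measure P.len_measure (U \<inter> {s<..t}) + measure P'.len_measure ({s<..t} - K)"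
      if st: "a \<le> s" "s \<le> t" for s t
    proof -
      have "measure P.len_measure ((U \<inter> {a..s}) \<union> (U \<inter> {s<..t})) =
          measure P.len_measure (U \<inter> {a..s}) + measure P.len_measure (U \<inter> {s<..t})"
        by (rule M.finite_measure_Union) (use Ub in auto)
      moreover have "(U \<inter> {a..s}) \<union> (U \<inter> {s<..t}) = U \<inter> {a..t}" using st by auto
      moreover have "measure P'.len_measure (({a..s} - K) \<union> ({s<..t} - K)) =
          measure P'.len_measure ({a..s} - K) + measure P'.len_measure ({s<..t} - K)"
        by (rule M'.finite_measure_Union) (use Kb in auto)
      moreover have "({a..s} - K) \<union> ({s<..t} - K) = {a..t} - K" using st by auto
      ultimately show ?thesis by (simp add: N_def distrib_left)
    qed
    \<comment> \<open>The bound \<open>\<eta>\<close> is for \<open>near\<close>; the bound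
      \<open>e\<close> puts every interval that meets \<open>K\<close> inside
      \<open>U\<close>.\<close>
    have loc: "orbit_dist (\<gamma>' s) (\<gamma>' t) \<le> N t - N s"
      if st: "a \<le> s" "s \<le> t" "t \<le> b" "t - s < min \<eta> e" for s t
    proof (cases "\<exists>u\<in>K. u \<in> {s..t}")
      case True
      then obtain u where u: "u \<in> K" "s \<le> u" "u \<le> t" by auto
      have sub: "U \<inter> {s<..t} = {s<..t}"
        using e(2)[OF u(1)] u st by auto
      have "orbit_dist (\<gamma>' s) (\<gamma>' t) \<le> orbit_dist (\<gamma>' s) (\<gamma>' u) + orbit_dist (\<gamma>' t) (\<gamma>' u)"
        using P'.dist_triangle[of s u t] u st by (simp add: orbit_dist_sym[of "\<gamma>' t"])
      also have "\<dots> \<le> c * orbit_dist (\<gamma> s) (\<gamma> u) + c * orbit_dist (\<gamma> t) (\<gamma> u)"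
        by (intro add_mono near) (use u st in auto)
      also have "\<dots> = c * (orbit_dist (\<gamma> s) (\<gamma> u) + orbit_dist (\<gamma> u) (\<gamma> t))"
        by (simp add: distrib_left orbit_dist_sym[of "\<gamma> t"])
      also have "\<dots> \<le> c * ((P.len u - P.len s) + (P.len t - P.len u))"
        by (intro mult_left_mono add_mono P.dist_le_len c) (use u st in auto)
      also have "\<dots> = c * measure P.len_measure (U \<inter> {s<..t})"
        unfolding sub using P.measure_half_open[of s t] st by simp
      also have "\<dots> \<le> N t - N s" using incr[of s t] st by simp
      finally show ?thesis .
    next
      case False
      then have sub: "{s<..t} - K = {s<..t}" by auto
      have "orbit_dist (\<gamma>' s) (\<gamma>' t) \<le> P'.len t - P'.len s" by (rule P'.dist_le_len[OF st(1-3)])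
      also have "\<dots> = measure P'.len_measure ({s<..t} - K)"
        unfolding sub using P'.measure_half_open[of s t] st by simp
      also have "\<dots> \<le> N t - N s" using incr[of s t] st c by simp
      finally show ?thesis .
    qed
    have "path_len \<gamma>' a b \<le> ennreal (N b - N a)"
      by (rule P'.path_len_le_local[of "min \<eta> e"]) (use \<eta> e(1) loc in auto)
    moreover have "path_len \<gamma>' a b = ennreal (measure P'.len_measure {a..b})"
      using P'.len_measure_interval[of a b] P.ab P'.len_measure_eq_ennreal by simp
    moreover have "0 \<le> N b - N a" using incr[of a b] P.ab c by simp
    ultimately have le: "measure P'.len_measure {a..b} \<le> N b - N a" by (simp add: ennreal_le_iff)
    have "0 \<le> N a" by (simp add: N_def c)
    then have "measure P'.len_measure {a..b} \<le> c * measure P.len_measure (U \<inter> {a..b}) + measure P'.len_measure ({a..b} - K)"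
      using le by (simp add: N_def)
    \<comment> \<open>The length of the second curve outside \<open>K\<close> now occurs on both
      sides; subtracting it, which finiteness permits, leaves the bound for
      \<open>K\<close>.\<close>
    moreover have "measure P'.len_measure ({a..b} - K) = measure P'.len_measure {a..b} - measure P'.len_measure K"
      by (rule M'.finite_measure_Diff) (use Kb K(2) in auto)
    ultimately have "measure P'.len_measure K \<le> c * measure P.len_measure (U \<inter> {a..b})" by simp
    also have "\<dots> \<le> c * measure P.len_measure U"
      by (intro mult_left_mono c M.finite_measure_mono) (use Ub in auto)
    finally show ?thesis .
  qed
  have "measure P'.len_measure K \<le> c * measure P.len_measure K"
  proof (rule field_le_epsilon)
    fix \<epsilon> :: real assume \<epsilon>: "0 < \<epsilon>"
    \<comment> \<open>The denominator \<open>c + 1\<close> ensures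
      \<open>c * \<delta> \<le> \<epsilon>\<close> and stays positive for
      \<open>c = 0\<close>.\<close>
    define \<delta> where "\<delta> = \<epsilon> / (c + 1)"
    have \<delta>: "0 < \<delta>" using \<epsilon> c by (simp add: \<delta>_def)
    have "emeasure P.len_measure K < emeasure P.len_measure K + ennreal \<delta>"
      using \<delta> by (simp add: P.len_measure_eq_ennreal ennreal_plus[symmetric] ennreal_less_iff del: ennreal_plus)
    then have "(INF U \<in> {U. K \<subseteq> U \<and> open U}. emeasure P.len_measure U) < emeasure P.len_measure K + ennreal \<delta>"
      using P.len_measure_outer[OF Kb] by simp
    then obtain U where U: "K \<subseteq> U" "open U" "emeasure P.len_measure U < emeasure P.len_measure K + ennreal \<delta>"
      unfolding INF_less_iff by blast
    then have "measure P.len_measure U < measure P.len_measure K + \<delta>"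
      using \<delta> by (simp add: P.len_measure_eq_ennreal ennreal_plus[symmetric] ennreal_less_iff del: ennreal_plus)
    then have "c * measure P.len_measure U \<le> c * (measure P.len_measure K + \<delta>)"
      using c by (intro mult_left_mono) auto
    also have "\<dots> \<le> c * measure P.len_measure K + \<epsilon>"
      using c \<epsilon> by (simp add: \<delta>_def distrib_left field_simps)
    finally show "measure P'.len_measure K \<le> c * measure P.len_measure K + \<epsilon>"
      using main[OF U(2,1)] by simp
  qed
  then show ?thesis
    using c by (simp add: P.len_measure_eq_ennreal P'.len_measure_eq_ennreal ennreal_mult[symmetric] ennreal_leI)
qed

text \<open>Inner regularity of the second measure reduces the Borel set \<open>B\<close> to its
  compact subsets.\<close>

lemma len_measure_compare:
  assumes P: "rect_curve \<gamma> a b" and P': "rect_curve \<gamma>' a b"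
    and S: "S \<subseteq> {a..b}" and c: "0 \<le> c" and \<eta>: "0 < \<eta>"
    and near: "\<And>u s. u \<in> S \<Longrightarrow> s \<in> {a..b} \<Longrightarrow> \<bar>s - u\<bar> < \<eta> \<Longrightarrow>
      orbit_dist (\<gamma>' s) (\<gamma>' u) \<le> c * orbit_dist (\<gamma> s) (\<gamma> u)"
    and B: "B \<in> sets borel" "B \<subseteq> S"
  shows "emeasure (rect_curve.len_measure \<gamma>' a b) B \<le> ennreal c * emeasure (rect_curve.len_measure \<gamma> a b) B"
proof -
  interpret P: rect_curve \<gamma> a b by (rule P)
  interpret P': rect_curve \<gamma>' a b by (rule P')
  have "emeasure P'.len_measure K \<le> ennreal c * emeasure P.len_measure B" if K: "K \<subseteq> B" "compact K" for K
  proof -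
    have "emeasure P'.len_measure K \<le> ennreal c * emeasure P.len_measure K"
      by (rule len_measure_compare_compact[OF P P' K(2) _ c \<eta>]) (use K B S near in auto)
    also have "\<dots> \<le> ennreal c * emeasure P.len_measure B"
      using K B by (intro mult_left_mono emeasure_mono) auto
    finally show ?thesis .
  qed
  then show ?thesis
    unfolding P'.len_measure_inner[OF B(1)] by (intro SUP_least) blast
qed

lemma grid_cell:
  fixes t :: "nat \<Rightarrow> real"
  assumes "t 0 \<le> x" "x \<le> t m" "0 < m"
  shows "\<exists>k<m. t k \<le> x \<and> x \<le> t (Suc k)"
  using assms(2,3)
proof (induction m)
  case (Suc m)
  show ?case
  proof (cases "x \<le> t m \<and> 0 < m")
    case True
    then show ?thesis using Suc.IH less_SucI by blast
  next
    case False
    then have "t m \<le> x" using assms(1) by auto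
    then show ?thesis using Suc.prems by blast
  qed
qed simp

text \<open>A compact null set of the first measure lies in an open set of small measure, hence in
  finitely many cells of a fine grid whose total first length is small; the hypothesis makes their
  second length small. Inner regularity extends this to all null sets. The shift
  \<open>\<sigma>\<close> allows for signed lengths, in which the length transfer function is
  expressed.\<close>

lemma len_measure_absolutely_continuous:
  assumes P: "rect_curve \<gamma> a b" and P': "rect_curve \<gamma>' a b"
    and ac: "\<And>\<epsilon>. 0 < \<epsilon> \<Longrightarrow> \<exists>\<delta>>0. \<forall>(m::nat) x y.
      (\<forall>k<m. a \<le> x k \<and> x k \<le> y k \<and> y k \<le> b) \<and>
      disjoint_family_on (\<lambda>k. {\<sigma> + rect_curve.len \<gamma> a (x k)<..<\<sigma> + rect_curve.len \<gamma> a (y k)}) {..<m} \<and>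
      (\<Sum>k<m. rect_curve.len \<gamma> a (y k) - rect_curve.len \<gamma> a (x k)) < \<delta> \<longrightarrow>
      (\<Sum>k<m. rect_curve.len \<gamma>' a (y k) - rect_curve.len \<gamma>' a (x k)) < \<epsilon>"
  shows "absolutely_continuous (rect_curve.len_measure \<gamma> a b) (rect_curve.len_measure \<gamma>' a b)"
proof -
  interpret P: rect_curve \<gamma> a b by (rule P)
  interpret P': rect_curve \<gamma>' a b by (rule P')
  interpret M: finite_measure P.len_measure by (rule P.finite_len_measure)
  interpret M': finite_measure P'.len_measure by (rule P'.finite_len_measure)
  have compact_small: "measure P'.len_measure K \<le> \<epsilon>"
    if K: "compact K" "K \<subseteq> {a..b}" "emeasure P.len_measure K = 0" and \<epsilon>: "0 < \<epsilon>" for K \<epsilon>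
  proof -
    obtain \<delta> where \<delta>: "\<delta> > 0" "\<And>(m::nat) x y.
      (\<And>k. k < m \<Longrightarrow> a \<le> x k \<and> x k \<le> y k \<and> y k \<le> b) \<Longrightarrow>
      disjoint_family_on (\<lambda>k. {\<sigma> + P.len (x k)<..<\<sigma> + P.len (y k)}) {..<m} \<Longrightarrow>
      (\<Sum>k<m. P.len (y k) - P.len (x k)) < \<delta> \<Longrightarrow>
      (\<Sum>k<m. P'.len (y k) - P'.len (x k)) < \<epsilon>"
      using ac[OF \<epsilon>] by blast
    have Kb: "K \<in> sets borel" using K(1) by (simp add: borel_compact)
    have "(INF U \<in> {U. K \<subseteq> U \<and> open U}. emeasure P.len_measure U) < ennreal \<delta>"
      using P.len_measure_outer[OF Kb] K(3) \<delta>(1) by simp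
    then obtain U where U: "K \<subseteq> U" "open U" "emeasure P.len_measure U < ennreal \<delta>"
      unfolding INF_less_iff by blast
    obtain e where e: "e > 0" "\<And>x y. x \<in> K \<Longrightarrow> \<bar>y - x\<bar> < e \<Longrightarrow> y \<in> U"
      using compact_cover_radius[OF K(1) U(2,1)] by metis
    obtain n :: nat where n: "b - a < real n * e"
      using ex_less_of_nat_mult[OF e(1)] by blast
    define m where "m = Suc n"
    define h where "h = (b - a) / real m"
    have h: "0 \<le> h" "h < e"
    proof -
      show "0 \<le> h" using P.ab by (simp add: h_def)
      have "b - a < real m * e" using n e(1) by (simp add: m_def distrib_right)
      then show "h < e" by (simp add: h_def m_def field_simps)
    qed
    define t where "t = (\<lambda>k. a + real k * h)"
    have tm: "t m = b" by (simp add: t_def h_def m_def)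
    have t0: "t 0 = a" by (simp add: t_def)
    have tS: "t (Suc k) = t k + h" for k by (simp add: t_def distrib_right)
    have tmono: "t j \<le> t k" if "j \<le> k" for j k
      using that h(1) by (simp add: t_def mult_right_mono)
    have tin: "a \<le> t k" "k \<le> m \<Longrightarrow> t k \<le> b" for k
      using tmono[of 0 k] tmono[of k m] t0 tm by auto
    define C where "C = {k. k < m \<and> {t k..t (Suc k)} \<inter> K \<noteq> {}}"
    \<comment> \<open>Cells that miss \<open>K\<close> are shrunk to a point: their empty intervals
      add nothing to either sum, and the family stays indexed by all \<open>k < m\<close>.\<close>
    define y where "y = (\<lambda>k. if k \<in> C then t (Suc k) else t k)"
    have xy: "a \<le> t k \<and> t k \<le> y k \<and> y k \<le> b" if "k < m" for k
      using tin[of k] tin[of "Suc k"] tmono[of k "Suc k"] that by (auto simp: y_def)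
    have disj: "disjoint_family_on (\<lambda>k. {\<sigma> + P.len (t k)<..<\<sigma> + P.len (y k)}) {..<m}"
      unfolding disjoint_family_on_def
    proof (intro ballI impI)
      fix i j assume ij: "i \<in> {..<m}" "j \<in> {..<m}" "i \<noteq> j"
      have *: "{\<sigma> + P.len (t i)<..<\<sigma> + P.len (y i)} \<inter> {\<sigma> + P.len (t j)<..<\<sigma> + P.len (y j)} = {}"
        if "i < j" "j < m" for i j
      proof -
        have "y i \<le> t (Suc i)" using tmono[of i "Suc i"] by (simp add: y_def)
        also have "\<dots> \<le> t j" using that by (intro tmono) simp
        finally have "P.len (y i) \<le> P.len (t j)"
          using xy[of i] tin[of j] that by (intro P.len_mono) auto
        then show ?thesis by auto
      qed
      show "{\<sigma> + P.len (t i)<..<\<sigma> + P.len (y i)} \<inter> {\<sigma> + P.len (t j)<..<\<sigma> + P.len (y j)} = {}"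
        using *[of i j] *[of j i] ij by (cases "i < j") auto
    qed
    have finC: "finite C" by (simp add: C_def)
    have sumC: "(\<Sum>k<m. l (y k) - l (t k)) = (\<Sum>k\<in>C. l (t (Suc k)) - l (t k))" for l :: "real \<Rightarrow> real"
    proof -
      have "(\<Sum>k<m. l (y k) - l (t k)) = (\<Sum>k\<in>C. l (y k) - l (t k))"
        by (rule sum.mono_neutral_right) (auto simp: C_def y_def)
      then show ?thesis by (simp add: y_def)
    qed
    have "(\<Sum>k<m. P.len (y k) - P.len (t k)) = (\<Sum>k\<in>C. measure P.len_measure {t k<..t (Suc k)})"
      unfolding sumC
      by (intro sum.cong refl P.measure_half_open[symmetric]) (use tin tmono in \<open>auto simp: C_def\<close>)
    also have "\<dots> = measure P.len_measure (\<Union>k\<in>C. {t k<..t (Suc k)})"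
    proof (rule M.finite_measure_finite_Union[symmetric, OF finC])
      show "disjoint_family_on (\<lambda>k. {t k<..t (Suc k)}) C"
        unfolding disjoint_family_on_def
      proof (intro ballI impI)
        fix i j :: nat assume "i \<noteq> j"
        then show "{t i<..t (Suc i)} \<inter> {t j<..t (Suc j)} = {}"
          using tmono[of "Suc i" j] tmono[of "Suc j" i] by (cases "i < j") auto
      qed
    qed auto
    also have "\<dots> \<le> measure P.len_measure U"
    proof (rule M.finite_measure_mono)
      show "(\<Union>k\<in>C. {t k<..t (Suc k)}) \<subseteq> U"
      proof
        fix x assume "x \<in> (\<Union>k\<in>C. {t k<..t (Suc k)})"
        then obtain k where k: "k \<in> C" "t k < x" "x \<le> t (Suc k)" by auto
        then obtain u where u: "u \<in> K" "t k \<le> u" "u \<le> t (Suc k)" by (auto simp: C_def)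
        have "\<bar>x - u\<bar> < e" using k u tS[of k] h by auto
        then show "x \<in> U" by (rule e(2)[OF u(1)])
      qed
    qed (use U in auto)
    also have "\<dots> < \<delta>" using U(3) \<delta>(1) by (simp add: P.len_measure_eq_ennreal ennreal_less_iff)
    finally have small: "(\<Sum>k<m. P'.len (y k) - P'.len (t k)) < \<epsilon>"
      using \<delta>(2)[of m t y] xy disj by blast
    have "K \<subseteq> (\<Union>k\<in>C. {t k..t (Suc k)})"
    proof
      fix x assume x: "x \<in> K"
      then have "t 0 \<le> x" "x \<le> t m" using K(2) t0 tm by auto
      then obtain k where k: "k < m" "t k \<le> x" "x \<le> t (Suc k)" using grid_cell[of t x m] by (auto simp: m_def)
      then have "k \<in> C" using x by (auto simp: C_def)
      then show "x \<in> (\<Union>k\<in>C. {t k..t (Suc k)})" using k by auto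
    qed
    then have "measure P'.len_measure K \<le> measure P'.len_measure (\<Union>k\<in>C. {t k..t (Suc k)})"
      using finC by (intro M'.finite_measure_mono) auto
    also have "\<dots> \<le> (\<Sum>k\<in>C. measure P'.len_measure {t k..t (Suc k)})"
      by (rule M'.finite_measure_subadditive_finite[OF finC]) auto
    also have "\<dots> = (\<Sum>k<m. P'.len (y k) - P'.len (t k))"
      unfolding sumC by (intro sum.cong refl P'.measure_closed) (use tin tmono in \<open>auto simp: C_def\<close>)
    finally show ?thesis using small by simp
  qed
  have "emeasure P'.len_measure N = 0" if N: "N \<in> null_sets P.len_measure" for N
  proof -
    have Nb: "N \<in> sets borel" and N0: "emeasure P.len_measure N = 0" using N by (auto simp: null_sets_def)
    have "emeasure P'.len_measure K = 0" if K: "K \<subseteq> N \<inter> {a..b}" "compact K" for K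
    proof -
      have "emeasure P.len_measure K \<le> emeasure P.len_measure N"
        by (rule emeasure_mono) (use K Nb in auto)
      then have "emeasure P.len_measure K = 0" using N0 by simp
      then have "measure P'.len_measure K \<le> \<epsilon>" if "0 < \<epsilon>" for \<epsilon>
        using compact_small[of K \<epsilon>] K that by auto
      then have "measure P'.len_measure K \<le> 0" by (rule field_le_epsilon) simp
      then show ?thesis by (simp add: P'.len_measure_eq_ennreal ennreal_eq_0_iff)
    qed
    then have "emeasure P'.len_measure (N \<inter> {a..b}) = 0"
      using Nb by (subst P'.len_measure_inner) (auto simp: SUP_eq_iff intro!: antisym SUP_least)
    moreover have "emeasure P'.len_measure (N - {a..b}) = 0"
      using emeasure_mono[of "N - {a..b}" "- {a..b}" P'.len_measure] P'.len_measure_outside Nb by auto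
    moreover have "N = (N \<inter> {a..b}) \<union> (N - {a..b})" by blast
    moreover have "emeasure P'.len_measure ((N \<inter> {a..b}) \<union> (N - {a..b})) \<le>
        emeasure P'.len_measure (N \<inter> {a..b}) + emeasure P'.len_measure (N - {a..b})"
      using Nb by (intro emeasure_subadditive) auto
    ultimately show ?thesis by simp
  qed
  then show ?thesis
    unfolding absolutely_continuous_def by (auto simp: null_sets_def)
qed

text \<open>By Radon-Nikodym it suffices to bound the density of \<open>M'\<close>.\<close>

lemma nn_integral_le_local_bounds:
  fixes M M' :: "'a measure" and c :: "'i \<Rightarrow> real"
  assumes fin: "finite_measure M" and sets: "sets M' = sets M"
    and ac: "absolutely_continuous M M'"
    and I: "countable I" and S: "\<And>i. i \<in> I \<Longrightarrow> S i \<in> sets M" and c: "\<And>i. i \<in> I \<Longrightarrow> 0 \<le> c i"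
    and bound: "\<And>i B. i \<in> I \<Longrightarrow> B \<in> sets M \<Longrightarrow> B \<subseteq> S i \<Longrightarrow> emeasure M' B \<le> ennreal (c i) * emeasure M B"
    and g: "g \<in> borel_measurable M"
  shows "(\<integral>\<^sup>+t. g t \<partial>M') \<le> (\<integral>\<^sup>+t. g t * (INF i\<in>I. if t \<in> S i then ennreal (c i) else \<infinity>) \<partial>M)"
proof -
  interpret finite_measure M by (rule fin)
  obtain h where h: "h \<in> borel_measurable M" "density M h = M'"
    using Radon_Nikodym_finite_measure_infinite[OF ac sets] by blast
  have ae: "AE t in M. h t \<le> (if t \<in> S i then ennreal (c i) else \<infinity>)" if i: "i \<in> I" for i
  proof -
    \<comment> \<open>Where the density exceeds the bound. Comparing the integrals over this set
      forces the excess to vanish almost everywhere.\<close>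
    define B where "B = {t \<in> space M. t \<in> S i \<and> ennreal (c i) < h t}"
    have B: "B \<in> sets M"
    proof -
      have "B = S i \<inter> {t \<in> space M. ennreal (c i) < h t}"
        using sets.sets_into_space[OF S[OF i]] by (auto simp: B_def)
      then show ?thesis using S[OF i] h(1) by auto
    qed
    have "(\<integral>\<^sup>+t. h t * indicator B t \<partial>M) = emeasure M' B"
      unfolding h(2)[symmetric] using emeasure_density[OF h(1) B] by simp
    also have "\<dots> \<le> ennreal (c i) * emeasure M B"
      by (rule bound[OF i B]) (auto simp: B_def)
    also have "\<dots> = (\<integral>\<^sup>+t. ennreal (c i) * indicator B t \<partial>M)"
      using B by (simp add: nn_integral_cmult_indicator)
    finally have le: "(\<integral>\<^sup>+t. h t * indicator B t \<partial>M) \<le> (\<integral>\<^sup>+t. ennreal (c i) * indicator B t \<partial>M)" .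
    \<comment> \<open>Subtraction of integrals in \<open>ennreal\<close> requires a finite
      subtrahend.\<close>
    have finB: "(\<integral>\<^sup>+t. ennreal (c i) * indicator B t \<partial>M) \<noteq> \<infinity>"
      using B by (simp add: nn_integral_cmult_indicator ennreal_mult_eq_top_iff emeasure_finite)
    have "(\<integral>\<^sup>+t. h t * indicator B t - ennreal (c i) * indicator B t \<partial>M) =
        (\<integral>\<^sup>+t. h t * indicator B t \<partial>M) - (\<integral>\<^sup>+t. ennreal (c i) * indicator B t \<partial>M)"
      using h(1) B finB by (intro nn_integral_diff) (auto simp: B_def indicator_def)
    also have "\<dots> = 0"
      using le le_less_trans[OF le] finB by (auto simp: diff_eq_0_iff_ennreal top.not_eq_extremum)
    finally have "AE t in M. h t * indicator B t - ennreal (c i) * indicator B t = 0"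
      using h(1) B by (subst (asm) nn_integral_0_iff_AE) auto
    then show ?thesis
    proof eventually_elim
      case (elim t)
      show ?case
      proof (rule ccontr)
        assume "\<not> ?case"
        then have ti: "t \<in> S i" "ennreal (c i) < h t" by (auto split: if_splits)
        then have "t \<in> B" using sets.sets_into_space[OF S[OF i]] by (auto simp: B_def)
        then have "h t - ennreal (c i) = 0" using elim by simp
        then show False using ti(2) by (auto simp: diff_eq_0_iff_ennreal dest: leD)
      qed
    qed
  qed
  then have "AE t in M. \<forall>i\<in>I. h t \<le> (if t \<in> S i then ennreal (c i) else \<infinity>)"
    by (simp add: AE_ball_countable[OF I])
  then have le: "AE t in M. h t * g t \<le> g t * (INF i\<in>I. if t \<in> S i then ennreal (c i) else \<infinity>)"
  proof eventually_elim
    case (elim t)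
    then have "h t \<le> (INF i\<in>I. if t \<in> S i then ennreal (c i) else \<infinity>)" by (intro INF_greatest) blast
    then show ?case by (simp add: mult.commute mult_left_mono)
  qed
  have "(\<integral>\<^sup>+t. g t \<partial>M') = (\<integral>\<^sup>+t. h t * g t \<partial>M)"
    unfolding h(2)[symmetric] by (rule nn_integral_density[OF h(1) g])
  also have "\<dots> \<le> (\<integral>\<^sup>+t. g t * (INF i\<in>I. if t \<in> S i then ennreal (c i) else \<infinity>) \<partial>M)"
    by (rule nn_integral_mono_AE[OF le])
  finally show ?thesis .
qed

section \<open>Lipschitz constants and path integrals\<close>

context moebius_group
begin

text \<open>The witness is a Lebesgue number of a cover of the interval by open sets on each of
  which the path varies by less than \<open>\<epsilon>\<close>; these come from the openness of
  metric balls in the orbit topology.\<close>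

lemma orbit_curve_uniform:
  fixes a b :: real
  assumes cont: "continuous_map (top_of_set \<Delta>) (orbit_topology G) \<gamma>" and sub: "{a..b} \<subseteq> \<Delta>" and \<epsilon>: "0 < \<epsilon>"
  shows "\<exists>\<delta>>0. \<forall>s\<in>{a..b}. \<forall>t\<in>{a..b}. \<bar>s - t\<bar> < \<delta> \<longrightarrow> orbit_dist (\<gamma> s) (\<gamma> t) < \<epsilon>"
proof -
  have in_space: "\<gamma> t \<in> orbit_space G" if "t \<in> {a..b}" for t
    using cont sub that by (auto simp: continuous_map_def)
  define \<G> where "\<G> = {V. open V \<and> (\<forall>s\<in>V \<inter> {a..b}. \<forall>t\<in>V \<inter> {a..b}. orbit_dist (\<gamma> s) (\<gamma> t) < \<epsilon>)}"
  have cover: "{a..b} \<subseteq> \<Union>\<G>"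
  proof
    fix u assume u: "u \<in> {a..b}"
    define W where "W = {q \<in> orbit_space G. orbit_dist (\<gamma> u) q < \<epsilon> / 2}"
    have "openin (orbit_topology G) W" unfolding W_def by (rule openin_orbit_ball[OF in_space[OF u]])
    then have "openin (top_of_set \<Delta>) {s \<in> topspace (top_of_set \<Delta>). \<gamma> s \<in> W}"
      by (rule openin_continuous_map_preimage[OF cont])
    then obtain V where V: "open V" "{s \<in> \<Delta>. \<gamma> s \<in> W} = \<Delta> \<inter> V" by (auto simp: openin_open)
    have "\<gamma> u \<in> W" using \<epsilon> orbit_dist_self[OF in_space[OF u]] in_space[OF u] by (simp add: W_def)
    then have "u \<in> V" using u sub V(2) by blast
    moreover have "V \<in> \<G>"
      unfolding \<G>_def
    proof (intro CollectI conjI V(1) ballI)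
      fix s t assume st: "s \<in> V \<inter> {a..b}" "t \<in> V \<inter> {a..b}"
      then have "\<gamma> s \<in> W" "\<gamma> t \<in> W" using V(2) sub by blast+
      then have "orbit_dist (\<gamma> u) (\<gamma> s) < \<epsilon> / 2" "orbit_dist (\<gamma> u) (\<gamma> t) < \<epsilon> / 2" by (auto simp: W_def)
      moreover have "orbit_dist (\<gamma> s) (\<gamma> t) \<le> orbit_dist (\<gamma> s) (\<gamma> u) + orbit_dist (\<gamma> u) (\<gamma> t)"
        by (rule orbit_dist_triangle) (use in_space u st in blast)+
      ultimately show "orbit_dist (\<gamma> s) (\<gamma> t) < \<epsilon>" by (simp add: orbit_dist_commute[of "\<gamma> s" "\<gamma> u"])
    qed
    ultimately show "u \<in> \<Union>\<G>" by blast
  qed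
  obtain e where e: "0 < e" "\<And>x. x \<in> {a..b} \<Longrightarrow> \<exists>V\<in>\<G>. ball x e \<subseteq> V"
    by (rule Heine_Borel_lemma[OF compact_Icc cover]) (auto simp: \<G>_def)
  have "orbit_dist (\<gamma> s) (\<gamma> t) < \<epsilon>" if st: "s \<in> {a..b}" "t \<in> {a..b}" "\<bar>s - t\<bar> < e" for s t
  proof -
    obtain V where V: "V \<in> \<G>" "ball s e \<subseteq> V" using e(2)[OF st(1)] by blast
    have "s \<in> ball s e" "t \<in> ball s e" using e(1) st(3) by (auto simp: dist_real_def)
    then have "s \<in> V \<inter> {a..b}" "t \<in> V \<inter> {a..b}" using V(2) st by blast+
    then show ?thesis using V(1) unfolding \<G>_def by blast
  qed
  then show ?thesis using e(1) by blast
qed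

lemma rect_curveI:
  assumes cont: "continuous_map (top_of_set \<Delta>) (orbit_topology G) \<gamma>" and sub: "{a..b} \<subseteq> \<Delta>"
    and ab: "a \<le> b" and fin: "path_len \<gamma> a b < \<infinity>"
  shows "rect_curve \<gamma> a b"
proof -
  have in_space: "\<gamma> t \<in> orbit_space G" if "t \<in> {a..b}" for t
    using cont sub that by (auto simp: continuous_map_def)
  show ?thesis
  proof
    show "orbit_dist (\<gamma> s) (\<gamma> s) = 0" if "s \<in> {a..b}" for s
      by (rule orbit_dist_self[OF in_space[OF that]])
    show "orbit_dist (\<gamma> s) (\<gamma> u) \<le> orbit_dist (\<gamma> s) (\<gamma> t) + orbit_dist (\<gamma> t) (\<gamma> u)"
      if "s \<in> {a..b}" "t \<in> {a..b}" "u \<in> {a..b}" for s t u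
      by (rule orbit_dist_triangle[OF in_space[OF that(1)] in_space[OF that(2)] in_space[OF that(3)]])
  qed (use ab fin orbit_curve_uniform[OF cont sub] in auto)
qed

lemma curve_measurable:
  fixes a b :: real
  assumes cont: "continuous_map (top_of_set \<Delta>) (orbit_topology G) \<gamma>" and sub: "{a..b} \<subseteq> \<Delta>"
    and \<rho>: "(\<rho> :: _ \<Rightarrow> ennreal) \<in> borel_measurable (orbit_borel G)"
  shows "(\<lambda>t. \<rho> (\<gamma> t) * indicator {a..b} t) \<in> borel_measurable borel"
proof -
  have m: "\<gamma> \<in> restrict_space borel {a..b} \<rightarrow>\<^sub>M orbit_borel G"
    unfolding orbit_borel_def
  proof (rule measurable_measure_of)
    show "{U. openin (orbit_topology G) U} \<subseteq> Pow (orbit_space G)" by (auto simp: openin_orbit_topology)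
    show "\<gamma> \<in> space (restrict_space borel {a..b}) \<rightarrow> orbit_space G"
      using cont sub by (auto simp: continuous_map_def space_restrict_space)
    fix U assume "U \<in> {U. openin (orbit_topology G) U}"
    then have "openin (top_of_set \<Delta>) {s \<in> topspace (top_of_set \<Delta>). \<gamma> s \<in> U}"
      by (intro openin_continuous_map_preimage[OF cont]) simp
    then obtain V where V: "open V" "{s \<in> \<Delta>. \<gamma> s \<in> U} = \<Delta> \<inter> V" by (auto simp: openin_open)
    then have "\<gamma> -` U \<inter> space (restrict_space borel {a..b}) = V \<inter> {a..b}"
      using sub by (auto simp: space_restrict_space)
    then show "\<gamma> -` U \<inter> space (restrict_space borel {a..b}) \<in> sets (restrict_space borel {a..b})"
      using V(1) by (subst sets_restrict_space_iff) auto
  qed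
  then have "(\<lambda>t. \<rho> (\<gamma> t)) \<in> borel_measurable (restrict_space borel {a..b})"
    by (rule measurable_compose[OF _ \<rho>])
  then show ?thesis by (subst (asm) borel_measurable_restrict_space_iff_ennreal) auto
qed

end

section \<open>Signed length on a parameter interval\<close>

lemma parameter_interval_convex:
  assumes "parameter_interval \<Delta>" "s \<in> \<Delta>" "t \<in> \<Delta>"
  shows "{s..t} \<subseteq> \<Delta>"
  using assms by (auto simp: parameter_interval_def)

lemma base_point_in:
  assumes "parameter_interval \<Delta>"
  shows "base_point \<Delta> \<in> \<Delta>"
proof -
  obtain a b where ab: "a < b" "\<Delta> = {a..b} \<or> \<Delta> = {a<..<b} \<or> \<Delta> = {a..<b} \<or> \<Delta> = {a<..b}"
    using assms unfolding parameter_interval_def by blast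
  then have "(a + b) / 2 \<in> \<Delta>" by auto
  then have "(SOME t. t \<in> \<Delta>) \<in> \<Delta>" by (rule someI)
  then show ?thesis by (simp add: base_point_def)
qed

text \<open>The base point lies left of \<open>s\<close>, between \<open>s\<close> and
  \<open>t\<close>, or right of \<open>t\<close>, and additivity of length settles each case. So on
  a closed subpath signed length and \<open>len\<close> differ by a constant.\<close>

lemma signed_len_diff:
  assumes \<Delta>: "parameter_interval \<Delta>"
    and rect: "\<And>a b. a \<le> b \<Longrightarrow> {a..b} \<subseteq> \<Delta> \<Longrightarrow> rect_curve \<gamma> a b"
    and st: "s \<in> \<Delta>" "t \<in> \<Delta>" "s \<le> t"
  shows "signed_len (\<Delta>, \<gamma>) t - signed_len (\<Delta>, \<gamma>) s = enn2real (path_len \<gamma> s t)"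
proof -
  let ?t0 = "base_point \<Delta>"
  have t0: "?t0 \<in> \<Delta>" by (rule base_point_in[OF \<Delta>])
  have add: "enn2real (path_len \<gamma> x z) = enn2real (path_len \<gamma> x y) + enn2real (path_len \<gamma> y z)"
    if "x \<in> \<Delta>" "z \<in> \<Delta>" "x \<le> y" "y \<le> z" for x y z
  proof -
    interpret P: rect_curve \<gamma> x z
      using that parameter_interval_convex[OF \<Delta>] by (intro rect) auto
    show ?thesis
      using P.path_len_add[of x y z] P.path_len_finite[of x y] P.path_len_finite[of y z] that
      by (simp add: enn2real_plus)
  qed
  have self: "enn2real (path_len \<gamma> x x) = 0" if "x \<in> \<Delta>" for x
  proof -
    interpret P: rect_curve \<gamma> x x using that by (intro rect) auto
    show ?thesis using P.path_len_self[of x] by simp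
  qed
  consider "?t0 \<le> s" | "s < ?t0" "?t0 \<le> t" | "t < ?t0" by linarith
  then show ?thesis
  proof cases
    case 1
    then show ?thesis using add[of ?t0 t s] t0 st by (simp add: signed_len_def)
  next
    case 2
    then show ?thesis using add[of s t ?t0] t0 st by (simp add: signed_len_def)
  next
    case 3
    then show ?thesis using add[of s ?t0 t] t0 st by (simp add: signed_len_def)
  qed
qed

section \<open>Mappings of orbit spaces and their pointwise Lipschitz constants\<close>

locale orbit_mapping = src: moebius_group G + tgt: moebius_group G'
  for G G' :: "(real^'n \<Rightarrow> real^'n) set" +
  fixes D D' :: "(real^'n) set set" and f :: "(real^'n) set \<Rightarrow> (real^'n) set"
  assumes D_open: "openin (orbit_topology G) D" and D'_sub: "D' \<subseteq> orbit_space G'"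
    and f_cont: "continuous_map (subtopology (orbit_topology G) D) (subtopology (orbit_topology G') D') f"
begin

lemma D_sub: "D \<subseteq> orbit_space G"
  using openin_subset[OF D_open] by simp

lemma f_in: "p \<in> D \<Longrightarrow> f p \<in> D'"
  using f_cont D_sub by (auto simp: continuous_map_def)

lemma f_in_space: "p \<in> D \<Longrightarrow> f p \<in> orbit_space G'"
  using f_in D'_sub by blast

lemma openin_f_preimage:
  assumes "openin (orbit_topology G') V"
  shows "openin (orbit_topology G) {p \<in> D. f p \<in> V}"
proof -
  have "openin (subtopology (orbit_topology G') D') (V \<inter> D')"
    using assms by (auto simp: openin_subtopology)
  then have "openin (subtopology (orbit_topology G) D) {p \<in> topspace (subtopology (orbit_topology G) D). f p \<in> V \<inter> D'}"
    by (rule openin_continuous_map_preimage[OF f_cont])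
  moreover have "{p \<in> topspace (subtopology (orbit_topology G) D). f p \<in> V \<inter> D'} = {p \<in> D. f p \<in> V}"
    using D_sub f_in by auto
  ultimately show ?thesis using openin_trans_full D_open by metis
qed

text \<open>Fixing the scale makes the condition uniform: the set is relatively closed in
  \<open>D\<close>, and along a closed subpath one bound on parameter differences works for all its
  points.\<close>

definition lip_set :: "real \<Rightarrow> nat \<Rightarrow> (real^'n) set set" where
  "lip_set c k = {p \<in> D. \<forall>q\<in>D. orbit_dist p q < 1 / Suc k \<longrightarrow> orbit_dist (f p) (f q) \<le> c * orbit_dist p q}"

text \<open>Only countably many constants enter, so that the pointwise Lipschitz constant is a Borel function.\<close>

definition lip :: "(real^'n) set \<Rightarrow> ennreal" where
  "lip p = (INF i \<in> {c \<in> \<rat>. 0 \<le> c} \<times> UNIV. if p \<in> lip_set (fst i) (snd i) then ennreal (fst i) else \<infinity>)"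

lemma countable_lip_index: "countable ({c \<in> \<rat>. 0 \<le> (c::real)} \<times> (UNIV :: nat set))"
  by (intro countable_SIGMA countable_subset[OF _ countable_rat]) auto

lemma lip_le: "p \<in> lip_set c k \<Longrightarrow> c \<in> \<rat> \<Longrightarrow> 0 \<le> c \<Longrightarrow> lip p \<le> ennreal c"
  unfolding lip_def by (rule INF_lower2[of "(c, k)"]) auto

text \<open>A violation by some \<open>q\<close> persists for all points near \<open>p\<close>,
  since \<open>f\<close> is continuous; so the complement in \<open>D\<close> is open.\<close>

lemma lip_set_sets:
  assumes c: "0 \<le> c"
  shows "lip_set c k \<in> sets (orbit_borel G)"
proof -
  define W where "W = {p \<in> D. \<exists>q\<in>D. orbit_dist p q < 1 / Suc k \<and> c * orbit_dist p q < orbit_dist (f p) (f q)}"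
  have "openin (orbit_topology G) W"
  proof (subst openin_subopen, intro ballI)
    fix p assume "p \<in> W"
    then obtain q where pq: "p \<in> D" "q \<in> D" "orbit_dist p q < 1 / Suc k" "c * orbit_dist p q < orbit_dist (f p) (f q)"
      by (auto simp: W_def)
    \<comment> \<open>Moving \<open>p\<close> and \<open>f p\<close> by less than
      \<open>\<epsilon>\<close> changes the two sides of the violated inequality by at most
      \<open>c * \<epsilon>\<close> and \<open>\<epsilon>\<close>, hence the division by
      \<open>c + 1\<close>. The first term keeps \<open>q\<close> within the scale.\<close>
    define \<epsilon> where "\<epsilon> = min (1 / Suc k - orbit_dist p q) ((orbit_dist (f p) (f q) - c * orbit_dist p q) / (c + 1))"
    have \<epsilon>: "0 < \<epsilon>" using pq c by (simp add: \<epsilon>_def)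
    have \<epsilon>1: "\<epsilon> \<le> 1 / Suc k - orbit_dist p q" by (simp add: \<epsilon>_def)
    have "\<epsilon> \<le> (orbit_dist (f p) (f q) - c * orbit_dist p q) / (c + 1)" by (simp add: \<epsilon>_def)
    then have \<epsilon>2: "c * \<epsilon> + \<epsilon> \<le> orbit_dist (f p) (f q) - c * orbit_dist p q"
      using c by (simp add: pos_le_divide_eq distrib_left mult.commute)
    have ps: "p \<in> orbit_space G" "q \<in> orbit_space G" "f p \<in> orbit_space G'" "f q \<in> orbit_space G'"
      using pq D_sub f_in_space by auto
    define T where "T = {r \<in> orbit_space G. orbit_dist p r < \<epsilon>} \<inter> {r \<in> D. f r \<in> {s \<in> orbit_space G'. orbit_dist (f p) s < \<epsilon>}}"
    have "openin (orbit_topology G) T"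
      unfolding T_def
      by (intro openin_Int src.openin_orbit_ball openin_f_preimage tgt.openin_orbit_ball ps)
    moreover have "p \<in> T"
      using ps pq \<epsilon> src.orbit_dist_self[OF ps(1)] tgt.orbit_dist_self[OF ps(3)] by (simp add: T_def)
    moreover have "T \<subseteq> W"
    proof
      fix r assume r: "r \<in> T"
      then have rs: "r \<in> D" "r \<in> orbit_space G" "f r \<in> orbit_space G'" "orbit_dist p r < \<epsilon>" "orbit_dist (f p) (f r) < \<epsilon>"
        by (auto simp: T_def)
      have "orbit_dist r q \<le> orbit_dist r p + orbit_dist p q" by (rule src.orbit_dist_triangle[OF rs(2) ps(1,2)])
      then have 1: "orbit_dist r q < \<epsilon> + orbit_dist p q" using rs(4) by (simp add: orbit_dist_sym[of r p])
      have "orbit_dist (f p) (f q) \<le> orbit_dist (f p) (f r) + orbit_dist (f r) (f q)"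
        by (rule tgt.orbit_dist_triangle[OF ps(3) rs(3) ps(4)])
      then have 2: "orbit_dist (f p) (f q) < \<epsilon> + orbit_dist (f r) (f q)" using rs(5) by simp
      have "c * orbit_dist r q \<le> c * (\<epsilon> + orbit_dist p q)" using 1 c by (intro mult_left_mono) auto
      then have "c * orbit_dist r q < orbit_dist (f r) (f q)" using 2 \<epsilon>2 by (simp add: distrib_left)
      moreover have "orbit_dist r q < 1 / Suc k" using 1 \<epsilon>1 by linarith
      ultimately show "r \<in> W" using rs(1) pq(2) unfolding W_def by blast
    qed
    ultimately show "\<exists>T. openin (orbit_topology G) T \<and> p \<in> T \<and> T \<subseteq> W" by blast
  qed
  then have "D - W \<in> sets (orbit_borel G)"
    by (intro sets.Diff src.openin_sets_orbit_borel D_open)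
  moreover have "D - W = lip_set c k"
    unfolding W_def lip_set_def by (auto simp: not_less)
  ultimately show ?thesis by simp
qed

lemma lip_measurable: "lip \<in> borel_measurable (orbit_borel G)"
proof -
  have eq: "lip = (\<lambda>p. INF i \<in> {c \<in> \<rat>. 0 \<le> c} \<times> UNIV. if p \<in> lip_set (fst i) (snd i) then ennreal (fst i) else \<infinity>)"
    by (rule ext) (rule lip_def)
  show ?thesis
    unfolding eq
  proof (rule borel_measurable_INF[OF countable_lip_index])
    fix i assume "i \<in> {c \<in> \<rat>. 0 \<le> (c::real)} \<times> (UNIV :: nat set)"
    then have "lip_set (fst i) (snd i) \<in> sets (orbit_borel G)" by (intro lip_set_sets) auto
    then show "(\<lambda>p. if p \<in> lip_set (fst i) (snd i) then ennreal (fst i) else \<infinity>) \<in> borel_measurable (orbit_borel G)"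
      by (intro measurable_If_set) auto
  qed
qed

lemma f_borel_measurable:
  assumes \<rho>: "(\<rho> :: _ \<Rightarrow> ennreal) \<in> borel_measurable (orbit_borel G')"
  shows "(\<lambda>p. \<rho> (f p) * indicator D p) \<in> borel_measurable (orbit_borel G)"
proof -
  have Ds: "D \<inter> space (orbit_borel G) \<in> sets (orbit_borel G)"
    using src.openin_sets_orbit_borel[OF D_open] by auto
  have m: "f \<in> restrict_space (orbit_borel G) D \<rightarrow>\<^sub>M orbit_borel G'"
    unfolding orbit_borel_def[of G']
  proof (rule measurable_measure_of)
    show "{U. openin (orbit_topology G') U} \<subseteq> Pow (orbit_space G')" by (auto simp: openin_orbit_topology)
    show "f \<in> space (restrict_space (orbit_borel G) D) \<rightarrow> orbit_space G'"
      using f_in_space by (auto simp: space_restrict_space)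
    fix U assume "U \<in> {U. openin (orbit_topology G') U}"
    then have "{p \<in> D. f p \<in> U} \<in> sets (orbit_borel G)"
      by (intro src.openin_sets_orbit_borel openin_f_preimage) simp
    moreover have "f -` U \<inter> space (restrict_space (orbit_borel G) D) = {p \<in> D. f p \<in> U}"
      using D_sub by (auto simp: space_restrict_space src.space_orbit_borel)
    ultimately show "f -` U \<inter> space (restrict_space (orbit_borel G) D) \<in> sets (restrict_space (orbit_borel G) D)"
      by (subst sets_restrict_space_iff[OF Ds]) auto
  qed
  then have "(\<lambda>p. \<rho> (f p)) \<in> borel_measurable (restrict_space (orbit_borel G) D)"
    by (rule measurable_compose[OF _ \<rho>])
  then show ?thesis by (subst (asm) borel_measurable_restrict_space_iff_ennreal[OF Ds])
qed

definition pullback :: "((real^'n) set \<Rightarrow> ennreal) \<Rightarrow> (real^'n) set \<Rightarrow> ennreal" where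
  "pullback \<rho>' p = \<rho>' (f p) * indicator D p * lip p"

lemma pullback_measurable:
  "\<rho>' \<in> borel_measurable (orbit_borel G') \<Longrightarrow> pullback \<rho>' \<in> borel_measurable (orbit_borel G)"
  unfolding pullback_def[abs_def] by (intro borel_measurable_times_ennreal f_borel_measurable lip_measurable)

text \<open>On a closed subpath both sides are integrals over the parameter interval against the two
  arc length measures. The transfer function makes the second measure absolutely continuous, each
  Lipschitz set bounds its density by the corresponding constant, and the infimum of these bounds is
  \<open>lip\<close> along the path.\<close>

lemma path_integral_pullback:
  assumes \<gamma>: "(\<Delta>, \<gamma>) \<in> paths_in G D" and lr: "locally_rectifiable (\<Delta>, \<gamma>)"
    and lr': "locally_rectifiable (image_path f (\<Delta>, \<gamma>))"
    and L: "length_transfer f (\<Delta>, \<gamma>) L"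
    and AC: "\<And>c d. c \<le> d \<Longrightarrow> {c..d} \<subseteq> signed_len (\<Delta>, \<gamma>) ` \<Delta> \<Longrightarrow> abs_continuous_on_segment c d L"
    and \<rho>': "\<rho>' \<in> borel_measurable (orbit_borel G')"
  shows "path_integral \<rho>' (image_path f (\<Delta>, \<gamma>)) \<le> path_integral (pullback \<rho>') (\<Delta>, \<gamma>)"
proof -
  let ?\<gamma>' = "f \<circ> \<gamma>"
  have \<Delta>: "parameter_interval \<Delta>" and cont: "continuous_map (top_of_set \<Delta>) (orbit_topology G) \<gamma>"
    and \<gamma>D: "\<gamma> ` \<Delta> \<subseteq> D"
    using \<gamma> by (auto simp: paths_in_def)
  have "continuous_map (top_of_set \<Delta>) (subtopology (orbit_topology G) D) \<gamma>"
    using cont \<gamma>D by (simp add: continuous_map_in_subtopology image_subset_iff_funcset)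
  then have "continuous_map (top_of_set \<Delta>) (subtopology (orbit_topology G') D') ?\<gamma>'"
    by (rule continuous_map_compose[OF _ f_cont])
  then have cont': "continuous_map (top_of_set \<Delta>) (orbit_topology G') ?\<gamma>'"
    by (rule continuous_map_into_fulltopology)
  have rect: "rect_curve \<gamma> a b" if "a \<le> b" "{a..b} \<subseteq> \<Delta>" for a b
    using lr that by (intro src.rect_curveI[OF cont that(2,1)]) (auto simp: locally_rectifiable_def)
  have rect': "rect_curve ?\<gamma>' a b" if "a \<le> b" "{a..b} \<subseteq> \<Delta>" for a b
    using lr' that by (intro tgt.rect_curveI[OF cont' that(2,1)]) (auto simp: locally_rectifiable_def image_path_def)
  have main: "(\<integral>\<^sup>+s\<in>{0..enn2real (path_len ?\<gamma>' a b)}. \<rho>' (normal_rep ?\<gamma>' a b s) \<partial>lborel)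
      \<le> (\<integral>\<^sup>+s\<in>{0..enn2real (path_len \<gamma> a b)}. pullback \<rho>' (normal_rep \<gamma> a b s) \<partial>lborel)"
    if ab: "a \<le> b" "{a..b} \<subseteq> \<Delta>" for a b
  proof -
    interpret P: rect_curve \<gamma> a b by (rule rect[OF ab])
    interpret P': rect_curve ?\<gamma>' a b by (rule rect'[OF ab])
    have abin: "x \<in> \<Delta>" if "a \<le> x" "x \<le> b" for x using ab that by auto
    have sl: "signed_len (\<Delta>, \<gamma>) x = signed_len (\<Delta>, \<gamma>) a + P.len x" if "a \<le> x" "x \<le> b" for x
      using signed_len_diff[OF \<Delta> rect, of a x] abin[of a] abin[of x] ab that
      by (simp add: P.len_def)
    have sl': "signed_len (\<Delta>, ?\<gamma>') x = signed_len (\<Delta>, ?\<gamma>') a + P'.len x" if "a \<le> x" "x \<le> b" for x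
      using signed_len_diff[OF \<Delta> rect', of a x] abin[of a] abin[of x] ab that
      by (simp add: P'.len_def)
    let ?\<sigma> = "signed_len (\<Delta>, \<gamma>) a"
    have Lx: "L (?\<sigma> + P.len x) = signed_len (\<Delta>, ?\<gamma>') a + P'.len x" if "a \<le> x" "x \<le> b" for x
    proof -
      have "L (signed_len (\<Delta>, \<gamma>) x) = signed_len (\<Delta>, ?\<gamma>') x"
        using L abin[OF that] by (simp add: length_transfer_def image_path_def)
      then show ?thesis unfolding sl[OF that] sl'[OF that] .
    qed
    have ac_seg: "abs_continuous_on_segment ?\<sigma> (?\<sigma> + P.len b) L"
    proof (rule AC)
      show "?\<sigma> \<le> ?\<sigma> + P.len b" using P.len_nonneg by simp
      show "{?\<sigma>..?\<sigma> + P.len b} \<subseteq> signed_len (\<Delta>, \<gamma>) ` \<Delta>"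
      proof
        fix y assume y: "y \<in> {?\<sigma>..?\<sigma> + P.len b}"
        then have i: "y - ?\<sigma> \<in> {0..P.len b}" by auto
        have "y = signed_len (\<Delta>, \<gamma>) (P.len_inv (y - ?\<sigma>))"
          using sl[of "P.len_inv (y - ?\<sigma>)"] P.len_inv[OF i] by simp
        moreover have "P.len_inv (y - ?\<sigma>) \<in> \<Delta>" using P.len_inv(1)[OF i] abin by simp
        ultimately show "y \<in> signed_len (\<Delta>, \<gamma>) ` \<Delta>" by blast
      qed
    qed
    have ac: "absolutely_continuous P.len_measure P'.len_measure"
    proof (rule len_measure_absolutely_continuous[OF rect[OF ab] rect'[OF ab], of ?\<sigma>])
      fix \<epsilon> :: real assume "0 < \<epsilon>"
      then obtain \<delta> where \<delta>: "\<delta> > 0" "\<And>(m::nat) u v.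
        (\<forall>k<m. ?\<sigma> \<le> u k \<and> u k \<le> v k \<and> v k \<le> ?\<sigma> + P.len b) \<and>
        disjoint_family_on (\<lambda>k. {u k<..<v k}) {..<m} \<and> (\<Sum>k<m. v k - u k) < \<delta> \<Longrightarrow>
        (\<Sum>k<m. \<bar>L (v k) - L (u k)\<bar>) < \<epsilon>"
        using ac_seg unfolding abs_continuous_on_segment_def by blast
      have "(\<Sum>k<m. P'.len (y k) - P'.len (x k)) < \<epsilon>"
        if xy: "(\<forall>k<m. a \<le> x k \<and> x k \<le> y k \<and> y k \<le> b) \<and>
          disjoint_family_on (\<lambda>k. {?\<sigma> + P.len (x k)<..<?\<sigma> + P.len (y k)}) {..<m} \<and>
          (\<Sum>k<m. P.len (y k) - P.len (x k)) < \<delta>" for m :: nat and x y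
      proof -
        have b1: "a \<le> x k" "x k \<le> b" "a \<le> y k" "y k \<le> b" "x k \<le> y k" if "k < m" for k
          using xy that by (force intro: order_trans)+
        have "(\<Sum>k<m. \<bar>L (?\<sigma> + P.len (y k)) - L (?\<sigma> + P.len (x k))\<bar>) < \<epsilon>"
        proof (rule \<delta>(2), intro conjI allI impI)
          fix k assume k: "k < m"
          show "?\<sigma> \<le> ?\<sigma> + P.len (x k)" using P.len_nonneg by simp
          show "?\<sigma> + P.len (x k) \<le> ?\<sigma> + P.len (y k)" using P.len_mono[of "x k" "y k"] b1[OF k] by simp
          show "?\<sigma> + P.len (y k) \<le> ?\<sigma> + P.len b" using P.len_mono[of "y k" b] b1[OF k] by simp
        next
          show "disjoint_family_on (\<lambda>k. {?\<sigma> + P.len (x k)<..<?\<sigma> + P.len (y k)}) {..<m}" using xy by blast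
          show "(\<Sum>k<m. ?\<sigma> + P.len (y k) - (?\<sigma> + P.len (x k))) < \<delta>" using xy by simp
        qed
        moreover have "\<bar>L (?\<sigma> + P.len (y k)) - L (?\<sigma> + P.len (x k))\<bar> = P'.len (y k) - P'.len (x k)" if k: "k < m" for k
          using Lx[of "x k"] Lx[of "y k"] P'.len_mono[of "x k" "y k"] b1[OF k] by simp
        ultimately show ?thesis by simp
      qed
      then show "\<exists>\<delta>>0. \<forall>(m::nat) x y.
        (\<forall>k<m. a \<le> x k \<and> x k \<le> y k \<and> y k \<le> b) \<and>
        disjoint_family_on (\<lambda>k. {?\<sigma> + P.len (x k)<..<?\<sigma> + P.len (y k)}) {..<m} \<and>
        (\<Sum>k<m. P.len (y k) - P.len (x k)) < \<delta> \<longrightarrow>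
        (\<Sum>k<m. P'.len (y k) - P'.len (x k)) < \<epsilon>"
        using \<delta>(1) by blast
    qed
    let ?I = "{c \<in> \<rat>. 0 \<le> (c::real)} \<times> (UNIV :: nat set)"
    define S where "S = (\<lambda>i. {t \<in> {a..b}. \<gamma> t \<in> lip_set (fst i) (snd i)})"
    have S: "S i \<in> sets borel" if "i \<in> ?I" for i
    proof -
      have "lip_set (fst i) (snd i) \<in> sets (orbit_borel G)" using that by (intro lip_set_sets) auto
      then have "(\<lambda>t. indicator (lip_set (fst i) (snd i)) (\<gamma> t) * indicator {a..b} t :: ennreal) \<in> borel_measurable borel"
        by (intro src.curve_measurable[OF cont ab(2)] borel_measurable_indicator)
      then have "(\<lambda>t. indicator (lip_set (fst i) (snd i)) (\<gamma> t) * indicator {a..b} t :: ennreal) -` {1} \<inter> space borel \<in> sets borel"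
        by (rule measurable_sets) simp
      also have "(\<lambda>t. indicator (lip_set (fst i) (snd i)) (\<gamma> t) * indicator {a..b} t :: ennreal) -` {1} \<inter> space borel = S i"
        by (auto simp: S_def indicator_def of_bool_def split: if_splits)
      finally show ?thesis .
    qed
    have bound: "emeasure P'.len_measure B \<le> ennreal (fst i) * emeasure P.len_measure B"
      if i: "i \<in> ?I" and B: "B \<in> sets P.len_measure" "B \<subseteq> S i" for i B
    proof -
      \<comment> \<open>Uniform continuity turns the scale of the Lipschitz set into a parameter
        distance valid on the whole subpath.\<close>
      obtain \<eta> where \<eta>: "0 < \<eta>" "\<And>s t. s \<in> {a..b} \<Longrightarrow> t \<in> {a..b} \<Longrightarrow> \<bar>s - t\<bar> < \<eta> \<Longrightarrow> orbit_dist (\<gamma> s) (\<gamma> t) < 1 / Suc (snd i)"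
        using P.dist_uniform[of "1 / Suc (snd i)"] by auto
      show ?thesis
      proof (rule len_measure_compare[OF rect[OF ab] rect'[OF ab], of "S i" _ \<eta>])
        show "S i \<subseteq> {a..b}" by (auto simp: S_def)
        show "0 \<le> fst i" using i by auto
        fix u s assume us: "u \<in> S i" "s \<in> {a..b}" "\<bar>s - u\<bar> < \<eta>"
        then have u: "u \<in> {a..b}" "\<gamma> u \<in> lip_set (fst i) (snd i)" by (auto simp: S_def)
        have "orbit_dist (\<gamma> u) (\<gamma> s) < 1 / Suc (snd i)"
          by (rule \<eta>(2)) (use u us in auto)
        moreover have "\<gamma> s \<in> D" using \<gamma>D ab us by blast
        ultimately have "orbit_dist (f (\<gamma> u)) (f (\<gamma> s)) \<le> fst i * orbit_dist (\<gamma> u) (\<gamma> s)"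
          using u(2) by (auto simp: lip_set_def)
        then show "orbit_dist (?\<gamma>' s) (?\<gamma>' u) \<le> fst i * orbit_dist (\<gamma> s) (\<gamma> u)"
          by (simp add: orbit_dist_sym[of "f (\<gamma> s)"] orbit_dist_sym[of "\<gamma> s"])
      qed (use \<eta>(1) B in auto)
    qed
    have g': "(\<lambda>t. \<rho>' (?\<gamma>' t) * indicator {a..b} t) \<in> borel_measurable borel"
      by (rule tgt.curve_measurable[OF cont' ab(2) \<rho>'])
    have "(\<integral>\<^sup>+s\<in>{0..enn2real (path_len ?\<gamma>' a b)}. \<rho>' (normal_rep ?\<gamma>' a b s) \<partial>lborel) =
        (\<integral>\<^sup>+t. \<rho>' (?\<gamma>' t) * indicator {a..b} t \<partial>P'.len_measure)"
      by (rule P'.nn_integral_normal_rep[OF g'])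
    also have "\<dots> \<le> (\<integral>\<^sup>+t. \<rho>' (?\<gamma>' t) * indicator {a..b} t *
        (INF i\<in>?I. if t \<in> S i then ennreal (fst i) else \<infinity>) \<partial>P.len_measure)"
      by (rule nn_integral_le_local_bounds[OF P.finite_len_measure _ ac countable_lip_index])
        (use S bound g' in \<open>auto cong: measurable_cong_sets\<close>)
    also have "\<dots> = (\<integral>\<^sup>+t. pullback \<rho>' (\<gamma> t) * indicator {a..b} t \<partial>P.len_measure)"
    proof (rule nn_integral_cong)
      fix t
      show "\<rho>' (?\<gamma>' t) * indicator {a..b} t * (INF i\<in>?I. if t \<in> S i then ennreal (fst i) else \<infinity>) =
          pullback \<rho>' (\<gamma> t) * indicator {a..b} t"
      proof (cases "t \<in> {a..b}")
        case True
        then have "\<gamma> t \<in> D" using \<gamma>D ab by blast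
        moreover have "(INF i\<in>?I. if t \<in> S i then ennreal (fst i) else \<infinity>) = lip (\<gamma> t)"
          unfolding lip_def S_def using True by (intro INF_cong refl) auto
        ultimately show ?thesis using True by (simp add: pullback_def)
      qed simp
    qed
    also have "\<dots> = (\<integral>\<^sup>+s\<in>{0..enn2real (path_len \<gamma> a b)}. pullback \<rho>' (normal_rep \<gamma> a b s) \<partial>lborel)"
      by (rule P.nn_integral_normal_rep[symmetric, OF src.curve_measurable[OF cont ab(2) pullback_measurable[OF \<rho>']]])
    finally show ?thesis .
  qed
  show ?thesis
    unfolding path_integral_def image_path_def prod.case
    by (rule SUP_mono) (use main in fastforce)
qed

end

section \<open>The dilatation and the change of variables\<close>

context orbit_mapping
begin

abbreviation tproj :: "real^'n \<Rightarrow> (real^'n) set" where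
  "tproj \<equiv> orbit_proj G'"

text \<open>Near \<open>x0\<close> the map \<open>R\<close> expands Euclidean distances from
  \<open>x0\<close> by at most slightly more than \<open>onorm R'\<close>.
  \<open>hyp_dist_le\<close> in the target and \<open>hyp_dist_ge\<close> in the source convert this
  to hyperbolic distances, with factors \<open>A\<close> and \<open>B\<close> continuous at
  \<open>x0\<close>. In the target the orbit distance is trivially at most the distance in the ball;
  in the source equality is needed, which \<open>local_isometry\<close> provides.\<close>

lemma lip_le_derivative:
  assumes x0: "x0 \<in> unit_ball" and R: "(R has_derivative R') (at x0)"
    and W: "open W" "x0 \<in> W" "W \<subseteq> unit_ball"
    and lift: "\<And>y. y \<in> W \<Longrightarrow> src.proj y \<in> D \<and> R y \<in> unit_ball \<and> tproj (R y) = f (src.proj y)"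
  shows "lip (src.proj x0) \<le> ennreal (onorm R' * ((1 - (norm x0)\<^sup>2) / (1 - (norm (R x0))\<^sup>2)))"
proof -
  define \<kappa> where "\<kappa> = onorm R' * ((1 - (norm x0)\<^sup>2) / (1 - (norm (R x0))\<^sup>2))"
  have Rx0: "R x0 \<in> unit_ball" using lift W(2) by blast
  have n0: "0 < 1 - (norm x0)\<^sup>2" and nR: "0 < 1 - (norm (R x0))\<^sup>2"
    using unit_ball_pos[OF x0] unit_ball_pos[OF Rx0] by simp_all
  have blR: "bounded_linear R'" using R by (rule has_derivative_bounded_linear)
  have on0: "0 \<le> onorm R'" by (rule onorm_pos_le[OF blR])
  have \<kappa>0: "0 \<le> \<kappa>" using on0 n0 nR by (simp add: \<kappa>_def)
  have contR: "(R \<longlongrightarrow> R x0) (at x0)"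
    using has_derivative_continuous[OF R] by (simp add: continuous_at)
  have key: "\<exists>k. src.proj x0 \<in> lip_set c k" if c: "\<kappa> < c" for c
  proof -
    define A where "A = (\<lambda>y. 1 / sqrt ((1 - (norm (R x0))\<^sup>2) * (1 - (norm (R y))\<^sup>2)))"
    define B where "B = (\<lambda>y. 1 / sqrt ((norm (x0 - y))\<^sup>2 + (1 - (norm x0)\<^sup>2) * (1 - (norm y)\<^sup>2)))"
    have A0: "A x0 = 1 / (1 - (norm (R x0))\<^sup>2)" using nR by (simp add: A_def)
    have B0: "B x0 = 1 / (1 - (norm x0)\<^sup>2)" using n0 by (simp add: B_def)
    have limA: "(A \<longlongrightarrow> A x0) (at x0)"
      unfolding A_def using nR by (intro tendsto_intros contR) auto
    have limB: "(B \<longlongrightarrow> B x0) (at x0)"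
      unfolding B_def using n0 by (intro tendsto_intros) auto
    have gap: "onorm R' * A x0 < c * B x0"
    proof -
      have "onorm R' * (1 - (norm x0)\<^sup>2) < c * (1 - (norm (R x0))\<^sup>2)"
        using c nR by (simp add: \<kappa>_def pos_divide_less_eq)
      then show ?thesis
        unfolding A0 B0 using n0 nR by (simp add: field_simps)
    qed
    \<comment> \<open>Chosen so that \<open>(onorm R' + e) * A x0\<close> is the midpoint between
      \<open>onorm R' * A x0\<close> and \<open>c * B x0\<close>.\<close>
    define e where "e = (c * B x0 - onorm R' * A x0) / (2 * A x0)"
    have Apos: "0 < A x0" using nR by (simp add: A0)
    have e: "0 < e" using gap Apos by (simp add: e_def)
    have "(onorm R' + e) * A x0 = (onorm R' * A x0 + c * B x0) / 2"
      using Apos by (simp add: e_def field_simps)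
    then have gap': "(onorm R' + e) * A x0 < c * B x0" using gap by simp
    have "((\<lambda>y. c * B y - (onorm R' + e) * A y) \<longlongrightarrow> c * B x0 - (onorm R' + e) * A x0) (at x0)"
      by (intro tendsto_intros limA limB)
    then have ev1: "\<forall>\<^sub>F y in at x0. 0 < c * B y - (onorm R' + e) * A y"
      by (rule order_tendstoD(1)) (use gap' in simp)
    obtain d1 where d1: "0 < d1" "\<And>y. norm (y - x0) < d1 \<Longrightarrow> norm (R y - R x0 - R' (y - x0)) \<le> e * norm (y - x0)"
      using R e unfolding has_derivative_at_alt by blast
    obtain d2 where d2: "0 < d2" "\<And>y. y \<noteq> x0 \<Longrightarrow> dist y x0 < d2 \<Longrightarrow> 0 < c * B y - (onorm R' + e) * A y"
      using ev1 unfolding eventually_at by auto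
    obtain d3 where d3: "0 < d3" "ball x0 d3 \<subseteq> W" using W openE by blast
    define d where "d = min d1 (min d2 d3)"
    have d: "0 < d" using d1 d2 d3 by (simp add: d_def)
    have est: "y \<in> W \<and> hyp_dist (R x0) (R y) \<le> c * hyp_dist x0 y" if y: "norm (x0 - y) < d" for y
    proof
      have "y \<in> ball x0 d3" using y by (simp add: d_def dist_norm)
      then show yW: "y \<in> W" using d3 by blast
      show "hyp_dist (R x0) (R y) \<le> c * hyp_dist x0 y"
      proof (cases "y = x0")
        case False
        have yB: "y \<in> unit_ball" using yW W(3) by blast
        have RyB: "R y \<in> unit_ball" using lift[OF yW] by blast
        have ny: "norm (y - x0) < d1" "dist y x0 < d2"
          using y by (simp_all add: d_def dist_norm norm_minus_commute)
        have "norm (R y - R x0) \<le> norm (R y - R x0 - R' (y - x0)) + norm (R' (y - x0))"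
          by (metis diff_add_cancel norm_triangle_ineq)
        also have "\<dots> \<le> e * norm (y - x0) + onorm R' * norm (y - x0)"
          by (intro add_mono d1(2) ny onorm[OF blR])
        finally have R1: "norm (R x0 - R y) \<le> (onorm R' + e) * norm (x0 - y)"
          by (simp add: norm_minus_commute distrib_right add.commute)
        have A: "0 \<le> A y"
          unfolding A_def using nR unit_ball_pos[OF RyB] by simp
        have "hyp_dist (R x0) (R y) \<le> 2 * norm (R x0 - R y) * A y"
          using hyp_dist_le[OF Rx0 RyB] by (simp add: A_def)
        also have "\<dots> \<le> 2 * ((onorm R' + e) * norm (x0 - y)) * A y"
          using R1 A by (intro mult_right_mono mult_left_mono) auto
        also have "\<dots> = 2 * norm (x0 - y) * ((onorm R' + e) * A y)" by simp
        also have "\<dots> \<le> 2 * norm (x0 - y) * (c * B y)"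
          using d2(2)[OF False ny(2)] by (intro mult_left_mono) auto
        also have "\<dots> = c * (2 * norm (x0 - y) * B y)" by simp
        also have "\<dots> \<le> c * hyp_dist x0 y"
          using hyp_dist_ge[OF x0 yB] c \<kappa>0 by (intro mult_left_mono) (auto simp: B_def)
        finally show ?thesis .
      qed simp
    qed
    obtain r where r: "r > 0"
      "\<And>y z. y \<in> unit_ball \<Longrightarrow> z \<in> unit_ball \<Longrightarrow> hyp_dist x0 y < r \<Longrightarrow> hyp_dist x0 z < r \<Longrightarrow>
        orbit_dist (src.proj y) (src.proj z) = hyp_dist y z"
      "inj_on src.proj {y \<in> unit_ball. hyp_dist x0 y < r}"
      by (rule src.local_isometry[OF x0]) (rule that, assumption+)
    \<comment> \<open>Below \<open>r\<close> the orbit distance equals \<open>hyp_dist\<close>;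
      below \<open>d / 2\<close> the Euclidean distance is less than \<open>d\<close>, by
      \<open>norm_le_hyp_dist\<close>.\<close>
    have "0 < min r (d / 2)" using r(1) d by simp
    from reals_Archimedean[OF this] obtain k where "inverse (real (Suc k)) < min r (d / 2)" ..
    then have k: "1 / real (Suc k) < min r (d / 2)" by (simp only: inverse_eq_divide)
    have "src.proj x0 \<in> lip_set c k"
      unfolding lip_set_def
    proof (intro CollectI conjI ballI impI)
      show "src.proj x0 \<in> D" using lift[OF W(2)] by blast
      fix q assume q: "q \<in> D" "orbit_dist (src.proj x0) q < 1 / real (Suc k)"
      have "q \<in> orbit_space G" using q D_sub by blast
      from src.orbit_dist_lessD[OF x0 this q(2)]
      obtain y where y: "y \<in> unit_ball" "q = src.proj y" "hyp_dist x0 y < 1 / real (Suc k)" by metis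
      have "norm (x0 - y) < d" using norm_le_hyp_dist[OF x0 y(1)] y(3) k by linarith
      then have yW: "y \<in> W" and le: "hyp_dist (R x0) (R y) \<le> c * hyp_dist x0 y" using est by blast+
      have "orbit_dist (f (src.proj x0)) (f q) = orbit_dist (tproj (R x0)) (tproj (R y))"
        using lift[OF W(2)] lift[OF yW] y(2) by simp
      also have "\<dots> \<le> hyp_dist (R x0) (R y)"
        by (rule tgt.orbit_dist_le) (use Rx0 lift[OF yW] in blast)+
      also have "\<dots> \<le> c * hyp_dist x0 y" by (rule le)
      also have "hyp_dist x0 y = orbit_dist (src.proj x0) q"
        unfolding y(2) by (rule r(2)[symmetric]) (use x0 y k r(1) in auto)
      finally show "orbit_dist (f (src.proj x0)) (f q) \<le> c * orbit_dist (src.proj x0) q" .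
    qed
    then show ?thesis by blast
  qed
  have "lip (src.proj x0) \<le> ennreal \<kappa>"
  proof (rule ennreal_le_epsilon)
    fix e :: real assume "0 < e"
    then obtain c where c: "c \<in> \<rat>" "\<kappa> < c" "c < \<kappa> + e" using Rats_dense_in_real[of \<kappa> "\<kappa> + e"] by auto
    obtain k where "src.proj x0 \<in> lip_set c k" using key[OF c(2)] by blast
    then have "lip (src.proj x0) \<le> ennreal c" by (rule lip_le) (use c \<kappa>0 in auto)
    also have "\<dots> \<le> ennreal (\<kappa> + e)" using c by (intro ennreal_leI) simp
    finally show "lip (src.proj x0) \<le> ennreal \<kappa> + ennreal e" using \<kappa>0 \<open>0 < e\<close> by simp
  qed
  then show ?thesis by (simp add: \<kappa>_def)
qed

text \<open>On the set where both chosen charts apply, the coordinate representation projects to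
  \<open>f\<close>. Later arguments use this lifting property in place of the charts
  themselves.\<close>

lemma coordinate_rep_lift:
  assumes p: "p \<in> D"
  obtains W where "open W" "coordinate_point G p \<in> W" "W \<subseteq> unit_ball" "src.proj (coordinate_point G p) = p"
    "\<And>y. y \<in> W \<Longrightarrow> src.proj y \<in> D \<and> coordinate_rep G G' f p y \<in> unit_ball \<and>
      tproj (coordinate_rep G G' f p y) = f (src.proj y)"
proof -
  obtain U \<phi> where U: "coordinate_at G p = (U, \<phi>)" by (cases "coordinate_at G p")
  obtain V \<psi> where V: "coordinate_at G' (f p) = (V, \<psi>)" by (cases "coordinate_at G' (f p)")
  have ps: "p \<in> orbit_space G" "f p \<in> orbit_space G'" using p D_sub f_in_space by auto
  note cU = src.coordinate_at[OF ps(1) U] and cV = tgt.coordinate_at[OF ps(2) V]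
  have R: "coordinate_rep G G' f p = \<psi> \<circ> f \<circ> inv_into U \<phi>"
    by (simp add: coordinate_rep_def U V)
  have pt: "coordinate_point G p = \<phi> p" by (simp add: coordinate_point_def U)
  define W where "W = \<phi> ` U \<inter> orbit_vimage G {q \<in> D. f q \<in> V}"
  show ?thesis
  proof (rule that[of W])
    have "open (orbit_vimage G {q \<in> D. f q \<in> V})"
      using openin_f_preimage[OF cV(5)] by (simp add: openin_orbit_topology)
    then show "open W" unfolding W_def by (rule open_Int[OF cU(1)])
    show "W \<subseteq> unit_ball" using cU(2) by (auto simp: W_def)
    show "src.proj (coordinate_point G p) = p" unfolding pt by (rule cU(3)[OF cU(4)])
    have "\<phi> p \<in> unit_ball" using cU(2,4) by blast
    then show "coordinate_point G p \<in> W"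
      unfolding pt W_def orbit_vimage_def using cU(3)[OF cU(4)] cU(4) cV(4) p by simp
    fix y assume "y \<in> W"
    then obtain q where q: "q \<in> U" "y = \<phi> q" "src.proj y \<in> D" "f (src.proj y) \<in> V"
      by (auto simp: W_def orbit_vimage_def)
    have pq: "src.proj y = q" using cU(3)[OF q(1)] q(2) by simp
    have "inj_on \<phi> U" using cU(3) by (metis inj_onI)
    then have "inv_into U \<phi> y = q" using q by simp
    then have Ry: "coordinate_rep G G' f p y = \<psi> (f q)" by (simp add: R)
    have fq: "f q \<in> V" using q(4) pq by simp
    have "\<psi> (f q) \<in> unit_ball" using cV(2) fq by blast
    moreover have "tproj (\<psi> (f q)) = f q" by (rule cV(3)[OF fq])
    ultimately show "src.proj y \<in> D \<and> coordinate_rep G G' f p y \<in> unit_ball \<and>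
      tproj (coordinate_rep G G' f p y) = f (src.proj y)"
      unfolding Ry pq using q(3) pq by simp
  qed
qed

section \<open>Local lifts of the mapping to the ball\<close>

definition lift_dom :: "(real^'n) set \<Rightarrow> (real^'n) set" where
  "lift_dom B = orbit_vimage G {p \<in> D. f p \<in> tproj ` B}"

text \<open>The branch of the inverse projection over \<open>B\<close>, applied to \<open>f\<close>.
  Its domain is the whole preimage in the ball, so no source chart has to be chosen, and countably
  many sets \<open>B\<close> are enough to cover everything over \<open>D\<close>.\<close>

definition lift :: "(real^'n) set \<Rightarrow> real^'n \<Rightarrow> real^'n" where
  "lift B x = inv_into B tproj (f (src.proj x))"

lemma lift_dom_iff: "x \<in> lift_dom B \<longleftrightarrow> x \<in> unit_ball \<and> src.proj x \<in> D \<and> f (src.proj x) \<in> tproj ` B"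
  by (simp add: lift_dom_def orbit_vimage_def)

lemma lift_in: "x \<in> lift_dom B \<Longrightarrow> lift B x \<in> B"
  unfolding lift_def by (rule inv_into_into) (simp add: lift_dom_iff)

lemma proj_lift: "x \<in> lift_dom B \<Longrightarrow> tproj (lift B x) = f (src.proj x)"
  unfolding lift_def by (rule f_inv_into_f) (simp add: lift_dom_iff)

lemma open_lift_dom:
  assumes "open B" "B \<subseteq> unit_ball"
  shows "open (lift_dom B)"
  using openin_f_preimage[OF tgt.openin_proj_image[OF assms]] by (simp add: lift_dom_def openin_orbit_topology)

text \<open>The preimage of \<open>W\<close> under the lift is the lift domain belonging to
  \<open>W \<inter> B\<close>, which is open.\<close>

lemma lift_continuous_on:
  assumes B: "open B" "B \<subseteq> unit_ball" "inj_on tproj B"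
  shows "continuous_on (lift_dom B) (lift B)"
proof (subst continuous_on_open_vimage[OF open_lift_dom[OF B(1,2)]], intro allI impI)
  fix W :: "(real^'n) set" assume W: "open W"
  have "lift B -` W \<inter> lift_dom B = lift_dom (W \<inter> B)"
  proof (rule equalityI; rule subsetI)
    fix x assume x: "x \<in> lift B -` W \<inter> lift_dom B"
    then have "lift B x \<in> W \<inter> B" "f (src.proj x) = tproj (lift B x)" using lift_in proj_lift by auto
    then show "x \<in> lift_dom (W \<inter> B)" using x by (auto simp: lift_dom_iff)
  next
    fix x assume x: "x \<in> lift_dom (W \<inter> B)"
    then obtain w where w: "w \<in> W" "w \<in> B" "f (src.proj x) = tproj w" by (auto simp: lift_dom_iff)
    then have "lift B x = w" using B(3) by (simp add: lift_def)
    then show "x \<in> lift B -` W \<inter> lift_dom B" using w x by (auto simp: lift_dom_iff)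
  qed
  then show "open (lift B -` W \<inter> lift_dom B)"
    using open_lift_dom[of "W \<inter> B"] W B by (simp add: open_Int le_infI2)
qed

text \<open>Near \<open>x\<close> the lift equals \<open>h \<circ> (R \<circ> g)\<close>, with
  \<open>R\<close> the coordinate representation and group elements \<open>g\<close>,
  \<open>h\<close> that account for the chosen charts. The conformal factors of \<open>g\<close> and
  \<open>h\<close> cancel in the hyperbolic Jacobian, leaving
  \<open>\<bar>det (matrix R')\<bar> * \<alpha> ^ CARD('n)\<close>, while
  \<open>lip_le_derivative\<close> bounds \<open>lip\<close> by
  \<open>onorm R' * \<alpha>\<close>.\<close>

lemma lift_derivative:
  assumes B: "open B" "B \<subseteq> unit_ball" "inj_on tproj B" and x: "x \<in> lift_dom B"
    and diff: "differentiable_at_orbit G G' f (src.proj x)"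
  obtains F' where "(lift B has_derivative F') (at x)"
    "det (matrix F') \<noteq> 0 \<Longrightarrow> lip (src.proj x) ^ CARD('n) \<le>
      K_O G G' f (src.proj x) * ennreal (\<bar>det (matrix F')\<bar> * ((1 - (norm x)\<^sup>2) / (1 - (norm (lift B x))\<^sup>2)) ^ CARD('n))"
proof -
  let ?p = "src.proj x"
  define R where "R = coordinate_rep G G' f ?p"
  define x0 where "x0 = coordinate_point G ?p"
  have xb: "x \<in> unit_ball" and pD: "?p \<in> D" using x by (simp_all add: lift_dom_iff)
  obtain W where W: "open W" "x0 \<in> W" "W \<subseteq> unit_ball" and px0: "src.proj x0 = ?p"
    and liftW: "\<And>y. y \<in> W \<Longrightarrow> src.proj y \<in> D \<and> R y \<in> unit_ball \<and> tproj (R y) = f (src.proj y)"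
    using coordinate_rep_lift[OF pD] unfolding R_def x0_def by metis
  have x0b: "x0 \<in> unit_ball" using W by blast
  have Rx0b: "R x0 \<in> unit_ball" using liftW[OF W(2)] by blast
  obtain g where g: "g \<in> G" "x0 = g x" by (rule src.proj_eqD[OF px0 x0b])
  have Fxb: "lift B x \<in> unit_ball" using lift_in[OF x] B(2) by blast
  have "tproj (lift B x) = tproj (R x0)"
    using proj_lift[OF x] liftW[OF W(2)] px0 by simp
  then obtain h where h: "h \<in> G'" "lift B x = h (R x0)" using Fxb by (rule tgt.proj_eqD)
  define R' where "R' = frechet_derivative R (at x0)"
  have Rdiff: "R differentiable (at x0)"
    using diff unfolding differentiable_at_orbit_def R_def x0_def .
  then have R': "(R has_derivative R') (at x0)" unfolding R'_def frechet_derivative_works[symmetric] .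
  obtain g' where g': "(g has_derivative g') (at x)"
    using src.G_differentiable[OF g(1) xb] by (auto simp: differentiable_def)
  obtain h' where h': "(h has_derivative h') (at (R x0))"
    using tgt.G_differentiable[OF h(1) Rx0b] by (auto simp: differentiable_def)
  have Rg: "((R \<circ> g) has_derivative (R' \<circ> g')) (at x)"
    by (rule diff_chain_at[OF g']) (use R' g(2) in simp)
  have comp: "((h \<circ> (R \<circ> g)) has_derivative (h' \<circ> (R' \<circ> g'))) (at x)"
    by (rule diff_chain_at[OF Rg]) (use h' g(2) in simp)
  \<comment> \<open>Near \<open>x\<close> the point on the right lies in \<open>B\<close> and
    projects to the value of \<open>f\<close>; injectivity of \<open>tproj\<close> on
    \<open>B\<close> makes it the lift.\<close>
  have ev: "\<forall>\<^sub>F y in nhds x. lift B y = (h \<circ> (R \<circ> g)) y"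
  proof -
    have "(g \<longlongrightarrow> g x) (nhds x)"
      using has_derivative_continuous[OF g'] by (simp add: continuous_at tendsto_at_iff_tendsto_nhds)
    then have 1: "\<forall>\<^sub>F y in nhds x. g y \<in> W" by (rule topological_tendstoD) (use W g in auto)
    have "((h \<circ> (R \<circ> g)) \<longlongrightarrow> (h \<circ> (R \<circ> g)) x) (nhds x)"
      using has_derivative_continuous[OF comp] unfolding continuous_at tendsto_at_iff_tendsto_nhds .
    then have 2: "\<forall>\<^sub>F y in nhds x. (h \<circ> (R \<circ> g)) y \<in> B"
      by (rule topological_tendstoD) (use B(1) lift_in[OF x] h(2) g(2) in auto)
    have 3: "\<forall>\<^sub>F y in nhds x. y \<in> unit_ball" using xb by (intro eventually_nhds_in_open) auto
    from 1 2 3 show ?thesis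
    proof eventually_elim
      case (elim y)
      have "tproj ((h \<circ> (R \<circ> g)) y) = tproj (R (g y))"
        using tgt.proj_G[OF h(1), of "R (g y)"] liftW[OF elim(1)] by simp
      also have "\<dots> = f (src.proj (g y))" using liftW[OF elim(1)] by simp
      also have "src.proj (g y) = src.proj y" by (rule src.proj_G[OF g(1) elim(3)])
      finally have "f (src.proj y) = tproj ((h \<circ> (R \<circ> g)) y)" by simp
      then show ?case unfolding lift_def using B(3) elim(2) by simp
    qed
  qed
  define F' where "F' = h' \<circ> (R' \<circ> g')"
  have F': "(lift B has_derivative F') (at x)"
    unfolding F'_def
    by (rule has_derivative_transform_eventually[OF comp])
      (use ev eventually_nhds_x_imp_x[OF ev] in \<open>auto simp: eventually_at_filter elim!: eventually_mono\<close>)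
  have lin: "linear h'" "linear R'" "linear g'" "linear (R' \<circ> g')"
    using h' R' g' Rg by (simp_all add: has_derivative_linear)
  have mat: "det (matrix F') = det (matrix h') * (det (matrix R') * det (matrix g'))"
    unfolding F'_def by (simp add: matrix_compose[OF lin(4,1)] matrix_compose[OF lin(3,2)] det_mul)
  have dg: "\<bar>det (matrix g')\<bar> = ((1 - (norm x0)\<^sup>2) / (1 - (norm x)\<^sup>2)) ^ CARD('n)"
    using src.G_derivative_det[OF g(1) xb g'] g(2) by simp
  have dh: "\<bar>det (matrix h')\<bar> = ((1 - (norm (lift B x))\<^sup>2) / (1 - (norm (R x0))\<^sup>2)) ^ CARD('n)"
    using tgt.G_derivative_det[OF h(1) Rx0b h'] h(2) by simp
  define \<alpha> where "\<alpha> = (1 - (norm x0)\<^sup>2) / (1 - (norm (R x0))\<^sup>2)"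
  have pos: "0 < 1 - (norm x)\<^sup>2" "0 < 1 - (norm x0)\<^sup>2" "0 < 1 - (norm (R x0))\<^sup>2" "0 < 1 - (norm (lift B x))\<^sup>2"
    using unit_ball_pos[OF xb] unit_ball_pos[OF x0b] unit_ball_pos[OF Rx0b] unit_ball_pos[OF Fxb] by simp_all
  have \<alpha>: "0 < \<alpha>" using pos by (simp add: \<alpha>_def)
  have jac: "\<bar>det (matrix F')\<bar> * ((1 - (norm x)\<^sup>2) / (1 - (norm (lift B x))\<^sup>2)) ^ CARD('n) = \<bar>det (matrix R')\<bar> * \<alpha> ^ CARD('n)"
    unfolding mat abs_mult dg dh \<alpha>_def using pos
    by (simp add: power_divide field_simps)
  show ?thesis
  proof (rule that[OF F'])
    assume "det (matrix F') \<noteq> 0"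
    then have dR: "det (matrix R') \<noteq> 0" using mat by auto
    have on0: "0 \<le> onorm R'" by (rule onorm_pos_le[OF has_derivative_bounded_linear[OF R']])
    have KO: "K_O G G' f ?p = ennreal (onorm R' ^ CARD('n) / \<bar>det (matrix R')\<bar>)"
      using Rdiff dR unfolding K_O_def R_def[symmetric] x0_def[symmetric] outer_dilatation_def jacobian_def R'_def
      by simp
    have "lip ?p \<le> ennreal (onorm R' * \<alpha>)"
      using lip_le_derivative[OF x0b R' W liftW] px0 by (simp add: \<alpha>_def)
    then have "lip ?p ^ CARD('n) \<le> ennreal (onorm R' * \<alpha>) ^ CARD('n)" by (rule power_mono) simp
    also have "\<dots> = ennreal ((onorm R' * \<alpha>) ^ CARD('n))"
      using on0 \<alpha> by (simp add: ennreal_power)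
    also have "(onorm R' * \<alpha>) ^ CARD('n) = onorm R' ^ CARD('n) / \<bar>det (matrix R')\<bar> * (\<bar>det (matrix R')\<bar> * \<alpha> ^ CARD('n))"
      using dR by (simp add: power_mult_distrib)
    also have "ennreal \<dots> = K_O G G' f ?p * ennreal (\<bar>det (matrix R')\<bar> * \<alpha> ^ CARD('n))"
      unfolding KO using on0 \<alpha> by (intro ennreal_mult) auto
    finally show "lip ?p ^ CARD('n) \<le> K_O G G' f ?p *
        ennreal (\<bar>det (matrix F')\<bar> * ((1 - (norm x)\<^sup>2) / (1 - (norm (lift B x))\<^sup>2)) ^ CARD('n))"
      unfolding jac .
  qed
qed

end

text \<open>For fixed \<open>y\<close> a violation is an open condition on \<open>x\<close>, so the
  complement in \<open>U\<close> is open, as a union over \<open>y\<close>.\<close>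

lemma expansive_set_sets:
  fixes F :: "'a::euclidean_space \<Rightarrow> 'b::euclidean_space"
  assumes U: "open U" and F: "continuous_on U F"
  shows "{x \<in> U. \<forall>y\<in>U. norm (y - x) < r \<longrightarrow> c * norm (y - x) \<le> norm (F y - F x)} \<in> sets borel"
proof -
  define Q where "Q = (\<Union>y\<in>U. {x \<in> U. norm (y - x) < r \<and> norm (F y - F x) < c * norm (y - x)})"
  have "open {x \<in> U. norm (y - x) < r \<and> norm (F y - F x) < c * norm (y - x)}" for y
  proof -
    have "open ((\<lambda>x. r - norm (y - x)) -` {0<..} \<inter> U)"
      using continuous_on_open_vimage[OF U, of "\<lambda>x. r - norm (y - x)"] by (auto intro!: continuous_intros)
    moreover have "continuous_on U (\<lambda>x. c * norm (y - x) - norm (F y - F x))"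
      by (intro continuous_intros F)
    then have "open ((\<lambda>x. c * norm (y - x) - norm (F y - F x)) -` {0<..} \<inter> U)"
      using continuous_on_open_vimage[OF U] open_greaterThan by blast
    ultimately have "open (((\<lambda>x. r - norm (y - x)) -` {0<..} \<inter> U) \<inter>
        ((\<lambda>x. c * norm (y - x) - norm (F y - F x)) -` {0<..} \<inter> U))" by (rule open_Int)
    also have "((\<lambda>x. r - norm (y - x)) -` {0<..} \<inter> U) \<inter>
        ((\<lambda>x. c * norm (y - x) - norm (F y - F x)) -` {0<..} \<inter> U) =
        {x \<in> U. norm (y - x) < r \<and> norm (F y - F x) < c * norm (y - x)}" by auto
    finally show ?thesis .
  qed
  then have "open Q" unfolding Q_def by blast
  then have "U - Q \<in> sets borel" using U by (intro sets.Diff) auto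
  moreover have "U - Q = {x \<in> U. \<forall>y\<in>U. norm (y - x) < r \<longrightarrow> c * norm (y - x) \<le> norm (F y - F x)}"
    unfolding Q_def by (auto simp: not_less)
  ultimately show ?thesis by simp
qed

text \<open>The injective derivative expands lengths by at least some \<open>B > 0\<close>, and
  nearby the error is at most \<open>B / 2\<close> times the distance. One natural number gives both
  the radius and the constant, which keeps the later decomposition countable.\<close>

lemma locally_expansive:
  fixes F :: "real^'n \<Rightarrow> real^'n"
  assumes F: "(F has_derivative F') (at x)" and det: "det (matrix F') \<noteq> 0"
  obtains m :: nat where "\<And>y. norm (y - x) < 1 / Suc m \<Longrightarrow> 1 / Suc m * norm (y - x) \<le> norm (F y - F x)"
proof -
  have lin: "linear F'" using F by (rule has_derivative_linear)
  have "inj F'" using det_nz_iff_inj[OF lin] det by blast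
  then obtain B where B: "B > 0" "\<And>v. B * norm v \<le> norm (F' v)"
    using linear_inj_bounded_below_pos[OF lin] by blast
  obtain d where d: "0 < d" "\<And>y. norm (y - x) < d \<Longrightarrow> norm (F y - F x - F' (y - x)) \<le> B / 2 * norm (y - x)"
    using F B(1) unfolding has_derivative_at_alt by (meson half_gt_zero)
  have "0 < min d (B / 2)" using B(1) d(1) by simp
  from reals_Archimedean[OF this] obtain m where "inverse (real (Suc m)) < min d (B / 2)" ..
  then have m: "1 / real (Suc m) < min d (B / 2)" by (simp only: inverse_eq_divide)
  show ?thesis
  proof (rule that[of m])
    fix y assume y: "norm (y - x) < 1 / Suc m"
    have "B * norm (y - x) \<le> norm (F' (y - x))" by (rule B(2))
    also have "\<dots> \<le> norm (F y - F x) + norm (F y - F x - F' (y - x))"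
      using norm_triangle_ineq4[of "F y - F x" "F y - F x - F' (y - x)"] by simp
    also have "norm (F y - F x - F' (y - x)) \<le> B / 2 * norm (y - x)" using d(2) y m by simp
    finally have "B / 2 * norm (y - x) \<le> norm (F y - F x)" by simp
    moreover have "1 / Suc m * norm (y - x) \<le> B / 2 * norm (y - x)"
      using m by (intro mult_right_mono) auto
    ultimately show "1 / Suc m * norm (y - x) \<le> norm (F y - F x)" by linarith
  qed
qed

section \<open>The modulus inequality\<close>

context moebius_group
begin

text \<open>Lindelof's theorem extracts a countable subcover from the injectivity neighbourhoods;
  the enumeration may repeat sets.\<close>

lemma countable_chart_cover:
  obtains B :: "nat \<Rightarrow> (real^'n) set" where "\<And>j. open (B j)" "\<And>j. B j \<subseteq> unit_ball" "\<And>j. inj_on proj (B j)"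
    "(\<Union>j. B j) = unit_ball"
proof -
  define \<B> where "\<B> = {B. open B \<and> B \<subseteq> unit_ball \<and> inj_on proj B}"
  obtain \<C> where \<C>: "\<C> \<subseteq> \<B>" "countable \<C>" "\<Union>\<C> = \<Union>\<B>"
    by (rule Lindelof[of \<B>]) (auto simp: \<B>_def)
  have "\<Union>\<B> = unit_ball"
  proof (rule equalityI; rule subsetI)
    fix x assume "x \<in> \<Union>\<B>"
    then show "x \<in> unit_ball" by (auto simp only: \<B>_def)
  next
    fix x :: "real^'n" assume "x \<in> unit_ball"
    then obtain B where "open B" "x \<in> B" "B \<subseteq> unit_ball" "inj_on proj B" by (rule injective_neighbourhood)
    then show "x \<in> \<Union>\<B>" unfolding \<B>_def by blast
  qed
  then have U: "\<Union>\<C> = unit_ball" using \<C> by simp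
  have ne: "\<C> \<noteq> {}"
  proof
    assume "\<C> = {}"
    then have "(0 :: real^'n) \<in> {}" using U centre_in_ball[of "0 :: real^'n" 1] by simp
    then show False by simp
  qed
  have "from_nat_into \<C> j \<in> \<B>" for j using from_nat_into[OF ne] \<C>(1) by blast
  then have "open (from_nat_into \<C> j) \<and> from_nat_into \<C> j \<subseteq> unit_ball \<and> inj_on proj (from_nat_into \<C> j)" for j
    unfolding \<B>_def by simp
  moreover have "(\<Union>j. from_nat_into \<C> j) = unit_ball"
    using U range_from_nat_into[OF ne \<C>(2)] by metis
  ultimately show ?thesis using that[of "from_nat_into \<C>"] by simp
qed

lemma null_sets_orbit_measureD:
  assumes p0: "p0 \<in> unit_ball" and N: "N \<in> null_sets (orbit_measure G p0)"
  shows "normal_polyhedron G p0 \<inter> orbit_vimage G N \<in> null_sets hyp_volume"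
proof -
  have s: "N \<in> sets (orbit_measure G p0)" and z: "emeasure (orbit_measure G p0) N = 0"
    using N by (auto simp: null_sets_def)
  have "orbit_vimage G N \<in> sets hyp_volume" using s by (simp add: sets_orbit_measure[OF p0])
  then have "normal_polyhedron G p0 \<inter> orbit_vimage G N \<in> sets hyp_volume"
    using normal_polyhedron_sets[OF p0] by (rule sets.Int[rotated])
  then show ?thesis using z emeasure_orbit_measure[OF p0 s] by (intro null_setsI) simp_all
qed

end

context orbit_mapping
begin

definition lift_deriv :: "(real^'n) set \<Rightarrow> real^'n \<Rightarrow> real^'n \<Rightarrow> real^'n" where
  "lift_deriv B x = frechet_derivative (lift B) (at x)"

lemma lift_deriv:
  assumes B: "open B" "B \<subseteq> unit_ball" "inj_on tproj B" and x: "x \<in> lift_dom B"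
    and diff: "differentiable_at_orbit G G' f (src.proj x)"
  shows "(lift B has_derivative lift_deriv B x) (at x)"
    and "det (matrix (lift_deriv B x)) \<noteq> 0 \<Longrightarrow> lip (src.proj x) ^ CARD('n) \<le>
      K_O G G' f (src.proj x) * ennreal (hyp_jacobian (lift B) (lift_deriv B) x)"
proof -
  obtain F' where F': "(lift B has_derivative F') (at x)"
    and K: "det (matrix F') \<noteq> 0 \<Longrightarrow> lip (src.proj x) ^ CARD('n) \<le>
      K_O G G' f (src.proj x) * ennreal (\<bar>det (matrix F')\<bar> * ((1 - (norm x)\<^sup>2) / (1 - (norm (lift B x))\<^sup>2)) ^ CARD('n))"
    by (rule lift_derivative[OF B x diff]) (rule that, assumption+)
  have eq: "lift_deriv B x = F'"
    unfolding lift_deriv_def by (rule frechet_derivative_at[OF F', symmetric])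
  show "(lift B has_derivative lift_deriv B x) (at x)" unfolding eq by (rule F')
  show "lip (src.proj x) ^ CARD('n) \<le> K_O G G' f (src.proj x) * ennreal (hyp_jacobian (lift B) (lift_deriv B) x)"
    if "det (matrix (lift_deriv B x)) \<noteq> 0"
    using K that unfolding eq hyp_jacobian_def by simp
qed

text \<open>The points at which \<open>f\<close> fails to be differentiable form a null set by assumption, and those with
  vanishing Jacobian do so by Sard's theorem in the image and Luzin's condition \<open>N\<^sup>-\<^sup>1\<close>. The rest of
  the polyhedron splits into pieces on which a local lift of \<open>f\<close> is injective.\<close>

lemma good_pieces:
  assumes p0: "p0 \<in> unit_ball" and p0': "p0' \<in> unit_ball"
    and diff: "AE p in orbit_measure G p0. p \<in> D \<longrightarrow> differentiable_at_orbit G G' f p"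
    and Ninv: "luzin_N_inv (orbit_measure G p0) (orbit_measure G' p0') D D' f"
  obtains A :: "nat \<Rightarrow> (real^'n) set" and B :: "nat \<Rightarrow> (real^'n) set" and N :: "(real^'n) set"
  where "N \<in> null_sets hyp_volume" "(\<Union>k. A k) = normal_polyhedron G p0 \<inter> orbit_vimage G D - N"
    "disjoint_family A" "\<And>k. A k \<in> sets hyp_volume"
    "\<And>k. open (B k)" "\<And>k. B k \<subseteq> unit_ball" "\<And>k. inj_on tproj (B k)" "\<And>k. A k \<subseteq> lift_dom (B k)"
    "\<And>k. inj_on (lift (B k)) (A k)"
    "\<And>k x. x \<in> A k \<Longrightarrow> differentiable_at_orbit G G' f (src.proj x)"
    "\<And>k x. x \<in> A k \<Longrightarrow> det (matrix (lift_deriv (B k) x)) \<noteq> 0"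
proof -
  let ?P = "normal_polyhedron G p0"
  have P: "?P \<in> sets hyp_volume" by (rule src.normal_polyhedron_sets[OF p0])
  obtain B :: "nat \<Rightarrow> (real^'n) set" where B: "\<And>j. open (B j)" "\<And>j. B j \<subseteq> unit_ball" "\<And>j. inj_on tproj (B j)"
    "(\<Union>j. B j) = unit_ball"
    by (rule tgt.countable_chart_cover) (rule that, assumption+)
  define Od where "Od = (\<lambda>j. lift_dom (B j))"
  have O_open: "open (Od j)" for j unfolding Od_def by (rule open_lift_dom[OF B(1,2)])
  have O_ball: "Od j \<subseteq> unit_ball" for j by (auto simp: Od_def lift_dom_iff)
  have O_cover: "(\<Union>j. Od j) = orbit_vimage G D"
  proof (rule equalityI; rule subsetI)
    fix x assume "x \<in> (\<Union>j. Od j)"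
    then show "x \<in> orbit_vimage G D" by (auto simp: Od_def lift_dom_def orbit_vimage_def)
  next
    fix x assume x: "x \<in> orbit_vimage G D"
    then have "f (src.proj x) \<in> orbit_space G'" by (intro f_in_space) (simp add: orbit_vimage_def)
    then obtain y where y: "y \<in> unit_ball" "f (src.proj x) = tproj y" by (rule tgt.orbit_space_cases)
    then obtain j where "y \<in> B j" using B(4) by blast
    then have "x \<in> Od j" using x y by (auto simp: Od_def lift_dom_iff orbit_vimage_def)
    then show "x \<in> (\<Union>j. Od j)" by blast
  qed
  obtain N0 where N0: "{p \<in> space (orbit_measure G p0). \<not> (p \<in> D \<longrightarrow> differentiable_at_orbit G G' f p)} \<subseteq> N0"
    "N0 \<in> null_sets (orbit_measure G p0)"
    using diff by (auto simp: eventually_ae_filter)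
  define NN where "NN = ?P \<inter> orbit_vimage G N0"
  have NN: "NN \<in> null_sets hyp_volume" unfolding NN_def by (rule src.null_sets_orbit_measureD[OF p0 N0(2)])
  have good: "differentiable_at_orbit G G' f (src.proj x)" if "x \<in> ?P \<inter> Od j - NN" for x j
  proof -
    have x: "x \<in> ?P" "x \<in> Od j" "x \<notin> NN" using that by auto
    then have xb: "x \<in> unit_ball" and xD: "src.proj x \<in> D" by (simp_all add: Od_def lift_dom_iff)
    have "src.proj x \<notin> N0" using x xb by (auto simp: NN_def orbit_vimage_def)
    moreover have "src.proj x \<in> space (orbit_measure G p0)" using xb by (simp add: src.space_orbit_measure[OF p0])
    ultimately show ?thesis using N0(1) xD by blast
  qed
  have der: "(lift (B j) has_derivative lift_deriv (B j) x) (at x)" if "x \<in> ?P \<inter> Od j - NN" for x j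
    by (rule lift_deriv(1)[OF B(1-3) _ good[OF that]]) (use that in \<open>simp add: Od_def\<close>)
  define Z where "Z = (\<lambda>j. {x \<in> ?P \<inter> Od j - NN. det (matrix (lift_deriv (B j) x)) = 0})"
  define E where "E = (\<lambda>j. (f \<circ> src.proj) ` Z j)"
  \<comment> \<open>Sard's theorem gives a null set in the ball. It lies in \<open>B j\<close>,
    where the projection is injective, so its image in the orbit space also has measure 0.\<close>
  have E_null: "E j \<in> null_sets (orbit_measure G' p0')" for j
  proof -
    have neg: "negligible (lift (B j) ` Z j)"
    proof (rule Sard_negligible)
      fix x assume x: "x \<in> Z j"
      show "(lift (B j) has_derivative lift_deriv (B j) x) (at x within Z j)"
        by (rule has_derivative_at_withinI[OF der]) (use x in \<open>simp add: Z_def\<close>)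
      show "det (matrix (lift_deriv (B j) x)) = 0" using x by (simp add: Z_def)
    qed
    have sub: "lift (B j) ` Z j \<subseteq> B j" by (auto simp: Z_def Od_def intro: lift_in)
    have null: "lift (B j) ` Z j \<in> null_sets hyp_volume"
      unfolding null_sets_hyp_volume using neg sub B(2)[of j] by auto
    then have s: "lift (B j) ` Z j \<in> sets hyp_volume" by auto
    have inj: "inj_on tproj (lift (B j) ` Z j)" by (rule inj_on_subset[OF B(3) sub])
    have E: "E j = tproj ` lift (B j) ` Z j"
      unfolding E_def image_image by (rule image_cong) (auto simp: Z_def Od_def proj_lift)
    show ?thesis
      unfolding E using tgt.proj_image_sets[OF p0' s inj] tgt.emeasure_proj_image[OF p0' s inj] null
      by (intro null_setsI) auto
  qed
  have E_sub: "E j \<subseteq> D'" for j using f_in by (auto simp: E_def Z_def Od_def lift_dom_iff)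
  \<comment> \<open>The full preimage of \<open>E j\<close> contains \<open>Z j\<close> and is null
    by \<open>Ninv\<close>; passing to it avoids asking whether \<open>Z j\<close> is
    measurable.\<close>
  define NZ where "NZ = (\<lambda>j. ?P \<inter> orbit_vimage G {p \<in> D. f p \<in> E j})"
  have NZ: "NZ j \<in> null_sets hyp_volume" for j
    unfolding NZ_def
    by (rule src.null_sets_orbit_measureD[OF p0]) (use Ninv E_sub[of j] E_null[of j] in \<open>simp add: luzin_N_inv_def\<close>)
  have ZNZ: "Z j \<subseteq> NZ j" for j
    unfolding NZ_def Z_def[THEN fun_cong, of j] by (auto simp: E_def Z_def Od_def lift_dom_iff orbit_vimage_def)
  define N where "N = NN \<union> (\<Union>j. NZ j)"
  have N: "N \<in> null_sets hyp_volume" unfolding N_def using NN NZ by (intro null_sets.Un null_sets_UN)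
  define X where "X = ?P \<inter> orbit_vimage G D - N"
  have vD: "orbit_vimage G D \<in> sets hyp_volume"
    using D_open src.orbit_vimage_subset by (auto simp: openin_orbit_topology sets_hyp_volume)
  have X: "X \<in> sets hyp_volume" unfolding X_def using P vD N by auto
  have Xgood: "x \<in> ?P \<inter> Od j - NN" if "x \<in> X" "x \<in> Od j" for x j using that by (auto simp: X_def N_def)
  have Xdet: "det (matrix (lift_deriv (B j) x)) \<noteq> 0" if "x \<in> X" "x \<in> Od j" for x j
  proof
    assume "det (matrix (lift_deriv (B j) x)) = 0"
    then have "x \<in> NZ j" using Xgood[OF that] ZNZ[of j] by (auto simp: Z_def)
    then show False using that(1) by (auto simp: X_def N_def)
  qed
  \<comment> \<open>Points at which the lift expands by at least \<open>1 / Suc m\<close> at scale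
    \<open>1 / Suc m\<close>. Two points of a ball \<open>C\<close> are closer than this scale, so
    the lift is injective on the part of \<open>S\<close> in one such ball.\<close>
  define S where "S = (\<lambda>j m. {x \<in> Od j. \<forall>y\<in>Od j. norm (y - x) < 1 / Suc m \<longrightarrow>
    1 / Suc m * norm (y - x) \<le> norm (lift (B j) y - lift (B j) x)})"
  have S_borel: "S j m \<in> sets borel" for j m
    unfolding S_def
    by (rule expansive_set_sets[OF O_open]) (unfold Od_def, rule lift_continuous_on[OF B(1-3)])
  obtain Q :: "(real^'n) set" where Q: "countable Q" "\<And>U. open U \<Longrightarrow> U \<noteq> {} \<Longrightarrow> \<exists>d\<in>Q. d \<in> U"
    by (rule countable_dense_setE) (rule that, assumption+)
  have Q_ne: "Q \<noteq> {}" using Q(2)[of UNIV] by auto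
  define C where "C = (\<lambda>i m. ball (from_nat_into Q i) (1 / (2 * real (Suc m))))"
  have C_cover: "\<exists>i. x \<in> C i m" for x m
  proof -
    obtain d where d: "d \<in> Q" "d \<in> ball x (1 / (2 * real (Suc m)))"
      using Q(2)[of "ball x (1 / (2 * real (Suc m)))"] by auto
    obtain i where "from_nat_into Q i = d" using from_nat_into_surj[OF Q(1) d(1)] by blast
    then show ?thesis using d(2) unfolding C_def by (metis dist_commute mem_ball)
  qed
  have C_diam: "norm (y - x) < 1 / Suc m" if "x \<in> C i m" "y \<in> C i m" for x y i m
  proof -
    let ?c = "from_nat_into Q i"
    have "norm (y - x) \<le> dist ?c y + dist ?c x"
      using dist_triangle3[of y x ?c] by (simp add: dist_norm)
    also have "\<dots> < 1 / (2 * real (Suc m)) + 1 / (2 * real (Suc m))"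
      using that by (intro add_strict_mono) (simp_all add: C_def)
    finally show ?thesis by (simp add: field_simps)
  qed
  \<comment> \<open>The index \<open>k\<close> codes a triple: the target chart \<open>j\<close>,
    the scale \<open>m\<close> and the small ball \<open>i\<close>.\<close>
  define jj where "jj = (\<lambda>k. fst (prod_decode k))"
  define mm where "mm = (\<lambda>k. fst (prod_decode (snd (prod_decode k))))"
  define ii where "ii = (\<lambda>k. snd (prod_decode (snd (prod_decode k))))"
  define Y where "Y = (\<lambda>k. X \<inter> Od (jj k) \<inter> S (jj k) (mm k) \<inter> C (ii k) (mm k))"
  have Y_sets: "Y k \<in> sets hyp_volume" for k
  proof -
    have "Od (jj k) \<inter> S (jj k) (mm k) \<inter> C (ii k) (mm k) \<in> sets lborel"
      using S_borel O_open by (intro sets.Int) (auto simp: C_def)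
    then have "Od (jj k) \<inter> S (jj k) (mm k) \<inter> C (ii k) (mm k) \<in> sets lebesgue"
      by (rule sets_completionI_sets)
    then have "X \<inter> (Od (jj k) \<inter> S (jj k) (mm k) \<inter> C (ii k) (mm k)) \<in> sets lebesgue"
      using X by (intro sets.Int[of X]) (simp_all add: sets_hyp_volume)
    then show ?thesis using X by (auto simp: sets_hyp_volume Y_def Int_assoc)
  qed
  have Y_inj: "inj_on (lift (B (jj k))) (Y k)" for k
  proof (rule inj_onI)
    fix x y assume x: "x \<in> Y k" and y: "y \<in> Y k" and eq: "lift (B (jj k)) x = lift (B (jj k)) y"
    have "norm (y - x) < 1 / Suc (mm k)" using C_diam[of x "ii k" "mm k" y] x y by (simp add: Y_def)
    moreover have "x \<in> S (jj k) (mm k)" "y \<in> Od (jj k)" using x y by (simp_all add: Y_def)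
    ultimately have "1 / Suc (mm k) * norm (y - x) \<le> norm (lift (B (jj k)) y - lift (B (jj k)) x)"
      unfolding S_def by blast
    then have "1 / Suc (mm k) * norm (y - x) \<le> 0" using eq by simp
    then show "x = y" by (simp add: mult_le_0_iff divide_le_0_iff)
  qed
  have Y_cover: "(\<Union>k. Y k) = X"
  proof (rule equalityI; rule subsetI)
    fix x assume "x \<in> (\<Union>k. Y k)"
    then show "x \<in> X" by (auto simp: Y_def)
  next
    fix x assume x: "x \<in> X"
    then obtain j where j: "x \<in> Od j" using O_cover by (auto simp: X_def)
    obtain m :: nat where m: "\<And>y. norm (y - x) < 1 / Suc m \<Longrightarrow>
        1 / Suc m * norm (y - x) \<le> norm (lift (B j) y - lift (B j) x)"
      by (rule locally_expansive[OF der[OF Xgood[OF x j]] Xdet[OF x j]]) (rule that, assumption+)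
    then have xS: "x \<in> S j m" using j by (simp add: S_def)
    obtain i where i: "x \<in> C i m" using C_cover by blast
    define k where "k = prod_encode (j, prod_encode (m, i))"
    have "x \<in> Y k" using x j xS i by (simp add: Y_def jj_def mm_def ii_def k_def)
    then show "x \<in> (\<Union>k. Y k)" by blast
  qed
  have AY: "disjointed Y k \<subseteq> Y k" for k by (rule disjointed_subset)
  show ?thesis
  proof (rule that[of N "disjointed Y" "\<lambda>k. B (jj k)"])
    show "N \<in> null_sets hyp_volume" by (rule N)
    show "(\<Union>k. disjointed Y k) = ?P \<inter> orbit_vimage G D - N"
      unfolding UN_disjointed_eq Y_cover X_def ..
    show "disjoint_family (disjointed Y)" by (rule disjoint_family_disjointed)
    show "disjointed Y k \<in> sets hyp_volume" for k
      using sets.range_disjointed_sets[of Y hyp_volume] Y_sets by blast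
    show "open (B (jj k))" "B (jj k) \<subseteq> unit_ball" "inj_on tproj (B (jj k))" for k by (rule B)+
    show "disjointed Y k \<subseteq> lift_dom (B (jj k))" for k using AY[of k] by (auto simp: Y_def Od_def)
    show "inj_on (lift (B (jj k))) (disjointed Y k)" for k by (rule inj_on_subset[OF Y_inj AY])
    fix k x assume "x \<in> disjointed Y k"
    then have xY: "x \<in> X" "x \<in> Od (jj k)" using AY[of k] by (auto simp: Y_def)
    show "differentiable_at_orbit G G' f (src.proj x)" by (rule good[OF Xgood[OF xY]])
    show "det (matrix (lift_deriv (B (jj k)) x)) \<noteq> 0" by (rule Xdet[OF xY])
  qed
qed

text \<open>An infinite sum of nonnegative terms is the supremum of its finite partial sums.\<close>

lemma sum_le_K_I:
  assumes "finite F" "F \<subseteq> D \<inter> f -` {q}"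
  shows "(\<Sum>p\<in>F. K_O G G' f p) \<le> K_I G G' D f q"
  unfolding K_I_def by (subst nonneg_infsum_complete) (use assms in \<open>auto intro!: SUP_upper\<close>)

text \<open>On each piece the change of variables is an equality for the measurable weight
  \<open>lip ^ n / jacobian\<close>, which is at most \<open>K_O\<close>; so \<open>K_I\<close> itself need not be measurable.\<close>

lemma nn_integral_pullback_le:
  assumes p0: "p0 \<in> unit_ball" and p0': "p0' \<in> unit_ball"
    and diff: "AE p in orbit_measure G p0. p \<in> D \<longrightarrow> differentiable_at_orbit G G' f p"
    and Ninv: "luzin_N_inv (orbit_measure G p0) (orbit_measure G' p0') D D' f"
    and \<rho>': "\<rho>' \<in> borel_measurable (orbit_borel G')"
  shows "(\<integral>\<^sup>+p. pullback \<rho>' p ^ CARD('n) \<partial>orbit_measure G p0) \<le>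
    (\<integral>\<^sup>+q \<in> f ` D. K_I G G' D f q * \<rho>' q ^ CARD('n) \<partial>orbit_measure G' p0')"
proof -
  let ?P = "normal_polyhedron G p0" and ?n = "CARD('n)"
  obtain A B :: "nat \<Rightarrow> (real^'n) set" and N where N: "N \<in> null_sets hyp_volume"
    and A_cover: "(\<Union>k. A k) = ?P \<inter> orbit_vimage G D - N"
    and A_disj: "disjoint_family A" and A_sets: "\<And>k. A k \<in> sets hyp_volume"
    and B: "\<And>k. open (B k)" "\<And>k. B k \<subseteq> unit_ball" "\<And>k. inj_on tproj (B k)"
    and A_dom: "\<And>k. A k \<subseteq> lift_dom (B k)" and A_inj: "\<And>k. inj_on (lift (B k)) (A k)"
    and A_diff: "\<And>k x. x \<in> A k \<Longrightarrow> differentiable_at_orbit G G' f (src.proj x)"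
    and A_det: "\<And>k x. x \<in> A k \<Longrightarrow> det (matrix (lift_deriv (B k) x)) \<noteq> 0"
    by (rule good_pieces[OF p0 p0' diff Ninv]) (rule that, assumption+)
  define pb where "pb = (\<lambda>x. pullback \<rho>' (src.proj x) ^ ?n)"
  have pbm: "(\<lambda>p. pullback \<rho>' p ^ ?n) \<in> borel_measurable (orbit_measure G p0)"
    by (intro borel_measurable_power_ennreal src.orbit_borel_measurable[OF p0] pullback_measurable[OF \<rho>'])
  have pb: "pb \<in> borel_measurable hyp_volume"
    unfolding pb_def by (rule measurable_compose[OF src.proj_measurable[OF p0] pbm])
  define T where "T = f \<circ> src.proj"
  define jac where "jac = (\<lambda>k. hyp_jacobian (lift (B k)) (lift_deriv (B k)))"
  define J where "J = (\<lambda>k x. ennreal (jac k x) * indicator (A k) x)"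
  \<comment> \<open>Division by the Jacobian, carried out in the reals. On \<open>A k\<close> the
    Jacobian is positive, so \<open>J\<close> times \<open>\<Psi>\<close> returns \<open>pb\<close>;
    elsewhere \<open>J\<close> is 0 and the convention for division by 0 makes \<open>\<Psi>\<close>
    vanish.\<close>
  define \<Psi> where "\<Psi> = (\<lambda>k x. pb x * ennreal (1 / enn2real (J k x)))"
  have der: "(lift (B k) has_derivative lift_deriv (B k) x) (at x within E)" if "x \<in> A k" for k x E
    by (rule has_derivative_at_withinI[OF lift_deriv(1)[OF B subsetD[OF A_dom that] A_diff[OF that]]])
  have lift_ball: "lift (B k) ` A k \<subseteq> B k" for k using lift_in A_dom by blast
  have J: "J k \<in> borel_measurable hyp_volume" for k
    unfolding J_def jac_def
    by (rule hyp_jacobian_measurable[OF A_sets der A_inj subset_trans[OF lift_ball B(2)]])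
  have \<Psi>: "\<Psi> k \<in> borel_measurable hyp_volume" for k
    unfolding \<Psi>_def using pb J[of k] by measurable
  have T_lift: "T x = tproj (lift (B k) x)" if "x \<in> A k" for x k
    using proj_lift[OF subsetD[OF A_dom that]] by (simp add: T_def)
  have T_image: "T ` E = tproj ` lift (B k) ` E" if "E \<subseteq> A k" for E k
    unfolding image_image using T_lift that by (intro image_cong) auto
  have T_inj: "inj_on T (A k)" for k
  proof (rule inj_onI)
    fix x y assume xy: "x \<in> A k" "y \<in> A k" "T x = T y"
    then have "tproj (lift (B k) x) = tproj (lift (B k) y)" by (simp add: T_lift)
    then have "lift (B k) x = lift (B k) y"
      by (rule inj_onD[OF B(3)]) (use lift_ball[of k] xy in blast)+
    then show "x = y" using A_inj[of k] xy by (auto dest: inj_onD)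
  qed
  have piece: "E \<subseteq> A k \<Longrightarrow> E \<in> sets hyp_volume \<Longrightarrow> T ` E \<in> sets (orbit_measure G' p0') \<and>
      emeasure (orbit_measure G' p0') (T ` E) = (\<integral>\<^sup>+x. J k x * indicator E x \<partial>hyp_volume)" for E k
  proof -
    assume EA: "E \<subseteq> A k" and E: "E \<in> sets hyp_volume"
    have derE: "(lift (B k) has_derivative lift_deriv (B k) x) (at x within E)" if "x \<in> E" for x
      by (rule der) (use that EA in blast)
    have injE: "inj_on (lift (B k)) E" by (rule inj_on_subset[OF A_inj EA])
    have subE: "lift (B k) ` E \<subseteq> B k" using lift_ball EA by blast
    have ballE: "lift (B k) ` E \<subseteq> unit_ball" by (rule subset_trans[OF subE B(2)])
    have sE: "lift (B k) ` E \<in> sets hyp_volume" by (rule hyp_volume_image_sets[OF E derE injE ballE])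
    have inj': "inj_on tproj (lift (B k) ` E)" by (rule inj_on_subset[OF B(3) subE])
    have "emeasure (orbit_measure G' p0') (T ` E) = emeasure hyp_volume (lift (B k) ` E)"
      unfolding T_image[OF EA] by (rule tgt.emeasure_proj_image[OF p0' sE inj'])
    also have "\<dots> = (\<integral>\<^sup>+x. ennreal (jac k x) * indicator E x \<partial>hyp_volume)"
      unfolding jac_def by (rule hyp_volume_image[OF E derE injE ballE])
    also have "\<dots> = (\<integral>\<^sup>+x. J k x * indicator E x \<partial>hyp_volume)"
      using EA by (intro nn_integral_cong) (auto simp: J_def indicator_def)
    finally show ?thesis
      unfolding T_image[OF EA] using tgt.proj_image_sets[OF p0' sE inj'] by simp
  qed
  let ?w = "\<lambda>k q. \<Psi> k (inv_into (A k) T q) * indicator (T ` A k) q"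
  have w: "?w k \<in> borel_measurable (orbit_measure G' p0')" for k
    by (rule measurable_injective_image[OF A_sets T_inj J _ _ \<Psi>]) (use piece in blast)+
  have jac_pos: "0 < jac k x" if x: "x \<in> A k" for k x
  proof -
    have "x \<in> unit_ball" using subsetD[OF A_dom x] by (simp add: lift_dom_iff)
    moreover have "lift (B k) x \<in> unit_ball" using lift_ball B(2) x by blast
    ultimately show ?thesis
      using unit_ball_pos[of x] unit_ball_pos[of "lift (B k) x"] A_det[OF x] by (simp add: jac_def hyp_jacobian_def)
  qed
  have J\<Psi>: "J k x * \<Psi> k x * indicator (A k) x = pb x * indicator (A k) x" for k x
  proof (cases "x \<in> A k")
    case True
    have "ennreal (jac k x) * ennreal (1 / jac k x) = 1"
      using jac_pos[OF True] by (simp add: ennreal_mult[symmetric])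
    then show ?thesis
      using True jac_pos[OF True] by (simp add: J_def \<Psi>_def mult.left_commute)
  qed simp
  have w_int: "(\<integral>\<^sup>+q. ?w k q \<partial>orbit_measure G' p0') = (\<integral>\<^sup>+x. pb x * indicator (A k) x \<partial>hyp_volume)" for k
    unfolding J\<Psi>[symmetric]
    by (rule nn_integral_injective_image[OF A_sets T_inj J _ _ \<Psi>]) (use piece in blast)+
  \<comment> \<open>Each piece whose image contains \<open>q\<close> contributes one point of the
    fibre over \<open>q\<close>. These points are distinct because the pieces are disjoint parts of
    the polyhedron, on which \<open>proj\<close> is injective; so finitely many contributions are
    bounded by a partial sum of \<open>K_I\<close>.\<close>
  have pointwise: "(\<Sum>k. ?w k q) \<le> K_I G G' D f q * \<rho>' q ^ ?n * indicator (f ` D) q" for q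
  proof (cases "q \<in> f ` D")
    case False
    have "q \<notin> T ` A k" for k
      using False A_dom[of k] by (auto simp: T_def lift_dom_iff)
    then show ?thesis by simp
  next
    case True
    have "(\<Sum>k<m. ?w k q) \<le> K_I G G' D f q * \<rho>' q ^ ?n" for m
    proof -
      define I where "I = {k. k < m \<and> q \<in> T ` A k}"
      define x where "x = (\<lambda>k. inv_into (A k) T q)"
      have x: "x k \<in> A k" "T (x k) = q" if "k \<in> I" for k
        using that by (auto simp: I_def x_def inv_into_into f_inv_into_f)
      have inj: "inj_on (\<lambda>k. src.proj (x k)) I"
      proof (rule inj_onI)
        fix k l assume kl: "k \<in> I" "l \<in> I" "src.proj (x k) = src.proj (x l)"
        have "x k \<in> ?P" "x l \<in> ?P" using x(1)[OF kl(1)] x(1)[OF kl(2)] A_cover by blast+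
        then have "x k = x l" using src.normal_polyhedron_inj[OF p0] kl(3) by (auto dest: inj_onD)
        then show "k = l" using A_disj x(1)[OF kl(1)] x(1)[OF kl(2)] by (auto simp: disjoint_family_on_def)
      qed
      have term_le: "?w k q \<le> K_O G G' f (src.proj (x k)) * \<rho>' q ^ ?n" if k: "k \<in> I" for k
      proof -
        have xd: "x k \<in> lift_dom (B k)" by (rule subsetD[OF A_dom x(1)[OF k]])
        have jp: "0 < jac k (x k)" by (rule jac_pos[OF x(1)[OF k]])
        have "lip (src.proj (x k)) ^ ?n * ennreal (1 / jac k (x k)) \<le>
            K_O G G' f (src.proj (x k)) * ennreal (jac k (x k)) * ennreal (1 / jac k (x k))"
          unfolding jac_def
          by (intro mult_right_mono lift_deriv(2)[OF B xd A_diff[OF x(1)[OF k]] A_det[OF x(1)[OF k]]]) simp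
        also have "\<dots> = K_O G G' f (src.proj (x k))"
          using jp by (simp add: mult.assoc ennreal_mult[symmetric])
        finally have le: "lip (src.proj (x k)) ^ ?n * ennreal (1 / jac k (x k)) \<le> K_O G G' f (src.proj (x k))" .
        have "?w k q = \<Psi> k (x k)" using k by (simp add: I_def x_def)
        also have "\<dots> = \<rho>' q ^ ?n * (lip (src.proj (x k)) ^ ?n * ennreal (1 / jac k (x k)))"
          using x(2)[OF k] x(1)[OF k] xd jp
          by (simp add: \<Psi>_def pb_def pullback_def J_def T_def lift_dom_iff power_mult_distrib mult.assoc)
        also have "\<dots> \<le> \<rho>' q ^ ?n * K_O G G' f (src.proj (x k))" by (rule mult_left_mono[OF le]) simp
        finally show ?thesis by (simp add: mult.commute)
      qed
      have "(\<Sum>k<m. ?w k q) = (\<Sum>k\<in>I. ?w k q)"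
        by (rule sum.mono_neutral_right) (auto simp: I_def)
      also have "\<dots> \<le> (\<Sum>k\<in>I. K_O G G' f (src.proj (x k)) * \<rho>' q ^ ?n)" by (rule sum_mono[OF term_le])
      also have "\<dots> = (\<Sum>p\<in>(\<lambda>k. src.proj (x k)) ` I. K_O G G' f p) * \<rho>' q ^ ?n"
        by (simp add: sum.reindex[OF inj] sum_distrib_right)
      also have "\<dots> \<le> K_I G G' D f q * \<rho>' q ^ ?n"
      proof (intro mult_right_mono sum_le_K_I)
        show "finite ((\<lambda>k. src.proj (x k)) ` I)" by (simp add: I_def)
        show "(\<lambda>k. src.proj (x k)) ` I \<subseteq> D \<inter> f -` {q}"
        proof
          fix p assume "p \<in> (\<lambda>k. src.proj (x k)) ` I"
          then obtain k where k: "k \<in> I" "p = src.proj (x k)" by blast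
          have "x k \<in> lift_dom (B k)" by (rule subsetD[OF A_dom x(1)[OF k(1)]])
          then show "p \<in> D \<inter> f -` {q}" using x(2)[OF k(1)] k(2) by (simp add: lift_dom_iff T_def)
        qed
      qed simp
      finally show ?thesis .
    qed
    then have "(\<Sum>k. ?w k q) \<le> K_I G G' D f q * \<rho>' q ^ ?n"
      unfolding suminf_eq_SUP by (intro SUP_least)
    then show ?thesis using True by simp
  qed
  have "(\<integral>\<^sup>+p. pullback \<rho>' p ^ ?n \<partial>orbit_measure G p0) = (\<integral>\<^sup>+x. pb x * indicator ?P x \<partial>hyp_volume)"
    unfolding pb_def by (rule src.nn_integral_orbit_measure[OF p0 pbm])
  \<comment> \<open>Where the projection is outside \<open>D\<close>, \<open>pb\<close> vanishes; so
    the pieces, which cover the part over \<open>D\<close> up to \<open>N\<close>, carry the whole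
    integral.\<close>
  also have "\<dots> = (\<integral>\<^sup>+x. (\<Sum>k. pb x * indicator (A k) x) \<partial>hyp_volume)"
  proof (rule nn_integral_cong_AE)
    have "AE x in hyp_volume. x \<notin> N" by (rule AE_not_in[OF N])
    then show "AE x in hyp_volume. pb x * indicator ?P x = (\<Sum>k. pb x * indicator (A k) x)"
    proof eventually_elim
      case (elim x)
      have "(\<Sum>k. pb x * indicator (A k) x) = pb x * indicator (\<Union>k. A k) x"
        by (simp add: suminf_indicator[OF A_disj])
      also have "\<dots> = pb x * indicator ?P x"
      proof (cases "x \<in> ?P")
        case True
        then have xb: "x \<in> unit_ball" using src.normal_polyhedron_subset by blast
        show ?thesis
        proof (cases "src.proj x \<in> D")
          case True
          then show ?thesis unfolding A_cover using \<open>x \<in> ?P\<close> elim xb by (simp add: orbit_vimage_def)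
        next
          case False
          then have "pb x = 0" by (simp add: pb_def pullback_def)
          then show ?thesis by simp
        qed
      next
        case False
        then show ?thesis unfolding A_cover by simp
      qed
      finally show ?case by simp
    qed
  qed
  also have "\<dots> = (\<Sum>k. \<integral>\<^sup>+x. pb x * indicator (A k) x \<partial>hyp_volume)"
    by (rule nn_integral_suminf) (use pb A_sets in \<open>intro borel_measurable_times_ennreal borel_measurable_indicator\<close>)
  also have "\<dots> = (\<Sum>k. \<integral>\<^sup>+q. ?w k q \<partial>orbit_measure G' p0')" by (simp only: w_int)
  also have "\<dots> = (\<integral>\<^sup>+q. (\<Sum>k. ?w k q) \<partial>orbit_measure G' p0')"
    by (rule nn_integral_suminf[symmetric, OF w])
  also have "\<dots> \<le> (\<integral>\<^sup>+q \<in> f ` D. K_I G G' D f q * \<rho>' q ^ ?n \<partial>orbit_measure G' p0')"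
    by (rule nn_integral_mono) (rule pointwise)
  finally show ?thesis .
qed

end

lemma path_integral_mono:
  assumes "\<And>p. \<rho> p \<le> \<rho>' p"
  shows "path_integral \<rho> \<gamma> \<le> path_integral \<rho>' \<gamma>"
proof -
  obtain \<Delta> c where \<gamma>: "\<gamma> = (\<Delta>, c)" by (cases \<gamma>)
  show ?thesis
    unfolding path_integral_def \<gamma> prod.case
    by (rule SUP_mono') (auto intro!: nn_integral_mono mult_right_mono assms split: prod.split)
qed

theorem theorem4p1:
  fixes G G' :: "(real^'n \<Rightarrow> real^'n) set"
    and p0 p0' :: "real^'n"
    and D D' :: "(real^'n) set set"
    and f :: "(real^'n) set \<Rightarrow> (real^'n) set"
    and \<Gamma> :: "'n orbit_path set"
  assumes "CARD('n) \<ge> 2"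
    and "moebius_ball_group G" and "acts_discontinuously G" and "fixed_point_free G"
    and "moebius_ball_group G'" and "acts_discontinuously G'" and "fixed_point_free G'"
    and "p0 \<in> unit_ball" and "p0' \<in> unit_ball"
    and "orbit_domain G D" and "compactin (orbit_topology G) (orbit_topology G closure_of D)"
    and "orbit_domain G' D'" and "compactin (orbit_topology G') (orbit_topology G' closure_of D')"
    and "continuous_map (subtopology (orbit_topology G) D) (subtopology (orbit_topology G') D') f"
    and "open_map (subtopology (orbit_topology G) D) (subtopology (orbit_topology G') D') f"
    and "discrete_mapping G D D' f"
    and "AE p in orbit_measure G p0. p \<in> D \<longrightarrow> differentiable_at_orbit G G' f p"
    and "ACP G p0 D f"
    and "luzin_N (orbit_measure G p0) (orbit_measure G' p0') D f"
    and "luzin_N_inv (orbit_measure G p0) (orbit_measure G' p0') D D' f"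
    and "\<Gamma> \<subseteq> paths_in G D"
  shows "\<forall>\<rho>' \<in> adm G' (image_path f ` \<Gamma>).
    modulus G p0 \<Gamma> \<le>
      (\<integral>\<^sup>+q \<in> f ` D. K_I G G' D f q * \<rho>' q ^ CARD('n) \<partial>orbit_measure G' p0')"
proof
  let ?n = "CARD('n)"
  fix \<rho>' assume \<rho>': "\<rho>' \<in> adm G' (image_path f ` \<Gamma>)"
  interpret orbit_mapping G G' D D' f
  proof (intro orbit_mapping.intro moebius_group.intro orbit_mapping_axioms.intro)
    show "openin (orbit_topology G) D" using assms(10) by (simp add: orbit_domain_def)
    have "openin (orbit_topology G') D'" using assms(12) by (simp add: orbit_domain_def)
    then show "D' \<subseteq> orbit_space G'" using openin_subset by fastforce
  qed (use assms in auto)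
  let ?rhs = "\<integral>\<^sup>+q \<in> f ` D. K_I G G' D f q * \<rho>' q ^ ?n \<partial>orbit_measure G' p0'"
  have \<rho>'m: "\<rho>' \<in> borel_measurable (orbit_borel G')" using \<rho>' by (simp add: adm_def)
  have pm: "pullback \<rho>' \<in> borel_measurable (orbit_borel G)" by (rule pullback_measurable[OF \<rho>'m])
  have le: "(\<integral>\<^sup>+p. pullback \<rho>' p ^ ?n \<partial>orbit_measure G p0) \<le> ?rhs"
    by (rule nn_integral_pullback_le[OF assms(8,9,17,20) \<rho>'m])
  let ?Q = "\<lambda>\<gamma>. locally_rectifiable \<gamma> \<and> locally_rectifiable (image_path f \<gamma>) \<and>
     (\<exists>L. length_transfer f \<gamma> L \<and>
        (\<forall>c d. c \<le> d \<and> {c..d} \<subseteq> signed_len \<gamma> ` fst \<gamma> \<longrightarrow> abs_continuous_on_segment c d L))"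
  let ?E = "{\<gamma> \<in> paths_in G D. \<not> ?Q \<gamma>}"
  have E0: "modulus G p0 ?E = 0" using assms(18) unfolding ACP_def almost_all_paths_def .
  show "modulus G p0 \<Gamma> \<le> ?rhs"
  proof (rule ennreal_le_epsilon)
    fix e :: real assume e: "0 < e"
    then have "(INF \<rho> \<in> adm G ?E. \<integral>\<^sup>+p. \<rho> p ^ ?n \<partial>orbit_measure G p0) < ennreal e"
      using E0 unfolding modulus_def by simp
    \<comment> \<open>The density \<open>\<rho>\<^sub>1\<close> takes care of the paths on which the
      length transfer fails, at a cost below \<open>e\<close>.\<close>
    then obtain \<rho>\<^sub>1 where \<rho>1: "\<rho>\<^sub>1 \<in> adm G ?E" "(\<integral>\<^sup>+p. \<rho>\<^sub>1 p ^ ?n \<partial>orbit_measure G p0) < ennreal e"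
      unfolding INF_less_iff by blast
    have \<rho>1m: "\<rho>\<^sub>1 \<in> borel_measurable (orbit_borel G)" using \<rho>1(1) by (simp add: adm_def)
    \<comment> \<open>A maximum rather than a sum, because its \<open>n\<close>-th power is at most
      the sum of the \<open>n\<close>-th powers.\<close>
    define \<rho> where "\<rho> = (\<lambda>p. max (pullback \<rho>' p) (\<rho>\<^sub>1 p))"
    have "\<rho> \<in> adm G \<Gamma>"
      unfolding adm_def
    proof (intro CollectI conjI ballI impI)
      show "\<rho> \<in> borel_measurable (orbit_borel G)" unfolding \<rho>_def using pm \<rho>1m by measurable
      fix \<gamma> assume \<gamma>: "\<gamma> \<in> \<Gamma>" "locally_rectifiable \<gamma>"
      show "1 \<le> path_integral \<rho> \<gamma>"
      proof (cases "?Q \<gamma>")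
        case True
        obtain \<Delta> c where g: "\<gamma> = (\<Delta>, c)" by (cases \<gamma>)
        obtain L where L: "length_transfer f \<gamma> L"
          "\<And>c d. c \<le> d \<Longrightarrow> {c..d} \<subseteq> signed_len \<gamma> ` fst \<gamma> \<Longrightarrow> abs_continuous_on_segment c d L"
          using True by blast
        have "1 \<le> path_integral \<rho>' (image_path f \<gamma>)" using \<rho>' \<gamma>(1) True by (simp add: adm_def)
        also have "\<dots> \<le> path_integral (pullback \<rho>') \<gamma>"
          unfolding g
          by (rule path_integral_pullback[OF _ _ _ _ _ \<rho>'m, where L = L])
            (use assms(21) \<gamma> True L g in auto)
        also have "\<dots> \<le> path_integral \<rho> \<gamma>" by (rule path_integral_mono) (simp add: \<rho>_def)
        finally show ?thesis .
      next
        case False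
        then have "1 \<le> path_integral \<rho>\<^sub>1 \<gamma>" using \<rho>1(1) \<gamma> assms(21) unfolding adm_def by blast
        also have "\<dots> \<le> path_integral \<rho> \<gamma>" by (rule path_integral_mono) (simp add: \<rho>_def)
        finally show ?thesis .
      qed
    qed
    then have "modulus G p0 \<Gamma> \<le> (\<integral>\<^sup>+p. \<rho> p ^ ?n \<partial>orbit_measure G p0)"
      unfolding modulus_def by (rule INF_lower)
    also have "\<dots> \<le> (\<integral>\<^sup>+p. pullback \<rho>' p ^ ?n + \<rho>\<^sub>1 p ^ ?n \<partial>orbit_measure G p0)"
      by (rule nn_integral_mono) (auto simp: \<rho>_def max_def)
    also have "\<dots> = (\<integral>\<^sup>+p. pullback \<rho>' p ^ ?n \<partial>orbit_measure G p0) + (\<integral>\<^sup>+p. \<rho>\<^sub>1 p ^ ?n \<partial>orbit_measure G p0)"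
      by (intro nn_integral_add borel_measurable_power_ennreal src.orbit_borel_measurable assms(8) pm \<rho>1m)
    also have "\<dots> \<le> ?rhs + ennreal e" by (intro add_mono le less_imp_le[OF \<rho>1(2)])
    finally show "modulus G p0 \<Gamma> \<le> ?rhs + ennreal e" .
  qed
qed

end
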